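(* Let $W$ be a weak $V$-module and $z$ a nonzero complex number. Let $Y_{P(z)}$ be the linear map $V\otimes V\to(\mathrm{End}\,\mathcal D_{P(z)}(W))[[x,x^{-1}]]$ determined by $Y_{P(z)}(u\otimes v,x)=Y^L_{P(z)}(u,x)Y^R_{P(z)}(v,x)$ for $u,v\in V$. Then $(\mathcal D_{P(z)}(W),Y_{P(z)})$ is a weak module for the tensor product vertex operator algebra $V\otimes V$.
   Context: $V$ is a vertex operator algebra with vacuum $\mathbf 1$, Virasoro element $\omega$, $Y(\omega,x)=\sum_{n}L(n)x^{-n-2}$, and $V=\coprod_{n\in\mathbb Z}V_{(n)}$ graded by $L(0)$-eigenvalues. $V\otimes V$ is the tensor product vertex operator algebra with $Y(u\otimes v,x)=Y(u,x)\otimes Y(v,x)$. The formal delta function is $\delta(x)=\sum_{n\in\mathbb Z}x^n$; binomial expressions $(x_1-x_2)^n$ are expanded in nonnegative powers of the second variable. A weak $V$-module is a vector space $W$ with a linear map $Y_W:V\to(\mathrm{End}\,W)[[x,x^{-1}]]$ such that $Y_W(v,x)w\in W((x))$, $Y_W(\mathbf 1,x)=\mathrm{id}_W$, and the Jacobi identity $x_0^{-1}\delta(\frac{x_1-x_2}{x_0})Y_W(u,x_1)Y_W(v,x_2)-x_0^{-1}\delta(\frac{x_2-x_1}{-x_0})Y_W(v,x_2)Y_W(u,x_1)=x_2^{-1}\delta(\frac{x_1-x_0}{x_2})Y_W(Y(u,x_0)v,x_2)$ holds (weak modules for $V\otimes V$ are defined likewise). For $v\in V$ set $Y^o(v,x)=Y_W(e^{xL(1)}(-x^{-2})^{L(0)}v,x^{-1})$;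 then $Y^o(v,x)w\in W((x^{-1}))$. For a nonzero complex number $z$, $\alpha\in W^*$ is a $P(z)$-linear functional if for all $v\in V,w\in W$ the series $\langle\alpha,Y^o(v,x)w\rangle$ converges absolutely in $|x|>|z|$ to a rational function in $\mathbb C[x,x^{-1},(x-z)^{-1}]$, and for each fixed $v$ the orders of the poles at $0$ and at $z$ of these rational functions are bounded independently of $w$. $\mathcal D_{P(z)}(W)$ is the space of $P(z)$-linear functionals on $W$. Let $\iota_{x;\infty}$ and $\iota_{x;0}$ be the injective maps from the field $\mathbb C(x)$ of rational functions to Laurent series sending a rational function to its Laurent expansion at $x=\infty$ and at $x=0$, respectively. For $v\in V$, $\alpha\in\mathcal D_{P(z)}(W)$, $w\in W$, let $f_{v,\alpha,w}=\iota_{x;\infty}^{-1}\langle\alpha,Y^o(v,x)w\rangle$; define $Y^R_{P(z)}(v,x)\alpha,\ Y^L_{P(z)}(v,x)\alpha\in W^*[[x,x^{-1}]]$ by $\langle Y^R_{P(z)}(v,x)\alpha,w\rangle=\iota_{x;0}f_{v,\alpha,w}(x)$ and $\langle Y^L_{P(z)}(v,x)\alpha,w\rangle=\iota_{x;0}\big(f_{v,\alpha,w}(x+z)\big)$. *)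

theory Defs
  imports "HOL-Analysis.Analysis" "HOL-Computational_Algebra.Polynomial"
begin

text \<open>
A complex vector space is a type 'v :: ab_group_add together with a scalar
multiplication sc :: complex => 'v => 'v satisfying the library locale vector_space.
A vertex operator Y(u,x) = sum_n u_n x^(-n-1) is given by its modes:
Y u n v = u_n v.  Weak module vertex operators likewise: YW v n w = v_n w.
Formal-series identities (Jacobi identity) are stated coefficientwise; all sums
occurring are finite, and fsum sums over the (finite) support.
\<close>

definition fsum :: "(nat \<Rightarrow> 'a::comm_monoid_add) \<Rightarrow> 'a" where
  "fsum t = sum t {i. t i \<noteq> 0}"

definition isum :: "(int \<Rightarrow> 'a::comm_monoid_add) \<Rightarrow> 'a" where
  "isum t = sum t {i. t i \<noteq> 0}"

text \<open>Binomial coefficient with integer upper entry (expansion of (x1 - x2)^m in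
nonnegative powers of x2).\<close>
definition ibin :: "int \<Rightarrow> nat \<Rightarrow> complex" where
  "ibin m i = (of_int m) gchoose i"

text \<open>Coefficient of x0^(-l-1) x1^(-m-1) x2^(-n-1) in the Jacobi identity
 (component form), for a vertex operator A acting on a space with scalar mult sc;
 Yuv k = (Y(u,x0)v)_k as an operator, i.e. the composite Y(u_k v, x2).\<close>
definition jacobi_coeff ::
  "(complex \<Rightarrow> 'm::ab_group_add \<Rightarrow> 'm) \<Rightarrow> (int \<Rightarrow> 'm \<Rightarrow> 'm) \<Rightarrow> (int \<Rightarrow> 'm \<Rightarrow> 'm)
    \<Rightarrow> (int \<Rightarrow> int \<Rightarrow> 'm \<Rightarrow> 'm) \<Rightarrow> int \<Rightarrow> int \<Rightarrow> int \<Rightarrow> 'm \<Rightarrow> bool" where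
  "jacobi_coeff sc Au Av Auv l m n w \<longleftrightarrow>
     fsum (\<lambda>i. sc ((-1)^i * ibin l i) (Au (l+m-int i) (Av (n+int i) w)))
     - sc ((-1) powi l) (fsum (\<lambda>i. sc ((-1)^i * ibin l i) (Av (l+n-int i) (Au (m+int i) w))))
     = fsum (\<lambda>i. sc (ibin m i) (Auv (l+int i) (m+n-int i) w))"
(* (Auv k j) = j-th mode of Y(u_k v, x) *)

definition Lop :: "('v \<Rightarrow> int \<Rightarrow> 'v \<Rightarrow> 'v) \<Rightarrow> 'v \<Rightarrow> int \<Rightarrow> 'v \<Rightarrow> 'v" where
  "Lop Y om n = Y om (n+1)"   \<comment> \<open>Y(omega,x) = sum L(n) x^(-n-2)\<close>

definition hom_space :: "(complex \<Rightarrow> 'v \<Rightarrow> 'v) \<Rightarrow> ('v \<Rightarrow> int \<Rightarrow> 'v \<Rightarrow> 'v) \<Rightarrow> 'v \<Rightarrow> int \<Rightarrow> 'v set" where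
  "hom_space sc Y om k = {v. Lop Y om 0 v = sc (of_int k) v}"

definition voa :: "(complex \<Rightarrow> 'v::ab_group_add \<Rightarrow> 'v) \<Rightarrow> ('v \<Rightarrow> int \<Rightarrow> 'v \<Rightarrow> 'v) \<Rightarrow> 'v \<Rightarrow> 'v \<Rightarrow> bool" where
  "voa sc Y vac om \<longleftrightarrow>
     vector_space sc
   \<and> (\<forall>u n. Vector_Spaces.linear sc sc (Y u n))
   \<and> (\<forall>n v. Vector_Spaces.linear sc sc (\<lambda>u. Y u n v))
   \<and> (\<forall>u v. \<exists>N. \<forall>n\<ge>N. Y u n v = 0)
   \<and> (\<forall>n v. Y vac n v = (if n = -1 then v else 0))
   \<and> (\<forall>u. (\<forall>n\<ge>0. Y u n vac = 0) \<and> Y u (-1) vac = u)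
   \<and> (\<forall>u v w l m n. jacobi_coeff sc (Y u) (Y v) (\<lambda>k. Y (Y u k v)) l m n w)
   \<and> (\<exists>c::complex. \<forall>m n v.
        Lop Y om m (Lop Y om n v) - Lop Y om n (Lop Y om m v)
        = sc (of_int (m-n)) (Lop Y om (m+n) v)
          + (if m + n = 0 then sc ((of_int m ^ 3 - of_int m) / 12 * c) v else 0))
   \<and> (\<forall>v n w. Y (Lop Y om (-1) v) n w = sc (- of_int n) (Y v (n-1) w))
   \<and> (\<forall>v. \<exists>c::int \<Rightarrow> 'v. finite {k. c k \<noteq> 0} \<and> (\<forall>k. c k \<in> hom_space sc Y om k)
          \<and> v = sum c {k. c k \<noteq> 0})
   \<and> (\<forall>k. \<exists>B. finite B \<and> hom_space sc Y om k \<subseteq> module.span sc B)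
   \<and> (\<exists>N. \<forall>k<N. hom_space sc Y om k = {0})"

definition weak_module ::
  "(complex \<Rightarrow> 'v::ab_group_add \<Rightarrow> 'v) \<Rightarrow> ('v \<Rightarrow> int \<Rightarrow> 'v \<Rightarrow> 'v) \<Rightarrow> 'v
   \<Rightarrow> (complex \<Rightarrow> 'w::ab_group_add \<Rightarrow> 'w) \<Rightarrow> ('v \<Rightarrow> int \<Rightarrow> 'w \<Rightarrow> 'w) \<Rightarrow> bool" where
  "weak_module scV Y vac scW YW \<longleftrightarrow>
     vector_space scW
   \<and> (\<forall>v n. Vector_Spaces.linear scW scW (YW v n))
   \<and> (\<forall>n w. Vector_Spaces.linear scV scW (\<lambda>v. YW v n w))
   \<and> (\<forall>v w. \<exists>N. \<forall>n\<ge>N. YW v n w = 0)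
   \<and> (\<forall>n w. YW vac n w = (if n = -1 then w else 0))
   \<and> (\<forall>u v w l m n. jacobi_coeff scW (YW u) (YW v) (\<lambda>k. YW (Y u k v)) l m n w)"

text \<open>Elements of V (x) V are finite sums of pure tensors u (x) v, represented by pairs.
A linear map on V (x) V is the same as a bilinear map on pairs; we therefore give the
vertex operator of a V (x) V-module on pure tensors, Yt (u,v) n = (u (x) v)_n, and require
bilinearity.  The module is a subspace M of the functionals 'w => complex (pointwise
operations).  The tensor product vertex operator is
Y(u1 (x) v1, x)(u2 (x) v2) = Y(u1,x)u2 (x) Y(v1,x)v2, whose k-th mode is
sum_p (u1_p u2) (x) (v1_(k-1-p) v2); acting through the linear extension of Yt.\<close>

definition tensor_mode_op ::
  "('v::zero \<Rightarrow> int \<Rightarrow> 'v \<Rightarrow> 'v) \<Rightarrow> ('v \<times> 'v \<Rightarrow> int \<Rightarrow> ('w \<Rightarrow> complex) \<Rightarrow> ('w \<Rightarrow> complex))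
    \<Rightarrow> 'v \<times> 'v \<Rightarrow> 'v \<times> 'v \<Rightarrow> int \<Rightarrow> int \<Rightarrow> ('w \<Rightarrow> complex) \<Rightarrow> ('w \<Rightarrow> complex)" where
  "tensor_mode_op Y Yt a b k j \<alpha> = (\<lambda>w.
     sum (\<lambda>p. Yt (Y (fst a) p (fst b), Y (snd a) (k-1-p) (snd b)) j \<alpha> w)
         {p. Y (fst a) p (fst b) \<noteq> 0 \<and> Y (snd a) (k-1-p) (snd b) \<noteq> 0})"

definition weak_tensor_module ::
  "(complex \<Rightarrow> 'v::ab_group_add \<Rightarrow> 'v) \<Rightarrow> ('v \<Rightarrow> int \<Rightarrow> 'v \<Rightarrow> 'v) \<Rightarrow> 'v
   \<Rightarrow> ('w \<Rightarrow> complex) set \<Rightarrow> ('v \<times> 'v \<Rightarrow> int \<Rightarrow> ('w \<Rightarrow> complex) \<Rightarrow> ('w \<Rightarrow> complex)) \<Rightarrow> bool" where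
  "weak_tensor_module sc Y vac M Yt \<longleftrightarrow>
     (\<lambda>w. 0) \<in> M
   \<and> (\<forall>\<alpha>\<in>M. \<forall>\<beta>\<in>M. \<forall>c. (\<lambda>w. c * \<alpha> w + \<beta> w) \<in> M)
   \<and> (\<forall>a n. \<forall>\<alpha>\<in>M. Yt a n \<alpha> \<in> M)
   \<and> (\<forall>a n. \<forall>\<alpha>\<in>M. \<forall>\<beta>\<in>M. \<forall>c.
        Yt a n (\<lambda>w. c * \<alpha> w + \<beta> w) = (\<lambda>w. c * Yt a n \<alpha> w + Yt a n \<beta> w))
   \<and> (\<forall>u1 u2 v n c. \<forall>\<alpha>\<in>M.
        Yt (sc c u1 + u2, v) n \<alpha> = (\<lambda>w. c * Yt (u1,v) n \<alpha> w + Yt (u2,v) n \<alpha> w)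
      \<and> Yt (v, sc c u1 + u2) n \<alpha> = (\<lambda>w. c * Yt (v,u1) n \<alpha> w + Yt (v,u2) n \<alpha> w))
   \<and> (\<forall>a. \<forall>\<alpha>\<in>M. \<exists>N. \<forall>n\<ge>N. Yt a n \<alpha> = (\<lambda>w. 0))
   \<and> (\<forall>n. \<forall>\<alpha>\<in>M. Yt (vac, vac) n \<alpha> = (if n = -1 then \<alpha> else (\<lambda>w. 0)))
   \<and> (\<forall>a b l m n. \<forall>\<alpha>\<in>M. \<forall>w.
        fsum (\<lambda>i. (-1)^i * ibin l i * Yt a (l+m-int i) (Yt b (n+int i) \<alpha>) w)
        - (-1) powi l * fsum (\<lambda>i. (-1)^i * ibin l i * Yt b (l+n-int i) (Yt a (m+int i) \<alpha>) w)
        = fsum (\<lambda>i. ibin m i * tensor_mode_op Y Yt a b (l+int i) (m+n-int i) \<alpha> w))"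

definition hcomp :: "(complex \<Rightarrow> 'v::ab_group_add \<Rightarrow> 'v) \<Rightarrow> ('v \<Rightarrow> int \<Rightarrow> 'v \<Rightarrow> 'v) \<Rightarrow> 'v \<Rightarrow> 'v \<Rightarrow> int \<Rightarrow> 'v" where
  "hcomp sc Y om v = (THE c. finite {k. c k \<noteq> 0} \<and> (\<forall>k. c k \<in> hom_space sc Y om k)
                          \<and> v = sum c {k. c k \<noteq> 0})"

text \<open>Coefficient of x^p in Y^o(v,x) w = Y_W(e^(x L(1)) (-x^(-2))^(L(0)) v, x^(-1)) w.
For v of weight k: Y^o(v,x) = sum_j (-1)^k / j! x^(j-2k) Y_W(L(1)^j v, x^(-1)),
and Y_W(u,x^(-1)) = sum_m u_m x^(m+1).\<close>
definition Yopp ::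
  "(complex \<Rightarrow> 'v::ab_group_add \<Rightarrow> 'v) \<Rightarrow> ('v \<Rightarrow> int \<Rightarrow> 'v \<Rightarrow> 'v) \<Rightarrow> 'v
   \<Rightarrow> (complex \<Rightarrow> 'w::ab_group_add \<Rightarrow> 'w) \<Rightarrow> ('v \<Rightarrow> int \<Rightarrow> 'w \<Rightarrow> 'w) \<Rightarrow> 'v \<Rightarrow> int \<Rightarrow> 'w \<Rightarrow> 'w" where
  "Yopp scV Y om scW YW v p w =
     sum (\<lambda>k. sum (\<lambda>j. scW ((-1) powi k / of_nat (fact j))
                        (YW ((Lop Y om 1 ^^ j) (hcomp scV Y om v k)) (p - int j + 2*k - 1) w))
                  {j. (Lop Y om 1 ^^ j) (hcomp scV Y om v k) \<noteq> 0})
         {k. hcomp scV Y om v k \<noteq> 0}"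

definition conv_abs :: "(int \<Rightarrow> complex) \<Rightarrow> complex \<Rightarrow> complex \<Rightarrow> bool" where
  "conv_abs a x s \<longleftrightarrow> (\<lambda>p. norm (a p * x powi p)) summable_on UNIV
                      \<and> ((\<lambda>p. a p * x powi p) has_sum s) UNIV"

text \<open>Rational functions in C[x, x^(-1), (x-z)^(-1)] with pole orders at most A at 0
and at most B at z are exactly q(x) / (x^A (x-z)^B) with q a polynomial.\<close>
definition ratfun_z :: "complex \<Rightarrow> nat \<Rightarrow> nat \<Rightarrow> complex poly \<Rightarrow> complex \<Rightarrow> complex" where
  "ratfun_z z A B q = (\<lambda>x. poly q x / (x ^ A * (x - z) ^ B))"

definition Pz_linear ::
  "(complex \<Rightarrow> 'v::ab_group_add \<Rightarrow> 'v) \<Rightarrow> ('v \<Rightarrow> int \<Rightarrow> 'v \<Rightarrow> 'v) \<Rightarrow> 'v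
   \<Rightarrow> (complex \<Rightarrow> 'w::ab_group_add \<Rightarrow> 'w) \<Rightarrow> ('v \<Rightarrow> int \<Rightarrow> 'w \<Rightarrow> 'w) \<Rightarrow> complex
   \<Rightarrow> ('w \<Rightarrow> complex) \<Rightarrow> bool" where
  "Pz_linear scV Y om scW YW z \<alpha> \<longleftrightarrow>
     Vector_Spaces.linear scW (*) \<alpha>
   \<and> (\<forall>v. \<exists>A B. \<forall>w. \<exists>q. \<forall>x. norm x > norm z \<longrightarrow>
          conv_abs (\<lambda>p. \<alpha> (Yopp scV Y om scW YW v p w)) x (ratfun_z z A B q x))"

definition Dz ::
  "(complex \<Rightarrow> 'v::ab_group_add \<Rightarrow> 'v) \<Rightarrow> ('v \<Rightarrow> int \<Rightarrow> 'v \<Rightarrow> 'v) \<Rightarrow> 'v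
   \<Rightarrow> (complex \<Rightarrow> 'w::ab_group_add \<Rightarrow> 'w) \<Rightarrow> ('v \<Rightarrow> int \<Rightarrow> 'w \<Rightarrow> 'w) \<Rightarrow> complex
   \<Rightarrow> ('w \<Rightarrow> complex) set" where
  "Dz scV Y om scW YW z = {\<alpha>. Pz_linear scV Y om scW YW z \<alpha>}"

text \<open>f_{v,alpha,w} = iota_{x;infinity}^(-1) <alpha, Y^o(v,x) w>.\<close>
definition fvaw ::
  "(complex \<Rightarrow> 'v::ab_group_add \<Rightarrow> 'v) \<Rightarrow> ('v \<Rightarrow> int \<Rightarrow> 'v \<Rightarrow> 'v) \<Rightarrow> 'v
   \<Rightarrow> (complex \<Rightarrow> 'w::ab_group_add \<Rightarrow> 'w) \<Rightarrow> ('v \<Rightarrow> int \<Rightarrow> 'w \<Rightarrow> 'w) \<Rightarrow> complex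
   \<Rightarrow> 'v \<Rightarrow> ('w \<Rightarrow> complex) \<Rightarrow> 'w \<Rightarrow> complex \<Rightarrow> complex" where
  "fvaw scV Y om scW YW z v \<alpha> w = (SOME f. \<exists>A B q. f = ratfun_z z A B q \<and>
      (\<forall>x. norm x > norm z \<longrightarrow> conv_abs (\<lambda>p. \<alpha> (Yopp scV Y om scW YW v p w)) x (f x)))"

text \<open>iota_{x;0}: coefficients of the Laurent expansion at x = 0 of a function which
is given by a convergent Laurent series on the punctured disc 0 < |x| < r
(r = |z| covers the rational functions occurring here: poles only at 0 and z, resp.
at 0 and -z).\<close>
definition iota0 :: "real \<Rightarrow> (complex \<Rightarrow> complex) \<Rightarrow> int \<Rightarrow> complex" where
  "iota0 r f = (THE c. \<forall>x. 0 < norm x \<and> norm x < r \<longrightarrow> conv_abs c x (f x))"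

text \<open>Coefficients of x^n in Y^R_{P(z)}(v,x) alpha and Y^L_{P(z)}(v,x) alpha.\<close>
definition YR ::
  "(complex \<Rightarrow> 'v::ab_group_add \<Rightarrow> 'v) \<Rightarrow> ('v \<Rightarrow> int \<Rightarrow> 'v \<Rightarrow> 'v) \<Rightarrow> 'v
   \<Rightarrow> (complex \<Rightarrow> 'w::ab_group_add \<Rightarrow> 'w) \<Rightarrow> ('v \<Rightarrow> int \<Rightarrow> 'w \<Rightarrow> 'w) \<Rightarrow> complex
   \<Rightarrow> 'v \<Rightarrow> int \<Rightarrow> ('w \<Rightarrow> complex) \<Rightarrow> ('w \<Rightarrow> complex)" where
  "YR scV Y om scW YW z v n \<alpha> = (\<lambda>w. iota0 (norm z) (fvaw scV Y om scW YW z v \<alpha> w) n)"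

definition YL ::
  "(complex \<Rightarrow> 'v::ab_group_add \<Rightarrow> 'v) \<Rightarrow> ('v \<Rightarrow> int \<Rightarrow> 'v \<Rightarrow> 'v) \<Rightarrow> 'v
   \<Rightarrow> (complex \<Rightarrow> 'w::ab_group_add \<Rightarrow> 'w) \<Rightarrow> ('v \<Rightarrow> int \<Rightarrow> 'w \<Rightarrow> 'w) \<Rightarrow> complex
   \<Rightarrow> 'v \<Rightarrow> int \<Rightarrow> ('w \<Rightarrow> complex) \<Rightarrow> ('w \<Rightarrow> complex)" where
  "YL scV Y om scW YW z v n \<alpha> =
     (\<lambda>w. iota0 (norm z) (\<lambda>x. fvaw scV Y om scW YW z v \<alpha> w (x + z)) n)"

text \<open>Y_{P(z)}(u (x) v, x) = Y^L(u,x) Y^R(v,x): its k-th mode (coefficient of x^(-k-1)),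
evaluated at w, is sum_i <Y^L_i(u) Y^R_(-k-1-i)(v) alpha, w>.\<close>
definition YPz ::
  "(complex \<Rightarrow> 'v::ab_group_add \<Rightarrow> 'v) \<Rightarrow> ('v \<Rightarrow> int \<Rightarrow> 'v \<Rightarrow> 'v) \<Rightarrow> 'v
   \<Rightarrow> (complex \<Rightarrow> 'w::ab_group_add \<Rightarrow> 'w) \<Rightarrow> ('v \<Rightarrow> int \<Rightarrow> 'w \<Rightarrow> 'w) \<Rightarrow> complex
   \<Rightarrow> 'v \<times> 'v \<Rightarrow> int \<Rightarrow> ('w \<Rightarrow> complex) \<Rightarrow> ('w \<Rightarrow> complex)" where
  "YPz scV Y om scW YW z a k \<alpha> = (\<lambda>w.
     isum (\<lambda>i. YL scV Y om scW YW z (fst a) i (YR scV Y om scW YW z (snd a) (-k-1-i) \<alpha>) w))"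

end

theory Submission imports Defs begin

text \<open>
Everything is done on coefficients.  For \<open>\<alpha>\<close> in \<open>\<D>\<close> a matrix coefficient of \<open>Y\<^sup>o(v, x)\<close> is a series
\<open>a\<close> with \<open>(x - z)\<^sup>B a\<close> a Laurent polynomial, and passing to its expansion at \<open>0\<close> is a purely algebraic
operation.  The field \<open>Y\<^sup>L\<close> is treated like \<open>Y\<^sup>R\<close> after the translation \<open>x \<mapsto> x + z\<close>, which
replaces the pair of poles \<open>0, z\<close> by \<open>-z, 0\<close>.

The opposite operators are mutually local and satisfy the opposite Jacobi identity, which comes from
the Jacobi identity on \<open>W\<close> and the conjugation formula for \<open>e\<^bsup>xL(1)\<^esup>\<close>.  Locality shows that the coefficients of
\<open>Y\<^sup>R(v, x)\<alpha>\<close> and \<open>Y\<^sup>L(v, x)\<alpha>\<close> stay in \<open>\<D>\<close>, that both families of fields are local, and, because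
\<open>x\<^sub>1 - x\<^sub>2 - z\<close> is invertible as a power series, that \<open>Y\<^sup>L\<close> and \<open>Y\<^sup>R\<close> commute.  The residue form (\<open>m = 0\<close>) of
the Jacobi identity survives the change of expansion since both sides agree after multiplication by a power
of \<open>x - z\<close>.  For the tensor product one compares Taylor coefficients along the diagonal.
\<close>


section \<open>Formal series in one and two variables\<close>

text \<open>A functional reverses the order of operators:
  \<open>Op t u a (Op t' v b \<alpha>) w\<close> is read off from
  \<open>\<alpha> (XT t' v b (XT t u a w))\<close>. The opposite Jacobi identity is reversed as
  well, and the two reversals cancel, so an ordinary module results. The main obstacle is
  uniformity. Membership in D demands pole orders that do not depend on w, while a product of modes
  is a nested expansion whose bounds grow with the power of the other variable. Hence the locality
  exponent is chosen before the functional and the vector, and the expansion lemmas record explicit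
  exponents and lower bounds. For two fields with the same base point, only the product with (x1 -
  x2)^N is bounded below in both variables at once, and it is there that factors can be cancelled.
  Convergence enters only where the algebraic description is matched with the given
  definitions.\<close>

lemma funpow_swap:
  assumes "\<And>x. f (g x) = g (f x)"
  shows "(f ^^ n) ((g ^^ k) x) = (g ^^ k) ((f ^^ n) x)"
proof -
  have *: "f ((g ^^ k) x) = (g ^^ k) (f x)" for x
    by (induction k) (auto simp: assms)
  show ?thesis by (induction n) (auto simp: *)
qed

text \<open>A series \<open>\<Sum>\<^sub>p a\<^sub>p x\<^sup>p\<close> is its coefficient function \<open>a\<close>, and \<open>mx c\<close> is multiplication by \<open>x - c\<close>.\<close>

definition mx :: "complex \<Rightarrow> (int \<Rightarrow> complex) \<Rightarrow> int \<Rightarrow> complex" where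
  "mx c a = (\<lambda>p. a (p - 1) - c * a p)"

lemma mx_ap: "mx c a p = a (p - 1) - c * a p"
  by (simp add: mx_def)

lemma mx_lin: "(mx c ^^ n) (\<lambda>p. k * a p + b p) = (\<lambda>p. k * (mx c ^^ n) a p + (mx c ^^ n) b p)"
  by (induction n) (auto simp: mx_ap fun_eq_iff algebra_simps)

lemma mx_zero: "(mx c ^^ n) (\<lambda>p. 0) = (\<lambda>p. 0)"
  by (induction n) (auto simp: mx_ap)

lemma mx_diff: "(mx c ^^ n) (\<lambda>p. a p - b p) = (\<lambda>p. (mx c ^^ n) a p - (mx c ^^ n) b p)"
  using mx_lin[of n c "-1" b a] by simp

lemma mx_comm: "mx c (mx d a) = mx d (mx c a)"
  by (auto simp: mx_ap fun_eq_iff algebra_simps)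

lemma mx_pow_comm: "(mx c ^^ n) ((mx d ^^ k) a) = (mx d ^^ k) ((mx c ^^ n) a)"
  by (intro funpow_swap mx_comm)

lemma mx_low: "(\<And>p. p < L \<Longrightarrow> a p = 0) \<Longrightarrow> p < L \<Longrightarrow> (mx c ^^ n) a p = 0"
  by (induction n arbitrary: p) (auto simp: mx_ap)

lemma mx_0_pow: "(mx 0 ^^ n) a p = a (p - int n)"
  by (induction n arbitrary: p) (auto simp: mx_ap algebra_simps)

text \<open>Below L the equation reads a_p = a_(p-1) / c, so zeros propagate upwards from L0. The
  lower bound is essential: the two-sided series of all c^(-p) x^p is annihilated by x - c.\<close>

lemma mx_inj_low1:
  assumes c: "c \<noteq> 0" and L0: "\<And>p. p < L0 \<Longrightarrow> a p = 0" and L: "\<And>p. p < L \<Longrightarrow> mx c a p = 0"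
    and "p < L"
  shows "a p = 0"
proof -
  have "\<forall>p. p < L0 + int n \<longrightarrow> p < L \<longrightarrow> a p = 0" for n
  proof (induction n)
    case 0 then show ?case using L0 by auto
  next
    case (Suc n)
    show ?case
    proof (intro allI impI)
      fix p assume p: "p < L0 + int (Suc n)" "p < L"
      have "a (p - 1) = 0" using Suc p by auto
      moreover have "a (p - 1) - c * a p = 0" using L[OF p(2)] by (simp add: mx_ap)
      ultimately show "a p = 0" using c by simp
    qed
  qed
  from this[of "nat (p - L0 + 1)"] show ?thesis using \<open>p < L\<close> by (auto split: if_splits)
qed

lemma mx_inj_low:
  assumes c: "c \<noteq> 0" and L0: "\<And>p. p < L0 \<Longrightarrow> a p = 0" and L: "\<And>p. p < L \<Longrightarrow> (mx c ^^ n) a p = 0"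
    and "p < L"
  shows "a p = 0"
  using L \<open>p < L\<close>
proof (induction n arbitrary: p)
  case 0 then show ?case by auto
next
  case (Suc n)
  have "\<And>p. p < L \<Longrightarrow> (mx c ^^ n) a p = 0"
    using mx_inj_low1[OF c, of L0 "(mx c ^^ n) a" L] mx_low[OF L0] Suc.prems by auto
  then show ?case using Suc by blast
qed

lemma mx_inj:
  assumes "c \<noteq> 0" "\<And>p. p < L \<Longrightarrow> a p = 0" "(mx c ^^ n) a = (mx c ^^ n) b" "\<And>p. p < L' \<Longrightarrow> b p = 0"
  shows "a = b"
proof
  fix p
  have "a p - b p = 0"
    by (rule mx_inj_low[where c = c and n = n and L = "p + 1" and ?L0.0 = "min L L'"])
      (use assms in \<open>auto simp: mx_diff\<close>)
  then show "a p = b p" by simp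
qed

text \<open>Division by x - c with the geometric series 1/(x - c) = - sum_j x^j / c^(j+1); the lower
  bound on b makes each coefficient a finite sum.\<close>

lemma mx_solve1:
  assumes c: "c \<noteq> 0" and L: "\<And>p. p < L \<Longrightarrow> b p = 0"
  shows "\<exists>a. (\<forall>p<L. a p = 0) \<and> mx c a = b"
proof -
  define a where "a = (\<lambda>p. if p < L then 0 else - (\<Sum>j\<le>nat (p - L). b (p - int j) / c ^ (Suc j)))"
  have "mx c a p = b p" for p
  proof (cases "p < L")
    case True then show ?thesis using L by (simp add: mx_ap a_def)
  next
    case False
    show ?thesis
    proof (cases "p = L")
      case True then show ?thesis using c by (simp add: mx_ap a_def)
    next
      case f: False
      define n where "n = nat (p - 1 - L)"
      have n: "nat (p - L) = Suc n" using False f by (simp add: n_def)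
      have "a p = - (b p / c + (\<Sum>j\<le>n. b (p - int (Suc j)) / c ^ (Suc (Suc j))))"
        using False n by (simp add: a_def sum.atMost_Suc_shift del: sum.atMost_Suc)
      then have "c * a p = - (b p + (\<Sum>j\<le>n. b (p - int (Suc j)) / c ^ (Suc j)))"
        using c by (simp add: right_diff_distrib sum_distrib_left)
      moreover have "a (p - 1) = - (\<Sum>j\<le>n. b (p - int (Suc j)) / c ^ (Suc j))"
        using False f by (simp add: a_def n_def algebra_simps)
      ultimately show ?thesis by (simp add: mx_ap)
    qed
  qed
  then show ?thesis by (intro exI[of _ a]) (auto simp: a_def)
qed

lemma mx_solve:
  assumes c: "c \<noteq> 0" and L: "\<And>p. p < L \<Longrightarrow> b p = 0"
  shows "\<exists>a. (\<forall>p<L. a p = 0) \<and> (mx c ^^ n) a = b"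
proof (induction n)
  case 0 then show ?case using L by (intro exI[of _ b]) auto
next
  case (Suc n)
  then obtain a where a: "\<forall>p<L. a p = 0" "(mx c ^^ n) a = b" by blast
  from mx_solve1[OF c, of L a] a obtain a' where "\<forall>p<L. a' p = 0" "mx c a' = a" by auto
  then show ?case using a by (intro exI[of _ a']) (simp add: funpow_swap[of "mx c" "mx c" n 1, simplified] funpow_Suc_right del: funpow.simps)
qed

text \<open>The composite of \<open>\<iota>\<^sub>0\<close> with the inverse of \<open>\<iota>\<^sub>\<infinity>\<close> in algebraic form: if \<open>a\<close> is the expansion at infinity of a
rational function with poles at \<open>0\<close> and \<open>z\<close>, its expansion at \<open>0\<close> is the only series with finitely many
negative powers that agrees with \<open>a\<close> after multiplication by a power of \<open>x - z\<close>.  Junk otherwise.\<close>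

definition expd :: "complex \<Rightarrow> (int \<Rightarrow> complex) \<Rightarrow> int \<Rightarrow> complex" where
  "expd z a = (THE c. (\<exists>L. \<forall>p<L. c p = 0) \<and> (\<exists>B. (mx z ^^ B) c = (mx z ^^ B) a))"

lemma mx_pow_mono:
  assumes "(mx z ^^ B) c = (mx z ^^ B) a" "B \<le> C"
  shows "(mx z ^^ C) c = (mx z ^^ C) a"
proof -
  obtain k where "C = k + B" using assms(2) by (metis le_add_diff_inverse2)
  then show ?thesis using assms(1) by (simp add: funpow_add)
qed

text \<open>Any exponent B serves as a witness: competitors are compared after multiplication by the
  larger of the two powers and identified by injectivity on series bounded below.\<close>

lemma expd_eqI:
  assumes z: "z \<noteq> 0" and L: "\<And>p. p < L \<Longrightarrow> c p = 0" and e: "(mx z ^^ B) c = (mx z ^^ B) a"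
  shows "expd z a = c"
  unfolding expd_def
proof (rule the_equality)
  show "(\<exists>L. \<forall>p<L. c p = 0) \<and> (\<exists>B. (mx z ^^ B) c = (mx z ^^ B) a)" using L e by blast
next
  fix d assume "(\<exists>L. \<forall>p<L. d p = 0) \<and> (\<exists>B. (mx z ^^ B) d = (mx z ^^ B) a)"
  then obtain L' B' where d: "\<And>p. p < L' \<Longrightarrow> d p = 0" "(mx z ^^ B') d = (mx z ^^ B') a" by auto
  have "(mx z ^^ max B B') d = (mx z ^^ max B B') c"
    using mx_pow_mono[OF e, of "max B B'"] mx_pow_mono[OF d(2), of "max B B'"] by simp
  then show "d = c" by (rule mx_inj[where L = L' and L' = L, OF z, rotated]) (simp_all add: d(1) L)
qed

text \<open>The same B and L hold before and after the expansion. This is how bounds uniform in w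
  survive it.\<close>

lemma expd_props:
  assumes z: "z \<noteq> 0" and L: "\<And>p. p < L \<Longrightarrow> (mx z ^^ B) a p = 0"
  shows "\<And>p. p < L \<Longrightarrow> expd z a p = 0" "(mx z ^^ B) (expd z a) = (mx z ^^ B) a"
proof -
  obtain c where c: "\<forall>p<L. c p = 0" "(mx z ^^ B) c = (mx z ^^ B) a"
    using mx_solve[where b = "(mx z ^^ B) a", OF z L] by metis
  have e: "expd z a = c" by (rule expd_eqI[OF z _ c(2), where L = L]) (use c(1) in simp)
  show "\<And>p. p < L \<Longrightarrow> expd z a p = 0" unfolding e using c(1) by simp
  show "(mx z ^^ B) (expd z a) = (mx z ^^ B) a" unfolding e by (rule c(2))
qed

lemma mx_low_mono:
  assumes "\<And>p. p < L \<Longrightarrow> (mx z ^^ B) a p = 0" "B \<le> C" "p < L"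
  shows "(mx z ^^ C) a p = 0"
proof -
  obtain k where "C = k + B" using assms(2) by (metis le_add_diff_inverse2)
  then show ?thesis using mx_low[where L = L and a = "(mx z ^^ B) a" and p = p and c = z and n = k] assms
    by (simp add: funpow_add)
qed

definition ratl :: "complex \<Rightarrow> (int \<Rightarrow> complex) \<Rightarrow> bool" where
  "ratl z a \<longleftrightarrow> (\<exists>B L. \<forall>p<L. (mx z ^^ B) a p = 0)"

lemma expd_lin:
  assumes z: "z \<noteq> 0" and a: "ratl z a" and b: "ratl z b"
  shows "expd z (\<lambda>p. k * a p + b p) = (\<lambda>p. k * expd z a p + expd z b p)"
proof -
  obtain B1 L1 where a: "\<And>p. p < L1 \<Longrightarrow> (mx z ^^ B1) a p = 0" using a by (auto simp: ratl_def)
  obtain B2 L2 where b: "\<And>p. p < L2 \<Longrightarrow> (mx z ^^ B2) b p = 0" using b by (auto simp: ratl_def)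
  define B where "B = max B1 B2"
  note ea = expd_props[where L = L1, OF z a, simplified] note eb = expd_props[where L = L2, OF z b, simplified]
  have "(mx z ^^ B) (expd z a) = (mx z ^^ B) a" "(mx z ^^ B) (expd z b) = (mx z ^^ B) b"
    by (rule mx_pow_mono[OF ea(2)], simp add: B_def) (rule mx_pow_mono[OF eb(2)], simp add: B_def)
  then show ?thesis
    by (intro expd_eqI[OF z, of "min L1 L2" _ B]) (auto simp: ea eb mx_lin)
qed

lemma expd_zero: "z \<noteq> 0 \<Longrightarrow> expd z (\<lambda>p. 0) = (\<lambda>p. 0)"
  by (rule expd_eqI[where B = 0 and L = 0]) auto

text \<open>Multiplication of a double series by \<open>x\<^sub>1 - c\<close>, \<open>x\<^sub>2 - c\<close> and \<open>x\<^sub>1 - x\<^sub>2 - s\<close>.\<close>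

definition m1 :: "complex \<Rightarrow> (int \<Rightarrow> int \<Rightarrow> complex) \<Rightarrow> int \<Rightarrow> int \<Rightarrow> complex" where
  "m1 c G = (\<lambda>a b. G (a - 1) b - c * G a b)"
definition m2 :: "complex \<Rightarrow> (int \<Rightarrow> int \<Rightarrow> complex) \<Rightarrow> int \<Rightarrow> int \<Rightarrow> complex" where
  "m2 c G = (\<lambda>a b. G a (b - 1) - c * G a b)"
definition m12 :: "complex \<Rightarrow> (int \<Rightarrow> int \<Rightarrow> complex) \<Rightarrow> int \<Rightarrow> int \<Rightarrow> complex" where
  "m12 s G = (\<lambda>a b. G (a - 1) b - G a (b - 1) - s * G a b)"

lemma m_ap:
  "m1 c G a b = G (a - 1) b - c * G a b"
  "m2 c G a b = G a (b - 1) - c * G a b"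
  "m12 s G a b = G (a - 1) b - G a (b - 1) - s * G a b"
  by (simp_all add: m1_def m2_def m12_def)

lemma m1_pow: "(m1 c ^^ n) G a b = (mx c ^^ n) (\<lambda>a. G a b) a"
  by (induction n arbitrary: a b) (auto simp: m_ap mx_ap)
lemma m2_pow: "(m2 c ^^ n) G a b = (mx c ^^ n) (G a) b"
  by (induction n arbitrary: a b) (auto simp: m_ap mx_ap)

lemma m_comm:
  "m1 c (m2 d G) = m2 d (m1 c G)" "m1 c (m12 d G) = m12 d (m1 c G)"
  "m2 c (m12 d G) = m12 d (m2 c G)" "m1 c (m1 d G) = m1 d (m1 c G)"
  by (auto simp: m_ap fun_eq_iff algebra_simps)

lemma m_pow_comm:
  "(m1 c ^^ n) ((m2 d ^^ k) G) = (m2 d ^^ k) ((m1 c ^^ n) G)"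
  "(m1 c ^^ n) ((m12 d ^^ k) G) = (m12 d ^^ k) ((m1 c ^^ n) G)"
  "(m2 c ^^ n) ((m12 d ^^ k) G) = (m12 d ^^ k) ((m2 c ^^ n) G)"
  "(m1 c ^^ n) ((m1 d ^^ k) G) = (m1 d ^^ k) ((m1 c ^^ n) G)"
  by (intro funpow_swap m_comm)+

lemma m_pow_diff:
  "(m1 c ^^ n) (\<lambda>a b. G a b - H a b) = (\<lambda>a b. (m1 c ^^ n) G a b - (m1 c ^^ n) H a b)"
  "(m2 c ^^ n) (\<lambda>a b. G a b - H a b) = (\<lambda>a b. (m2 c ^^ n) G a b - (m2 c ^^ n) H a b)"
  "(m12 c ^^ n) (\<lambda>a b. G a b - H a b) = (\<lambda>a b. (m12 c ^^ n) G a b - (m12 c ^^ n) H a b)"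
  by (induction n; auto simp: m_ap fun_eq_iff right_diff_distrib)+

lemma m1_low:
  assumes "\<And>a b. P a b \<Longrightarrow> G a b = 0" "\<And>a b. P a b \<Longrightarrow> P (a - 1) b" "P a b"
  shows "(m1 s ^^ n) G a b = 0"
  using assms(3) by (induction n arbitrary: a b) (auto simp: m_ap assms(1,2))

lemma m2_low:
  assumes "\<And>a b. P a b \<Longrightarrow> G a b = 0" "\<And>a b. P a b \<Longrightarrow> P a (b - 1)" "P a b"
  shows "(m2 s ^^ n) G a b = 0"
  using assms(3) by (induction n arbitrary: a b) (auto simp: m_ap assms(1,2))

lemma m12_low:
  assumes "\<And>a b. P a b \<Longrightarrow> G a b = 0" "\<And>a b. P a b \<Longrightarrow> P (a - 1) b" "\<And>a b. P a b \<Longrightarrow> P a (b - 1)" "P a b"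
  shows "(m12 s ^^ n) G a b = 0"
  using assms(4) by (induction n arbitrary: a b) (auto simp: m_ap assms(1,2,3))

text \<open>Since s is invertible, the equation expresses the coefficient at (a, b) by those at (a -
  1, b) and (a, b - 1); induction on a + b over the quadrant.\<close>

lemma m12_inj:
  assumes s: "s \<noteq> 0" and low: "\<And>a b. a < A \<or> b < A' \<Longrightarrow> G a b = 0" and z: "(m12 s ^^ N) G = (\<lambda>a b. 0)"
  shows "G a b = 0"
proof -
  have 1: "F a b = 0" if low: "\<And>a b. a < A \<or> b < A' \<Longrightarrow> F a b = 0" and z: "m12 s F = (\<lambda>a b. 0)" for F a b
  proof (induction "nat (a - A + b - A' + 1)" arbitrary: a b rule: less_induct)
    case less
    show ?case
    proof (cases "a < A \<or> b < A'")
      case True then show ?thesis using low by blast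
    next
      case False
      then have "F (a - 1) b = 0" "F a (b - 1) = 0" using less by auto
      moreover have "F (a - 1) b - F a (b - 1) - s * F a b = 0" using z by (auto simp: m_ap fun_eq_iff)
      ultimately show ?thesis using s by simp
    qed
  qed
  have "(m12 s ^^ N) G = (\<lambda>a b. 0) \<longrightarrow> G = (\<lambda>a b. 0)"
  proof (induction N)
    case (Suc N)
    have low': "(m12 s ^^ N) G a b = 0" if "a < A \<or> b < A'" for a b
      by (rule m12_low[where P = "\<lambda>a b. a < A \<or> b < A'"]) (use that low in auto)
    show ?case using Suc 1[OF low'] by (auto simp: fun_eq_iff)
  qed simp
  then show ?thesis using z by (metis)
qed

text \<open>For a < A the lowest power of x2 that can occur is b0. There the summand x2 contributes
  nothing, so x1 - x2 - s acts as x1 - s.\<close>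

lemma one_sided_ind:
  assumes U: "\<And>a b. a < A \<Longrightarrow> b < b0 \<Longrightarrow> U a b = 0" and a: "a < A"
  shows "(m12 s ^^ j) U a b0 = (m1 s ^^ j) U a b0"
  using a
proof (induction j arbitrary: a)
  case (Suc j)
  have "(m12 s ^^ j) U a (b0 - 1) = 0"
    by (rule m12_low[where P = "\<lambda>a b. a < A \<and> b < b0"]) (use U Suc.prems in auto)
  moreover define V W where "V = (m12 s ^^ j) U" and "W = (m1 s ^^ j) U"
  ultimately have "V a (b0 - 1) = 0" "V a b0 = W a b0" "V (a - 1) b0 = W (a - 1) b0" using Suc by auto
  then have "m12 s V a b0 = m1 s W a b0" by (simp add: m_ap)
  then show ?case by (simp add: V_def W_def)
qed simp

text \<open>\<open>G\<close> and \<open>H\<close> stand for the two orders of the product of two mutually local fields, paired with a functional.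
Expanding \<open>G\<close> at \<open>x\<^sub>2 = 0\<close> gives \<open>G2\<close>; then each coefficient of \<open>x\<^sub>2\<close> in \<open>G2\<close> is again rational in \<open>x\<^sub>1\<close>, and
expanding at \<open>x\<^sub>1 = 0\<close> gives \<open>G'\<close>.  For two fields based at the same point \<open>s = 0\<close>; for fields based at
the two different poles \<open>s = z\<close>.\<close>

locale one_sided =
  fixes z e s :: complex and N B B' :: nat and A A' :: int and G H :: "int \<Rightarrow> int \<Rightarrow> complex"
  assumes z: "z \<noteq> 0" and e: "e \<noteq> 0" and s: "s = 0 \<or> s = z"
    and loc: "(m12 s ^^ N) G = (m12 s ^^ N) H"
    and h: "\<And>a b. a < A \<Longrightarrow> (m1 z ^^ B) H a b = 0"
    and g: "\<And>a b. b < A' \<Longrightarrow> (m2 e ^^ B') G a b = 0"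
begin

definition "G2 = (\<lambda>a b. expd e (G a) b)"
definition "G' = (\<lambda>a b. expd z (\<lambda>a. G2 a b) a)"

lemma G2_low: "b < A' \<Longrightarrow> G2 a b = 0"
  using expd_props(1)[OF e, of A' B' "G a"] g by (simp add: G2_def m2_pow)

lemma G2_eq: "(m2 e ^^ B') G2 = (m2 e ^^ B') G"
proof (intro ext)
  fix a b
  show "(m2 e ^^ B') G2 a b = (m2 e ^^ B') G a b"
    using expd_props(2)[OF e, of A' B' "G a"] g by (simp add: G2_def m2_pow)
qed

text \<open>Locality replaces G by H, whose pole in x1 is under control. The factor (x2 - e)^B' used
  to pass from \<open>G2\<close> to G is then cancelled, as \<open>G2\<close> is bounded below in
  x2.\<close>

lemma T_low: "a < A \<Longrightarrow> (m12 s ^^ N) ((m1 z ^^ B) G2) a b = 0"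
proof -
  assume a: "a < A"
  have "(m2 e ^^ B') ((m12 s ^^ N) ((m1 z ^^ B) G2)) = (m2 e ^^ B') ((m12 s ^^ N) ((m1 z ^^ B) H))"
    by (metis (no_types) G2_eq loc m_pow_comm)
  moreover have "(m2 e ^^ B') ((m12 s ^^ N) ((m1 z ^^ B) H)) a b = 0" for b
    by (rule m2_low[where P = "\<lambda>a b. a < A"], rule m12_low[where P = "\<lambda>a b. a < A"]) (use a h in auto)
  ultimately have 0: "(mx e ^^ B') ((m12 s ^^ N) ((m1 z ^^ B) G2) a) b = 0" for b
    by (simp add: m2_pow[symmetric])
  have l: "(m12 s ^^ N) ((m1 z ^^ B) G2) a b = 0" if "b < A'" for b
    by (rule m12_low[where P = "\<lambda>a b. b < A'"], rule m1_low[where P = "\<lambda>a b. b < A'"]) (use that G2_low in auto)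
  show "(m12 s ^^ N) ((m1 z ^^ B) G2) a b = 0"
    by (rule mx_inj_low[OF e, of A' _ "b+1" B']) (use l 0 in auto)
qed

text \<open>Induction on the power of \<open>x\<^sub>2\<close>: multiplying by \<open>(x\<^sub>1 - x\<^sub>2 - s)\<^sup>N\<close> expresses \<open>(x\<^sub>1 - s)\<^sup>N\<close> times the current coefficient
through a series without low powers of \<open>x\<^sub>1\<close> and the earlier coefficients.\<close>

lemma G2_rat: "a < A \<Longrightarrow> b < A' + int k \<Longrightarrow> (m1 s ^^ (N * k)) ((m1 z ^^ B) G2) a b = 0"
proof (induction k arbitrary: a b)
  case 0
  then show ?case by (auto intro!: m1_low[where P = "\<lambda>a b. b < A'"] G2_low)
next
  case (Suc k)
  define U where "U = (m1 s ^^ (N * k)) ((m1 z ^^ B) G2)"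
  have U: "\<And>a b. a < A \<Longrightarrow> b < A' + int k \<Longrightarrow> U a b = 0" using Suc.IH by (simp add: U_def)
  have e: "(m1 s ^^ (N * Suc k)) ((m1 z ^^ B) G2) = (m1 s ^^ N) U"
    by (simp add: U_def funpow_add)
  have 0: "(m12 s ^^ N) U a b = 0" if "a < A" for a b
  proof -
    have "(m12 s ^^ N) U = (m1 s ^^ (N * k)) ((m12 s ^^ N) ((m1 z ^^ B) G2))"
      by (simp add: U_def m_pow_comm)
    moreover have "(m1 s ^^ (N * k)) ((m12 s ^^ N) ((m1 z ^^ B) G2)) a b = 0"
      by (rule m1_low[where P = "\<lambda>a b. a < A"]) (use that T_low in auto)
    ultimately show ?thesis by simp
  qed
  consider "b < A' + int k" | "b = A' + int k" using Suc.prems by linarith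
  then show ?case
  proof cases
    case 1
    then show ?thesis unfolding e
      by (intro m1_low[where P = "\<lambda>a b. a < A \<and> b < A' + int k"]) (use U Suc.prems in auto)
  next
    case 2
    then show ?thesis unfolding e
      using one_sided_ind[where A = A and ?b0.0 = "A' + int k" and U = U and a = a and s = s and j = N] U 0 Suc.prems by auto
  qed
qed

lemma G'_low: "b < A' \<Longrightarrow> G' a b = 0"
  by (simp add: G'_def G2_low expd_zero[OF z])

text \<open>For s = 0 the factor (x1 - s)^(N k) is a shift by N k: the bound at x1 = 0 weakens with
  the power of x2, while the order at z stays B.\<close>

lemma G'_s0:
  assumes "s = 0" shows "b < A' + int k \<Longrightarrow> a < A - int (N * k) \<Longrightarrow> G' a b = 0"
    "(m1 z ^^ B) G' = (m1 z ^^ B) G2"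
proof -
  have *: "(mx z ^^ B) (\<lambda>a. G2 a b) a = 0" if "b < A' + int k" "a < A - int (N * k)" for a b k
    using G2_rat[of "a + int (N*k)" b k] that assms by (simp add: m1_pow mx_0_pow)
  have b: "b < A' + int (nat (b - A' + 1))" for b by simp
  show "b < A' + int k \<Longrightarrow> a < A - int (N * k) \<Longrightarrow> G' a b = 0"
    unfolding G'_def by (rule expd_props(1)[OF z, of "A - int (N * k)" B]) (use * in auto)
  show "(m1 z ^^ B) G' = (m1 z ^^ B) G2"
  proof (intro ext)
    fix a b
    show "(m1 z ^^ B) G' a b = (m1 z ^^ B) G2 a b"
      using expd_props(2)[where L = "A - int (N * nat (b - A' + 1))", OF z *[OF b]]
      by (simp add: m1_pow G'_def)
  qed
qed

text \<open>For s = z the factor joins (x1 - z)^B: now the order at z grows with the power of x2,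
  and one lower bound in x1 serves all of them. The commutation of the two actions depends on
  this.\<close>

lemma G'_sz:
  assumes "s = z" shows "a < A \<Longrightarrow> G' a b = 0"
    "b < A' + int k \<Longrightarrow> (m1 z ^^ (N * k + B)) G' a b = (m1 z ^^ (N * k + B)) G2 a b"
proof -
  have *: "(mx z ^^ (N * k + B)) (\<lambda>a. G2 a b) a = 0" if "b < A' + int k" "a < A" for a b k
    using G2_rat[of a b k] that assms by (simp add: m1_pow funpow_add)
  have b: "b < A' + int (nat (b - A' + 1))" for b by simp
  show "a < A \<Longrightarrow> G' a b = 0"
    unfolding G'_def by (rule expd_props(1)[OF z *[OF b]])
  assume "b < A' + int k"
  from expd_props(2)[OF z *[OF this]]
  show "(m1 z ^^ (N * k + B)) G' a b = (m1 z ^^ (N * k + B)) G2 a b"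
    by (simp add: m1_pow G'_def)
qed

lemma G'_low': "b < A' + int k \<Longrightarrow> a < A - int (N * k) \<Longrightarrow> G' a b = 0"
proof (cases "s = 0")
  case True
  then show "b < A' + int k \<Longrightarrow> a < A - int (N * k) \<Longrightarrow> G' a b = 0" by (rule G'_s0)
next
  case False
  assume a: "a < A - int (N * k)"
  have "0 \<le> int (N * k)" by simp
  with a have "a < A" by linarith
  then show "G' a b = 0" using G'_sz(1)[of a b] False s by auto
qed

lemma G'_eq: "b < A' + int k \<Longrightarrow> (m1 z ^^ (N * k + B)) G' a b = (m1 z ^^ (N * k + B)) G2 a b"
proof (cases "s = 0")
  case True
  then show ?thesis using G'_s0(2)[OF True] by (simp add: funpow_add)
next
  case False
  assume "b < A' + int k"
  then show ?thesis using G'_sz(2)[of b k a] False s by auto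
qed

text \<open>The exponent in \<open>G'_eq\<close> depends on k, so it cannot be removed for all
  powers of x2 at once. For each fixed b both sides are bounded below in x1, and the surplus factor
  (x1 - z)^(N k) is cancelled there.\<close>

lemma K'_eq1: "(m1 z ^^ B) ((m12 s ^^ N) G') = (m1 z ^^ B) ((m12 s ^^ N) G2)"
proof (intro ext)
  fix a b
  define k where "k = nat (b - A' + 1)"
  have b: "b < A' + int k" by (simp add: k_def)
  define V where "V = (m1 z ^^ B) (\<lambda>a b. G' a b - G2 a b)"
  have "(m1 z ^^ (N * k)) V a b = 0" if "b < A' + int k" for a b
    using G'_eq[OF that, of a] unfolding V_def by (simp add: funpow_add m_pow_diff)
  then have "(m12 s ^^ N) ((m1 z ^^ (N * k)) V) a b = 0" if "b < A' + int k" for a b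
    by (intro m12_low[where P = "\<lambda>a b. b < A' + int k"]) (use that in auto)
  then have 0: "(mx z ^^ (N * k)) (\<lambda>a. (m12 s ^^ N) V a b) a = 0" for a
    using b by (simp add: m_pow_comm[symmetric] m1_pow)
  have V: "(m12 s ^^ N) V = (\<lambda>a b. (m1 z ^^ B) ((m12 s ^^ N) G') a b - (m1 z ^^ B) ((m12 s ^^ N) G2) a b)"
    by (simp add: V_def m_pow_comm[symmetric] m_pow_diff)
  have 1: "(m1 z ^^ B) ((m12 s ^^ N) G') a b = 0" if "a < A - int (N * k)" for a
    by (rule m1_low[where P = "\<lambda>a b. b < A' + int k \<and> a < A - int (N * k)"],
      rule m12_low[where P = "\<lambda>a b. b < A' + int k \<and> a < A - int (N * k)"])
      (use that b G'_low' in auto)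
  have 2: "(m1 z ^^ B) ((m12 s ^^ N) G2) a b = 0" if "a < A" for a
    using T_low[OF that, of b] by (simp add: m_pow_comm)
  have "0 \<le> int N * int k" by simp
  then have 3: "p < A" if "p < A - int N * int k" for p using that by linarith
  have "(m12 s ^^ N) V a b = 0"
    by (rule mx_inj_low[where ?L0.0 = "min A (A - int (N*k))" and a = "\<lambda>a. (m12 s ^^ N) V a b" and L = "a + 1" and n = "N * k", OF z])
      (use 0 1 2 3 in \<open>auto simp: V\<close>)
  then show "(m1 z ^^ B) ((m12 s ^^ N) G') a b = (m1 z ^^ B) ((m12 s ^^ N) G2) a b"
    by (simp add: V)
qed

text \<open>The bound of \<open>T_low\<close> is carried from \<open>G2\<close> to \<open>G'\<close>
  by \<open>K'_eq1\<close>, after which (x1 - z)^B is cancelled.\<close>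

lemma K'_low: "a < A \<or> b < A' \<Longrightarrow> (m12 s ^^ N) G' a b = 0"
proof -
  have b: "(m12 s ^^ N) G' a b = 0" if "b < A'" for a b
    by (rule m12_low[where P = "\<lambda>a b. b < A'"]) (use that G'_low in auto)
  have a: "(m12 s ^^ N) G' a b = 0" if "a < A" for a b
  proof -
    define k where "k = nat (b - A' + 1)"
    have b: "b < A' + int k" by (simp add: k_def)
    have 1: "(m12 s ^^ N) G' a b = 0" if "a < A - int (N * k)" for a
      by (rule m12_low[where P = "\<lambda>a b. b < A' + int k \<and> a < A - int (N * k)"])
        (use that b G'_low' in auto)
    have "(m1 z ^^ B) ((m12 s ^^ N) G') a b = 0" if "a < A" for a
      using T_low[OF that, of b] K'_eq1 by (simp add: m_pow_comm)
    then show ?thesis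
      using mx_inj_low[OF z, of "A - int (N*k)" "\<lambda>a. (m12 s ^^ N) G' a b" A B a] 1 that
      by (simp add: m1_pow)
  qed
  show "a < A \<or> b < A' \<Longrightarrow> (m12 s ^^ N) G' a b = 0" using a b by blast
qed

lemma K'_eq: "(m1 z ^^ B) ((m2 e ^^ B') ((m12 s ^^ N) G')) = (m1 z ^^ B) ((m2 e ^^ B') ((m12 s ^^ N) G))"
  by (metis (no_types) G2_eq K'_eq1 m_pow_comm)

lemma G'_full: "s = 0 \<Longrightarrow> (m1 z ^^ B) ((m2 e ^^ B') G') = (m1 z ^^ B) ((m2 e ^^ B') G)"
  by (metis (no_types) G2_eq G'_s0(2) m_pow_comm)

end

section \<open>Exchange of the two variables\<close>

definition tr :: "(int \<Rightarrow> int \<Rightarrow> 'a) \<Rightarrow> int \<Rightarrow> int \<Rightarrow> 'a" where "tr G = (\<lambda>a b. G b a)"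

lemma tr_m1: "(m1 c ^^ n) (tr G) = tr ((m2 c ^^ n) G)"
  and tr_m2: "(m2 c ^^ n) (tr G) = tr ((m1 c ^^ n) G)"
  by (induction n; auto simp: m_ap tr_def)+

lemma tr_m12: "(m12 (- s) ^^ n) (tr G) = (\<lambda>a b. (-1) ^ n * tr ((m12 s ^^ n) G) a b)"
  by (induction n) (auto simp: m_ap tr_def fun_eq_iff algebra_simps)

lemma m_pow_scale:
  "(m1 c ^^ n) (\<lambda>a b. k * G a b) = (\<lambda>a b. k * (m1 c ^^ n) G a b)"
  "(m2 c ^^ n) (\<lambda>a b. k * G a b) = (\<lambda>a b. k * (m2 c ^^ n) G a b)"
  "(m12 c ^^ n) (\<lambda>a b. k * G a b) = (\<lambda>a b. k * (m12 c ^^ n) G a b)"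
  by (induction n; auto simp: m_ap fun_eq_iff algebra_simps)+

lemma tr_tr [simp]: "tr (tr G) = G" by (simp add: tr_def)

text \<open>With this condition the hypotheses are symmetric under exchange of x1 and x2, which
  turns s into -s; the mirrored copy treats H.\<close>

locale two_sided = one_sided +
  assumes s': "s = 0 \<or> s = - e"
begin

sublocale op: one_sided e z "- s" N B' B A' A "tr H" "tr G"
proof
  show "e \<noteq> 0" "z \<noteq> 0" "- s = 0 \<or> - s = e" using z e s s' by auto
  show "(m12 (- s) ^^ N) (tr H) = (m12 (- s) ^^ N) (tr G)" by (simp add: tr_m12 loc)
  show "\<And>a b. a < A' \<Longrightarrow> (m1 e ^^ B') (tr G) a b = 0" using g by (simp add: tr_m1) (simp add: tr_def)
  show "\<And>a b. b < A \<Longrightarrow> (m2 z ^^ B) (tr H) a b = 0" using h by (simp add: tr_m2) (simp add: tr_def)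
qed

definition "H' = tr op.G'"

lemma H'_eq: "H' = (\<lambda>a b. expd e (\<lambda>b. expd z (\<lambda>a. H a b) a) b)"
  unfolding H'_def op.G'_def op.G2_def by (simp add: tr_def)

lemma KH'_tr: "(m12 (- s) ^^ N) (op.G') = (\<lambda>a b. (-1) ^ N * tr ((m12 s ^^ N) H') a b)"
  using tr_m12[of N s H'] by (simp add: H'_def)

lemma KH'_low: "a < A \<or> b < A' \<Longrightarrow> (m12 s ^^ N) H' a b = 0"
  using op.K'_low[of b a] by (simp add: KH'_tr) (auto simp: tr_def)

lemma KH'_eq: "(m1 z ^^ B) ((m2 e ^^ B') ((m12 s ^^ N) H')) = (m1 z ^^ B) ((m2 e ^^ B') ((m12 s ^^ N) H))"
proof -
  have "(m1 e ^^ B') ((m2 z ^^ B) (tr ((m12 s ^^ N) H'))) = (m1 e ^^ B') ((m2 z ^^ B) (tr ((m12 s ^^ N) H)))"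
    using op.K'_eq by (simp add: KH'_tr tr_m12 m_pow_scale fun_eq_iff)
  then have "(m2 e ^^ B') ((m1 z ^^ B) ((m12 s ^^ N) H')) = (m2 e ^^ B') ((m1 z ^^ B) ((m12 s ^^ N) H))"
    by (simp add: tr_m1 tr_m2) (metis tr_tr)
  then show ?thesis by (simp add: m_pow_comm)
qed

lemma H'_full: "s = 0 \<Longrightarrow> (m1 z ^^ B) ((m2 e ^^ B') H') = (m1 z ^^ B) ((m2 e ^^ B') H)"
proof -
  assume "s = 0"
  then have "(m1 e ^^ B') ((m2 z ^^ B) (tr H')) = (m1 e ^^ B') ((m2 z ^^ B) (tr H))"
    using op.G'_full by (simp add: H'_def)
  then have "(m2 e ^^ B') ((m1 z ^^ B) H') = (m2 e ^^ B') ((m1 z ^^ B) H)"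
    by (simp add: tr_m1 tr_m2) (metis tr_tr)
  then show ?thesis by (simp add: m_pow_comm)
qed

text \<open>Both sides are bounded below in x1 and x2 and agree after multiplication by (x1 - z)^B
  (x2 - e)^B', where they equal the original local products; these factors are cancelled one
  variable at a time.\<close>

theorem local: "(m12 s ^^ N) G' = (m12 s ^^ N) H'"
proof -
  define V where "V = (\<lambda>a b. (m12 s ^^ N) G' a b - (m12 s ^^ N) H' a b)"
  have V0: "V a b = 0" if "a < A \<or> b < A'" for a b
    using K'_low[OF that] KH'_low[OF that] by (simp add: V_def)
  have "(m1 z ^^ B) ((m2 e ^^ B') V) = (\<lambda>a b. 0)"
    using K'_eq KH'_eq loc by (simp add: V_def m_pow_diff)
  then have 1: "(mx z ^^ B) (\<lambda>a. (m2 e ^^ B') V a b) a = 0" for a b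
    by (metis m1_pow)
  have 2: "(m2 e ^^ B') V a b = 0" if "a < A" for a b
    by (rule m2_low[where P = "\<lambda>a b. a < A"]) (use that V0 in auto)
  have 3: "(m2 e ^^ B') V a b = 0" for a b
    by (rule mx_inj_low[OF z, of A "\<lambda>a. (m2 e ^^ B') V a b" "a + 1" B a]) (use 1 2 in auto)
  have "V a b = 0" for a b
    by (rule mx_inj_low[OF e, of A' "V a" "b + 1" B' b]) (use 3 V0 in \<open>auto simp: m2_pow\<close>)
  then show ?thesis by (simp add: V_def fun_eq_iff)
qed

text \<open>For \<open>s \<noteq> 0\<close> the factor \<open>x\<^sub>1 - x\<^sub>2 - s\<close> is invertible on series bounded below in both variables.\<close>

theorem commute:
  assumes "s \<noteq> 0" shows "G' = H'"
proof -
  have G: "G' a b = 0" if "a < A \<or> b < A'" for a b using that G'_low G'_sz(1) s assms by blast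
  have "s = - e" using s' assms by auto
  then have H: "H' a b = 0" if "a < A \<or> b < A'" for a b using that op.G'_low op.G'_sz(1) assms
    by (auto simp: H'_def tr_def)
  have "G' a b - H' a b = 0" for a b
    by (rule m12_inj[OF assms, of A A' _ N]) (use G H local in \<open>auto simp: m_pow_diff\<close>)
  then show ?thesis by (simp add: fun_eq_iff)
qed

end

section \<open>Jacobi coefficients\<close>

text \<open>\<open>fsum\<close> returns 0 when the support is infinite, so its algebraic laws are
  stated under this condition.\<close>

definition evz :: "(nat \<Rightarrow> 'a::zero) \<Rightarrow> bool" where
  "evz t \<longleftrightarrow> (\<exists>I. \<forall>i\<ge>I. t i = 0)"

lemma fsum_eq: "(\<And>i. i \<ge> I \<Longrightarrow> t i = 0) \<Longrightarrow> fsum t = sum t {..<I}"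
  unfolding fsum_def by (rule sum.mono_neutral_left) (auto simp: not_less[symmetric])

lemma evzD2:
  assumes "evz t" "evz u"
  obtains I where "\<And>i. i \<ge> I \<Longrightarrow> t i = 0" "\<And>i. i \<ge> I \<Longrightarrow> u i = 0"
proof -
  obtain I1 I2 where "\<And>i. i \<ge> I1 \<Longrightarrow> t i = 0" "\<And>i. i \<ge> I2 \<Longrightarrow> u i = 0" using assms unfolding evz_def by blast
  then show ?thesis by (intro that[of "max I1 I2"]) auto
qed

lemma fsum_lin:
  fixes t u :: "nat \<Rightarrow> complex"
  assumes "evz t" "evz u"
  shows "fsum (\<lambda>i. k * t i + u i) = k * fsum t + fsum u"
proof -
  obtain I where I: "\<And>i. i \<ge> I \<Longrightarrow> t i = 0" "\<And>i. i \<ge> I \<Longrightarrow> u i = 0" using evzD2[OF assms] by blast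
  have "fsum (\<lambda>i. k * t i + u i) = (\<Sum>i<I. k * t i + u i)" by (rule fsum_eq) (simp add: I)
  also have "\<dots> = k * fsum t + fsum u"
    by (simp add: fsum_eq[of I t] fsum_eq[of I u] I sum.distrib sum_distrib_left)
  finally show ?thesis .
qed

lemma evz_lin: "evz t \<Longrightarrow> evz u \<Longrightarrow> evz (\<lambda>i. k * t i + u i :: complex)"
  by (erule (1) evzD2) (simp add: evz_def, metis add_0 mult_zero_right)

lemma evz_mult: "evz t \<Longrightarrow> evz (\<lambda>i. c i * t i :: complex)"
  unfolding evz_def by (metis mult_zero_right)

lemma evz_zero [simp]: "evz (\<lambda>i. 0)"
  unfolding evz_def by auto

lemma fsum_zero [simp]: "fsum (\<lambda>i. 0) = 0"
  by (simp add: fsum_def)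

lemma fsum_diff:
  fixes t u :: "nat \<Rightarrow> complex"
  assumes "evz t" "evz u"
  shows "fsum (\<lambda>i. t i - u i) = fsum t - fsum u"
  using fsum_lin[OF assms(2,1), of "-1"] by (simp add: algebra_simps)

lemma fsum_shift:
  fixes t :: "nat \<Rightarrow> 'a::comm_monoid_add"
  assumes "evz t" shows "fsum t = t 0 + fsum (\<lambda>i. t (Suc i))"
proof -
  obtain I where I: "\<And>i. i \<ge> I \<Longrightarrow> t i = 0" using assms unfolding evz_def by blast
  show ?thesis
    using fsum_eq[of "Suc I" t] fsum_eq[of I "\<lambda>i. t (Suc i)"] I by (simp add: sum.lessThan_Suc_shift del: sum.lessThan_Suc)
qed

lemma ibin_0 [simp]: "ibin l 0 = 1" by (simp add: ibin_def)
lemma ibin_0' : "ibin 0 i = (if i = 0 then 1 else 0)" by (cases i) (auto simp: ibin_def)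
lemma ibin_Suc: "ibin (l + 1) (Suc i) = ibin l i + ibin l (Suc i)"
  unfolding ibin_def using gbinomial_Suc_Suc[of "of_int l :: complex" i] by simp

text \<open>Multiplication by \<open>(x\<^sub>1 - x\<^sub>2)\<^sup>l\<close>, expanded in nonnegative powers of \<open>x\<^sub>2\<close>.\<close>

definition Mop :: "int \<Rightarrow> (int \<Rightarrow> int \<Rightarrow> complex) \<Rightarrow> int \<Rightarrow> int \<Rightarrow> complex" where
  "Mop l G = (\<lambda>a b. fsum (\<lambda>i. ((-1) ^ i * ibin l i) * G (a - l + int i) (b - int i)))"

text \<open>Finiteness along antidiagonals in the direction met by the expansion of (x1 - x2)^l in
  nonnegative powers of x2.\<close>

definition fin1 :: "(int \<Rightarrow> int \<Rightarrow> complex) \<Rightarrow> bool" where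
  "fin1 G \<longleftrightarrow> (\<forall>a b. evz (\<lambda>i. G (a + int i) (b - int i)))"

lemma fin1_term: "fin1 G \<Longrightarrow> evz (\<lambda>i. c i * G (a - l + int i) (b - int i))"
  unfolding fin1_def by (intro evz_mult) auto

lemma fin1_lin: "fin1 G \<Longrightarrow> fin1 H \<Longrightarrow> fin1 (\<lambda>a b. k * G a b + H a b)"
  unfolding fin1_def by (auto intro: evz_lin)

lemma fin1_zero [simp]: "fin1 (\<lambda>a b. 0)" by (simp add: fin1_def)

lemma fin1_diff: "fin1 G \<Longrightarrow> fin1 H \<Longrightarrow> fin1 (\<lambda>a b. G a b - H a b)"
  using fin1_lin[of H G "-1"] by simp

lemma fin1_scale: "fin1 G \<Longrightarrow> fin1 (\<lambda>a b. k * G a b)"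
  using fin1_lin[of G "\<lambda>_ _. 0" k] by simp

lemma fin1_shift: "fin1 G \<Longrightarrow> fin1 (\<lambda>a b. G (a - 1) b)" "fin1 G \<Longrightarrow> fin1 (\<lambda>a b. G a (b - 1))"
proof -
  assume G: "fin1 G"
  then have "evz (\<lambda>i. G ((a - 1) + int i) (b - int i))" "evz (\<lambda>i. G (a + int i) ((b - 1) - int i))" for a b
    by (auto simp: fin1_def)
  then show "fin1 (\<lambda>a b. G (a - 1) b)" "fin1 (\<lambda>a b. G a (b - 1))"
    by (auto simp: fin1_def algebra_simps)
qed

lemma fin1_m1: "fin1 G \<Longrightarrow> fin1 (m1 c G)"
  unfolding m1_def by (intro fin1_diff fin1_scale fin1_shift)
lemma fin1_m2: "fin1 G \<Longrightarrow> fin1 (m2 c G)"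
  unfolding m2_def by (intro fin1_diff fin1_scale fin1_shift)
lemma fin1_m12: "fin1 G \<Longrightarrow> fin1 (m12 c G)"
  unfolding m12_def by (intro fin1_diff fin1_scale fin1_shift)

lemma Mop_lin: "fin1 G \<Longrightarrow> fin1 H \<Longrightarrow> Mop l (\<lambda>a b. k * G a b + H a b) a b = k * Mop l G a b + Mop l H a b"
  unfolding Mop_def
  by (subst fsum_lin[OF fin1_term fin1_term, symmetric]) (simp_all add: algebra_simps)

lemma Mop_zero [simp]: "Mop l (\<lambda>a b. 0) = (\<lambda>a b. 0)" by (simp add: Mop_def)

lemma Mop_diff: "fin1 G \<Longrightarrow> fin1 H \<Longrightarrow> Mop l (\<lambda>a b. G a b - H a b) a b = Mop l G a b - Mop l H a b"
  using Mop_lin[of H G l "-1"] by simp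
lemma Mop_scale: "fin1 G \<Longrightarrow> Mop l (\<lambda>a b. k * G a b) a b = k * Mop l G a b"
  using Mop_lin[of G "\<lambda>_ _. 0" l k] by simp

lemma Mop_shift: "Mop l (\<lambda>a b. G (a - 1) b) a b = Mop l G (a - 1) b" "Mop l (\<lambda>a b. G a (b - 1)) a b = Mop l G a (b - 1)"
  by (simp_all add: Mop_def algebra_simps)

lemma Mop_m1: "fin1 G \<Longrightarrow> Mop l (m1 c G) = m1 c (Mop l G)"
  unfolding m1_def by (intro ext) (simp add: Mop_diff Mop_scale fin1_scale fin1_shift Mop_shift)
lemma Mop_m2: "fin1 G \<Longrightarrow> Mop l (m2 c G) = m2 c (Mop l G)"
  unfolding m2_def by (intro ext) (simp add: Mop_diff Mop_scale fin1_scale fin1_shift Mop_shift)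
lemma Mop_m12: "fin1 G \<Longrightarrow> Mop l (m12 c G) = m12 c (Mop l G)"
  unfolding m12_def by (intro ext) (simp add: Mop_diff Mop_scale fin1_scale fin1_shift fin1_diff Mop_shift)

lemma fin1_Mop: "fin1 G \<Longrightarrow> fin1 (Mop l G)"
  unfolding fin1_def
proof (intro allI)
  fix a b
  assume "\<forall>a b. evz (\<lambda>i. G (a + int i) (b - int i))"
  then obtain I where I: "\<And>i. i \<ge> I \<Longrightarrow> G (a - l + int i) (b - int i) = 0" unfolding evz_def by blast
  have "Mop l G (a + int i) (b - int i) = 0" if "i \<ge> I" for i
  proof -
    have *: "G (a + int i - l + int j) (b - int i - int j) = 0" for j
      using I[of "i + j"] that by (simp add: algebra_simps)
    show ?thesis unfolding Mop_def * by simp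
  qed
  then show "evz (\<lambda>i. Mop l G (a + int i) (b - int i))" by (auto simp: evz_def)
qed

lemma Mop_0: "fin1 G \<Longrightarrow> Mop 0 G = G"
proof (intro ext)
  fix a b
  have "fsum (\<lambda>i. ((-1) ^ i * ibin 0 i) * G (a - 0 + int i) (b - int i)) = G a b"
    by (subst fsum_eq[of 1]) (auto simp: ibin_0')
  then show "Mop 0 G a b = G a b" by (simp add: Mop_def)
qed

text \<open>Pascal's rule splits the summand for i + 1 into one with the old exponent and one
  shifted in x2.\<close>

lemma Mop_Suc: "fin1 G \<Longrightarrow> Mop (l + 1) G = m12 0 (Mop l G)"
proof (intro ext)
  fix a b assume G: "fin1 G"
  have E: "evz (\<lambda>i. c i * G (a - l + int i) (b - 1 - int i))" for c
    using fin1_term[OF G, of _ a l "b - 1"] by simp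
  have "Mop (l + 1) G a b = G (a - l - 1) b
      + fsum (\<lambda>i. ((-1) ^ Suc i * ibin (l + 1) (Suc i)) * G (a - l + int i) (b - 1 - int i))"
    unfolding Mop_def by (subst fsum_shift[OF fin1_term[OF G]]) (simp add: algebra_simps)
  also have "fsum (\<lambda>i. ((-1) ^ Suc i * ibin (l + 1) (Suc i)) * G (a - l + int i) (b - 1 - int i))
     = fsum (\<lambda>i. ((-1) ^ Suc i * ibin l (Suc i)) * G (a - l + int i) (b - 1 - int i)
        - ((-1) ^ i * ibin l i) * G (a - l + int i) (b - 1 - int i))"
    by (rule arg_cong[where f = fsum]) (simp add: fun_eq_iff ibin_Suc distrib_left distrib_right left_diff_distrib mult.assoc)
  also have "\<dots> = fsum (\<lambda>i. ((-1) ^ Suc i * ibin l (Suc i)) * G (a - l + int i) (b - 1 - int i)) - Mop l G a (b - 1)"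
    unfolding Mop_def by (rule fsum_diff[OF E E])
  also have "G (a - l - 1) b + \<dots> = Mop l G (a - 1) b - Mop l G a (b - 1)"
    unfolding Mop_def by (subst (2) fsum_shift[OF fin1_term[OF G]]) (simp add: algebra_simps)
  finally show "Mop (l + 1) G a b = m12 0 (Mop l G) a b" by (simp add: m12_def)
qed

text \<open>The kernel of x1 - x2 consists of the series that are constant on antidiagonals, such as
  the delta function; \<open>fin1\<close> excludes all but 0.\<close>

lemma m12_inj_fin1:
  assumes "fin1 G" "m12 0 G = m12 0 H" "fin1 H"
  shows "G = H"
proof (intro ext)
  fix a b
  define M where "M = (\<lambda>a b. G a b - H a b)"
  have f: "fin1 M" unfolding M_def by (intro fin1_diff assms)
  have step: "M a b = M (a + 1) (b - 1)" for a b
    using fun_cong[OF fun_cong[OF assms(2), of "a + 1"], of b] by (simp add: m12_def M_def algebra_simps)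
  have "M a b = M (a + int i) (b - int i)" for i
  proof (induction i)
    case (Suc i)
    then show ?case using step[of "a + int i" "b - int i"] by (simp add: algebra_simps)
  qed simp
  moreover obtain I where "\<And>i. i \<ge> I \<Longrightarrow> M (a + int i) (b - int i) = 0"
    using f unfolding fin1_def evz_def by blast
  ultimately have "M a b = 0" by (metis order_refl)
  then show "G a b = H a b" by (simp add: M_def)
qed

text \<open>The left-hand side of the component Jacobi identity for the products \<open>G\<close> and \<open>H\<close>.  The mode \<open>n\<close> is the
coefficient of \<open>x\<^sup>-\<^sup>n\<^sup>-\<^sup>1\<close>.\<close>

definition Dcf :: "int \<Rightarrow> int \<Rightarrow> int \<Rightarrow> (int \<Rightarrow> int \<Rightarrow> complex) \<Rightarrow> (int \<Rightarrow> int \<Rightarrow> complex) \<Rightarrow> complex" where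
  "Dcf l m n G H = Mop l G (- m - 1) (- n - 1) - (-1) powi l * Mop l (tr H) (- n - 1) (- m - 1)"

text \<open>In the Jacobi expression H is multiplied by a power expanded in nonnegative powers of
  x1; hence the transpose.\<close>

definition fins :: "(int \<Rightarrow> int \<Rightarrow> complex) \<Rightarrow> (int \<Rightarrow> int \<Rightarrow> complex) \<Rightarrow> bool" where
  "fins G H \<longleftrightarrow> fin1 G \<and> fin1 (tr H)"

lemma Dcf_lin: "fins G H \<Longrightarrow> fins G' H' \<Longrightarrow>
  Dcf l m n (\<lambda>a b. k * G a b + G' a b) (\<lambda>a b. k * H a b + H' a b) = k * Dcf l m n G H + Dcf l m n G' H'"
  unfolding Dcf_def fins_def using Mop_lin[of G G'] Mop_lin[of "tr H" "tr H'"]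
  by (simp add: tr_def algebra_simps)

lemma fins_lin: "fins G H \<Longrightarrow> fins G' H' \<Longrightarrow> fins (\<lambda>a b. k * G a b + G' a b) (\<lambda>a b. k * H a b + H' a b)"
  unfolding fins_def using fin1_lin[of G G'] fin1_lin[of "tr H" "tr H'"] by (simp add: tr_def)

lemma fins_zero [simp]: "fins (\<lambda>a b. 0) (\<lambda>a b. 0)" by (simp add: fins_def tr_def)
lemma Dcf_zero [simp]: "Dcf l m n (\<lambda>a b. 0) (\<lambda>a b. 0) = 0" by (simp add: Dcf_def tr_def)

lemma fins_diff: "fins G H \<Longrightarrow> fins G' H' \<Longrightarrow> fins (\<lambda>a b. G a b - G' a b) (\<lambda>a b. H a b - H' a b)"
  using fins_lin[of G' H' G H "-1"] by simp
lemma Dcf_diff: "fins G H \<Longrightarrow> fins G' H' \<Longrightarrow>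
  Dcf l m n (\<lambda>a b. G a b - G' a b) (\<lambda>a b. H a b - H' a b) = Dcf l m n G H - Dcf l m n G' H'"
  using Dcf_lin[of G' H' G H _ _ _ "-1"] by simp

lemma fins_sum:
  assumes "finite S" "\<And>x. x \<in> S \<Longrightarrow> fins (G x) (H x)"
  shows "fins (\<lambda>a b. \<Sum>x\<in>S. c x * G x a b) (\<lambda>a b. \<Sum>x\<in>S. c x * H x a b)"
  using assms by (induction S rule: finite_induct) (auto intro: fins_lin)

lemma Dcf_sum:
  assumes "finite S" "\<And>x. x \<in> S \<Longrightarrow> fins (G x) (H x)"
  shows "Dcf l m n (\<lambda>a b. \<Sum>x\<in>S. c x * G x a b) (\<lambda>a b. \<Sum>x\<in>S. c x * H x a b) = (\<Sum>x\<in>S. c x * Dcf l m n (G x) (H x))"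
  using assms by (induction S rule: finite_induct) (auto simp: Dcf_lin fins_sum)

lemma tr_ms: "tr (m1 c H) = m2 c (tr H)" "tr (m2 c H) = m1 c (tr H)" "tr (m12 0 H) = (\<lambda>a b. (-1) * m12 0 (tr H) a b)"
  by (auto simp: tr_def m1_def m2_def m12_def fun_eq_iff)

lemma fin1_uminus: "fin1 G \<Longrightarrow> fin1 (\<lambda>a b. - G a b)" using fin1_scale[of G "-1"] by simp
lemma Mop_uminus: "fin1 G \<Longrightarrow> Mop l (\<lambda>a b. - G a b) a b = - Mop l G a b" using Mop_scale[of G l "-1"] by simp

lemma fins_m: "fins G H \<Longrightarrow> fins (m1 c G) (m1 c H)" "fins G H \<Longrightarrow> fins (m2 c G) (m2 c H)" "fins G H \<Longrightarrow> fins (m12 0 G) (m12 0 H)"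
  unfolding fins_def tr_ms by (auto intro: fin1_m1 fin1_m2 fin1_m12 fin1_uminus)

lemma fins_pow: "fins G H \<Longrightarrow> fins ((m1 c ^^ k) G) ((m1 c ^^ k) H)" "fins G H \<Longrightarrow> fins ((m2 c ^^ k) G) ((m2 c ^^ k) H)"
   "fins G H \<Longrightarrow> fins ((m12 0 ^^ k) G) ((m12 0 ^^ k) H)"
  by (induction k) (auto intro: fins_m)

lemma Dcf_m1: "fins G H \<Longrightarrow> Dcf l m n (m1 c G) (m1 c H) = Dcf l (m + 1) n G H - c * Dcf l m n G H"
  unfolding Dcf_def fins_def tr_ms by (simp add: Mop_m1 Mop_m2 m_ap algebra_simps)
lemma Dcf_m2: "fins G H \<Longrightarrow> Dcf l m n (m2 c G) (m2 c H) = Dcf l m (n + 1) G H - c * Dcf l m n G H"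
  unfolding Dcf_def fins_def tr_ms by (simp add: Mop_m1 Mop_m2 m_ap algebra_simps)
lemma Dcf_m12: "fins G H \<Longrightarrow> Dcf l m n (m12 0 G) (m12 0 H) = Dcf l (m + 1) n G H - Dcf l m (n + 1) G H"
proof -
  have e: "- (m + 1) - 1 = - m - 1 - 1" "- (n + 1) - 1 = - n - 1 - 1" by simp_all
  show "fins G H \<Longrightarrow> ?thesis"
    unfolding Dcf_def fins_def tr_ms e
    by (simp only: Mop_uminus Mop_m12 fin1_m12 mult_minus1) (simp add: Mop_uminus Mop_m12 fin1_m12 m_ap right_diff_distrib)
qed
lemma Dcf_Suc: "fins G H \<Longrightarrow> Dcf (l + 1) m n G H = Dcf l m n (m12 0 G) (m12 0 H)"
  unfolding Dcf_def fins_def tr_ms by (simp add: Mop_uminus Mop_m12 Mop_Suc fin1_m12 power_int_add)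

lemma Dcf_pow: "fins G H \<Longrightarrow> Dcf (l + int k) m n G H = Dcf l m n ((m12 0 ^^ k) G) ((m12 0 ^^ k) H)"
proof (induction k arbitrary: l)
  case (Suc k)
  have "Dcf (l + int (Suc k)) m n G H = Dcf ((l + 1) + int k) m n G H" by (simp add: algebra_simps)
  also have "\<dots> = Dcf (l + 1) m n ((m12 0 ^^ k) G) ((m12 0 ^^ k) H)" using Suc by blast
  also have "\<dots> = Dcf l m n ((m12 0 ^^ Suc k) G) ((m12 0 ^^ Suc k) H)" using Suc.prems by (simp add: Dcf_Suc fins_pow)
  finally show ?case .
qed simp

lemma Dcf_0: "fins G H \<Longrightarrow> Dcf 0 m n G H = G (- m - 1) (- n - 1) - H (- m - 1) (- n - 1)"
  unfolding Dcf_def fins_def by (simp add: Mop_0) (simp add: tr_def)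

lemma Dcf_local:
  assumes f: "fins G H" and loc: "(m12 0 ^^ N) G = (m12 0 ^^ N) H" and l: "l \<ge> int N"
  shows "Dcf l m n G H = 0"
proof -
  obtain k where k: "l = 0 + int (k + N)"
    using l by (metis add.commute add_0 nonneg_int_cases le_add_diff_inverse of_nat_add zero_le_imp_eq_int diff_ge_0_iff_ge)
  have "(m12 0 ^^ (k + N)) G = (m12 0 ^^ (k + N)) H" using loc by (simp add: funpow_add)
  moreover have "fins ((m12 0 ^^ (k + N)) G) ((m12 0 ^^ (k + N)) H)" using f by (rule fins_pow)
  ultimately show ?thesis unfolding k Dcf_pow[OF f] by (simp add: Dcf_0)
qed

lemma local_of_Dcf:
  assumes f: "fins G H" and z: "\<And>m n. Dcf (int N) m n G H = 0"
  shows "(m12 0 ^^ N) G = (m12 0 ^^ N) H"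
proof (intro ext)
  fix a b
  have "Dcf (0 + int N) (- a - 1) (- b - 1) G H = 0" using z by simp
  then show "(m12 0 ^^ N) G a b = (m12 0 ^^ N) H a b" unfolding Dcf_pow[OF f] using f by (simp add: Dcf_0 fins_pow)
qed

text \<open>For mutually local fields the Jacobi identity for all \<open>m\<close> follows from the case \<open>m = 0\<close>: both sides satisfy
the recursion obtained from multiplication by \<open>x\<^sub>1 - x\<^sub>2\<close>, and both vanish for large \<open>l\<close>.\<close>

lemma Dcf_full:
  assumes f: "fins G H" and loc: "(m12 0 ^^ N) G = (m12 0 ^^ N) H"
  shows "Dcf l m n G H = fsum (\<lambda>i. ibin m i * Dcf (l + int i) 0 (m + n - int i) G H)"
proof -
  let ?S = "\<lambda>l m n. fsum (\<lambda>i. ibin m i * Dcf (l + int i) 0 (m + n - int i) G H)"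
  have ev: "evz (\<lambda>i. c i * Dcf (l + int i) 0 (t - int i) G H)" for l c t
    by (rule evz_mult) (auto simp: evz_def intro!: exI[of _ "nat (int N - l)"] Dcf_local[OF f loc])
  have rec: "?S (l + 1) m n = ?S l (m + 1) n - ?S l m (n + 1)" for l m n
  proof -
    have "?S l (m + 1) n - ?S l m (n + 1) = fsum (\<lambda>i. ibin (m + 1) i * Dcf (l + int i) 0 ((m + n + 1) - int i) G H
       - ibin m i * Dcf (l + int i) 0 ((m + n + 1) - int i) G H)"
      by (subst fsum_diff[OF ev ev]) (simp add: algebra_simps)
    also have "\<dots> = fsum (\<lambda>i. (ibin (m + 1) i - ibin m i) * Dcf (l + int i) 0 ((m + n + 1) - int i) G H)"
      by (simp add: algebra_simps)
    also have "\<dots> = ?S (l + 1) m n"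
      by (subst fsum_shift[OF ev]) (simp add: ibin_Suc, simp add: algebra_simps)
    finally show ?thesis by simp
  qed
  have "\<forall>m n. Dcf l m n G H = ?S l m n" if "l \<ge> int N - int k" for k l
    using that
  proof (induction k arbitrary: l)
    case 0
    then have "Dcf (l + int i) m n G H = 0" for i m n by (intro Dcf_local[OF f loc]) auto
    from this[of 0] this show ?case by simp
  next
    case (Suc k)
    \<comment> \<open>The defect at level l depends only on m + n, because level l + 1 is already
      settled; it vanishes at m = 0, where only the term i = 0 survives.\<close>
    define E where "E = (\<lambda>m n. Dcf l m n G H - ?S l m n)"
    have E1: "E (m + 1) n = E m (n + 1)" for m n
    proof -
      have a: "?S l (m + 1) n = ?S l m (n + 1) + ?S (l + 1) m n"
        using rec[where l = l and m = m and n = n] by simp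
      have b: "Dcf l (m + 1) n G H = Dcf l m (n + 1) G H + Dcf (l + 1) m n G H"
        using Dcf_Suc[OF f, of l m n] Dcf_m12[OF f, of l m n] by simp
      have c: "Dcf (l + 1) m n G H = ?S (l + 1) m n" using Suc.IH[of "l + 1"] Suc.prems by simp
      show ?thesis unfolding E_def a b c by simp
    qed
    have E0: "E 0 n = 0" for n
      unfolding E_def by (subst fsum_eq[of 1]) (auto simp: ibin_0')
    have "\<forall>n. E m n = 0" for m
    proof (induction m rule: int_induct[of _ 0])
      case base then show ?case using E0 by simp
    next
      case (step1 m) then show ?case using E1[of m] by simp
    next
      case (step2 m)
      show ?case
      proof
        fix n
        have "E (m - 1) n = E (m - 1) ((n - 1) + 1)" by simp
        also have "\<dots> = E m (n - 1)" using E1[of "m - 1" "n - 1"] by simp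
        finally show "E (m - 1) n = 0" using step2 by simp
      qed
    qed
    then show ?case by (simp add: E_def)
  qed
  from this[of "nat (int N - l)" l] show ?thesis by auto
qed

text \<open>The residue in x1, as a series in x2. For vertex operators it represents the field of
  the product u_l v.\<close>

definition Jcf :: "int \<Rightarrow> (int \<Rightarrow> int \<Rightarrow> complex) \<Rightarrow> (int \<Rightarrow> int \<Rightarrow> complex) \<Rightarrow> int \<Rightarrow> complex" where
  "Jcf l G H = (\<lambda>p. Dcf l 0 (- p - 1) G H)"

lemma mx_Jcf: "fins G H \<Longrightarrow> mx c (Jcf l G H) = Jcf l (m2 c G) (m2 c H)"
  unfolding mx_def Jcf_def by (simp add: Dcf_m2)

lemma mx_Jcf': "fins G H \<Longrightarrow> mx c (Jcf l G H) = (\<lambda>p. Jcf l (m1 c G) (m1 c H) p - Jcf (l + 1) G H p)"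
  by (intro ext, simp only: mx_Jcf) (simp add: Jcf_def Dcf_m1 Dcf_m2 Dcf_m12 Dcf_Suc)

lemma mx_pow_Jcf: "fins G H \<Longrightarrow> (mx c ^^ k) (Jcf l G H) = Jcf l ((m2 c ^^ k) G) ((m2 c ^^ k) H)"
  by (induction k) (auto simp: mx_Jcf fins_pow)

text \<open>Since \<open>x\<^sub>2 - c = (x\<^sub>1 - c) - (x\<^sub>1 - x\<^sub>2)\<close>, a power of \<open>x\<^sub>1 - c\<close> that kills \<open>G\<close> and \<open>H\<close> can be traded for a power of
\<open>x - c\<close> that kills the residue.\<close>

lemma Jcf_kill:
  assumes "fins G H" "(m12 0 ^^ N) G = (m12 0 ^^ N) H"
    "(m1 c ^^ B) ((m2 c ^^ B') G) = (\<lambda>a b. 0)" "(m1 c ^^ B) ((m2 c ^^ B') H) = (\<lambda>a b. 0)"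
    "l \<ge> int N - int j"
  shows "(mx c ^^ (j + B + B')) (Jcf l G H) = (\<lambda>p. 0)"
  using assms
proof (induction "j + B" arbitrary: j B l G H)
  case 0
  then show ?case by (simp add: Jcf_def Dcf_local mx_zero)
next
  case (Suc k)
  \<comment> \<open>With j = 0 locality makes the residue vanish; with B = 0 the power of x2 - c
    acts on the products directly; otherwise one factor is traded and j + B drops.\<close>
  consider "j = 0" | "B = 0" | j' B'' where "j = Suc j'" "B = Suc B''" by (metis not0_implies_Suc)
  then show ?case
  proof cases
    case 1
    then show ?thesis using Suc.prems by (simp add: Jcf_def Dcf_local mx_zero)
  next
    case 2
    then have "(mx c ^^ B') (Jcf l G H) = (\<lambda>p. 0)"
      using Suc.prems by (simp add: mx_pow_Jcf) (simp add: Jcf_def)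
    then show ?thesis using 2 by (simp add: funpow_add mx_zero)
  next
    case 3
    have a: "(mx c ^^ (j + B'' + B')) (Jcf l (m1 c G) (m1 c H)) = (\<lambda>p. 0)"
    proof (rule Suc.hyps(1))
      show "fins (m1 c G) (m1 c H)" using Suc.prems fins_m by blast
      show "(m12 0 ^^ N) (m1 c G) = (m12 0 ^^ N) (m1 c H)"
        using Suc.prems(2) m_pow_comm(2)[of 1 c N 0 G] m_pow_comm(2)[of 1 c N 0 H] by simp
      show "(m1 c ^^ B'') ((m2 c ^^ B') (m1 c G)) = (\<lambda>a b. 0)" "(m1 c ^^ B'') ((m2 c ^^ B') (m1 c H)) = (\<lambda>a b. 0)"
        using Suc.prems m_pow_comm(1)[of 1 c B' c] 3 by (simp_all add: funpow_Suc_right del: funpow.simps)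
    qed (use Suc 3 in auto)
    have b: "(mx c ^^ (j' + B + B')) (Jcf (l + 1) G H) = (\<lambda>p. 0)"
      by (rule Suc.hyps(1)) (use Suc 3 in auto)
    have "(mx c ^^ (j + B + B')) (Jcf l G H) = (mx c ^^ (j' + B + B')) (mx c (Jcf l G H))"
      using 3 by (simp add: funpow_swap[of "mx c" "mx c" _ 1, simplified])
    also have "\<dots> = (\<lambda>p. 0)"
    proof -
      have e: "j + B'' + B' = j' + B + B'" using 3 by simp
      show ?thesis using a[unfolded e] b Suc.prems(1) by (simp only: mx_Jcf' mx_diff) simp
    qed
    finally show ?thesis .
  qed
qed

text \<open>Apply \<open>Jcf_kill\<close> to the difference of the two pairs: it is local and
  annihilated by powers of x1 - c and x2 - c, so its residue is annihilated by a power of x -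
  c.\<close>

lemma Jcf_expd:
  assumes c: "c \<noteq> 0" and f: "fins G H" "fins G' H'"
    and loc: "(m12 0 ^^ N) G = (m12 0 ^^ N) H" "(m12 0 ^^ N) G' = (m12 0 ^^ N) H'"
    and e: "(m1 c ^^ B) ((m2 c ^^ B') G') = (m1 c ^^ B) ((m2 c ^^ B') G)"
      "(m1 c ^^ B) ((m2 c ^^ B') H') = (m1 c ^^ B) ((m2 c ^^ B') H)"
    and low: "\<And>p. p < L \<Longrightarrow> Jcf l G' H' p = 0"
  shows "expd c (Jcf l G H) = Jcf l G' H'"
proof -
  define k where "k = nat (int N - l) + B + B'"
  have "(mx c ^^ k) (Jcf l (\<lambda>a b. G' a b - G a b) (\<lambda>a b. H' a b - H a b)) = (\<lambda>p. 0)"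
    unfolding k_def
    by (rule Jcf_kill[where N = N]) (use f loc e in \<open>auto intro: fins_diff simp: m_pow_diff\<close>)
  moreover have "Jcf l (\<lambda>a b. G' a b - G a b) (\<lambda>a b. H' a b - H a b) = (\<lambda>p. Jcf l G' H' p - Jcf l G H p)"
    using f by (simp add: Jcf_def Dcf_diff)
  ultimately have "(mx c ^^ k) (Jcf l G' H') = (mx c ^^ k) (Jcf l G H)"
    by (simp add: mx_diff fun_eq_iff)
  from expd_eqI[where L = L, OF c _ this] low show ?thesis by blast
qed

lemma low_fins:
  assumes "\<And>a b. b < A' \<Longrightarrow> G a b = 0" "\<And>a b. a < A \<Longrightarrow> H a b = 0"
  shows "fins G H"
  unfolding fins_def fin1_def tr_def evz_def
proof safe
  fix a b
  show "\<exists>I. \<forall>i\<ge>I. G (a + int i) (b - int i) = 0"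
    by (intro exI[of _ "nat (b - A' + 1)"] allI impI assms) auto
  show "\<exists>I. \<forall>i\<ge>I. H (b - int i) (a + int i) = 0"
    by (intro exI[of _ "nat (b - A + 1)"] allI impI assms) auto
qed

text \<open>The difference of the two expansions of \<open>(x\<^sub>1 - x\<^sub>2)\<^sup>-\<^sup>r\<^sup>-\<^sup>1\<close> is a derivative of the delta function, so the residue is
the coefficient of \<open>x\<^sub>0\<^sup>r\<close> in \<open>K(x + x\<^sub>0, x)\<close>.\<close>

lemma Jcf_res:
  assumes low: "\<And>a b. a < A \<or> b < A' \<Longrightarrow> K a b = 0"
    and S: "finite S" "{A..p + int r - A'} \<subseteq> S"
  shows "Jcf (- int r - 1) K K p = (\<Sum>a\<in>S. ibin a r * K a (p + int r - a))"
proof -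
  \<comment> \<open>Large enough that both half-infinite sums below stop before M, and that every
    index outside their joint range violates a lower bound or has vanishing binomial
    coefficient.\<close>
  define M where "M = nat (\<bar>A\<bar> + \<bar>A'\<bar> + \<bar>p\<bar> + int r + 2)"
  let ?f = "\<lambda>a. ibin a r * K a (p + int r - a)"
  have i1: "(-1) ^ i * ibin (- int r - 1) i = ibin (int r + int i) r" for i
  proof -
    have "ibin (- int r - 1) i = (-1) ^ i * ((of_nat r + of_nat i) gchoose i)"
      unfolding ibin_def using gbinomial_minus[of "of_nat r + 1 :: complex" i]
      by (simp add: algebra_simps minus_diff_commute)
    also have "(of_nat r + of_nat i gchoose i :: complex) = of_nat ((r + i) choose i)"
      by (simp add: binomial_gbinomial)
    also have "(r + i) choose i = (r + i) choose r" using binomial_symmetric[of i "r + i"] by simp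
    also have "(of_nat \<dots> :: complex) = ibin (int r + int i) r"
      by (simp add: ibin_def binomial_gbinomial)
    finally show ?thesis by (simp add: power_mult_distrib[symmetric] mult.assoc[symmetric])
  qed
  have i2: "ibin (- 1 - int i) r = (-1) ^ r * ibin (int r + int i) r" for i
    unfolding ibin_def using gbinomial_minus[of "of_nat i + 1 :: complex" r] by (simp add: algebra_simps)
  \<comment> \<open>The two sums run over a >= r and a < 0. The indices in between contribute
    nothing, so the sums join to one.\<close>
  have i3: "ibin a r = 0" if "0 \<le> a" "a < int r" for a
  proof -
    define n where "n = nat a"
    have n: "a = int n" using that(1) by (simp add: n_def)
    have "(of_nat n gchoose r :: complex) = of_nat (n choose r)" by (simp only: binomial_gbinomial)
    then show ?thesis using that n by (simp add: ibin_def)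
  qed
  have Ml: "p - int i < A'" "- 1 - int i < A" if "i \<ge> M" for i using that by (auto simp: M_def)
  have "Mop (- int r - 1) K (-1) p = fsum (\<lambda>i. ibin (int r + int i) r * K (int r + int i) (p - int i))"
    unfolding Mop_def i1 by (simp add: algebra_simps)
  also have "\<dots> = (\<Sum>i<M. ibin (int r + int i) r * K (int r + int i) (p - int i))"
    by (rule fsum_eq) (simp add: low Ml)
  also have "\<dots> = (\<Sum>a\<in>{int r..<int r + int M}. ?f a)"
    by (rule sum.reindex_bij_witness[of _ "\<lambda>a. nat (a - int r)" "\<lambda>i. int r + int i"]) auto
  finally have t1: "Mop (- int r - 1) K (-1) p = (\<Sum>a\<in>{int r..<int r + int M}. ?f a)" .
  have "Mop (- int r - 1) (tr K) p (-1) = fsum (\<lambda>i. ibin (int r + int i) r * K (- 1 - int i) (p + int r + 1 + int i))"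
    unfolding Mop_def i1 by (simp add: algebra_simps tr_def)
  also have "\<dots> = (\<Sum>i<M. ibin (int r + int i) r * K (- 1 - int i) (p + int r + 1 + int i))"
    by (rule fsum_eq) (simp add: low Ml)
  also have "\<dots> = (\<Sum>i<M. (-1) ^ r * ?f (- 1 - int i))"
    by (rule sum.cong) (auto simp: i2 algebra_simps)
  also have "\<dots> = (\<Sum>a\<in>{- int M..<0}. (-1) ^ r * ?f a)"
    by (rule sum.reindex_bij_witness[of _ "\<lambda>a. nat (- 1 - a)" "\<lambda>i. - 1 - int i"]) auto
  finally have t2: "Mop (- int r - 1) (tr K) p (-1) = (-1) ^ r * (\<Sum>a\<in>{- int M..<0}. ?f a)"
    by (simp add: sum_distrib_left)
  have sg: "(-1::complex) powi (- int r - 1) = - ((-1) ^ r)"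
    by (simp add: power_int_diff power_int_minus power_inverse[symmetric])
  have "Jcf (- int r - 1) K K p = (\<Sum>a\<in>{int r..<int r + int M}. ?f a) + (\<Sum>a\<in>{- int M..<0}. ?f a)"
    by (simp add: Jcf_def Dcf_def t1 t2 sg power_mult_distrib[symmetric] mult.assoc[symmetric])
  also have "\<dots> = (\<Sum>a\<in>{int r..<int r + int M} \<union> {- int M..<0}. ?f a)"
    by (rule sum.union_disjoint[symmetric]) auto
  also have "\<dots> = (\<Sum>a\<in>S \<union> ({int r..<int r + int M} \<union> {- int M..<0}). ?f a)"
  proof (rule sum.mono_neutral_left)
    show "\<forall>a\<in>S \<union> ({int r..<int r + int M} \<union> {- int M..<0}) - ({int r..<int r + int M} \<union> {- int M..<0}). ?f a = 0"
    proof
      fix a assume "a \<in> S \<union> ({int r..<int r + int M} \<union> {- int M..<0}) - ({int r..<int r + int M} \<union> {- int M..<0})"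
      then have "0 \<le> a \<and> a < int r \<or> a < A \<or> p + int r - a < A'" by (auto simp: M_def)
      then show "?f a = 0" using low i3 by auto
    qed
  qed (use S in auto)
  also have "\<dots> = (\<Sum>a\<in>S. ?f a)"
  proof (rule sum.mono_neutral_right)
    show "\<forall>a\<in>S \<union> ({int r..<int r + int M} \<union> {- int M..<0}) - S. ?f a = 0"
    proof
      fix a assume "a \<in> S \<union> ({int r..<int r + int M} \<union> {- int M..<0}) - S"
      then have "a \<notin> {A..p + int r - A'}" using S(2) by blast
      then have "a < A \<or> p + int r - a < A'" by auto
      then show "?f a = 0" using low by auto
    qed
  qed (use S in auto)
  finally show ?thesis .
qed

lemma Jcf_shift: "fins G H \<Longrightarrow> Jcf l G H = Jcf (l - int N) ((m12 0 ^^ N) G) ((m12 0 ^^ N) H)"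
  using Dcf_pow[of G H "l - int N" N] by (simp add: Jcf_def)

text \<open>In the Taylor coefficient of order r = N - l - 1 the two exponents add up to p + r,
  which is at least A + A' for a nonzero term.\<close>

lemma Jcf_low:
  assumes f: "fins G H" and loc: "(m12 0 ^^ N) G = (m12 0 ^^ N) H"
    and low: "\<And>a b. a < A \<or> b < A' \<Longrightarrow> (m12 0 ^^ N) G a b = 0"
    and p: "p < A + A' - \<bar>int N - l\<bar>"
  shows "Jcf l G H p = 0"
proof (cases "l \<ge> int N")
  case True
  then show ?thesis using Dcf_local[OF f loc] by (simp add: Jcf_def)
next
  case False
  define r where "r = nat (int N - l - 1)"
  have r: "l - int N = - int r - 1" using False by (simp add: r_def)
  show ?thesis
    unfolding Jcf_shift[OF f, of l N] loc[symmetric] r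
    by (subst Jcf_res[where A = A and A' = A' and S = "{A..p + int r - A'}"])
      (use low p r in auto)
qed

section \<open>Translation of the variable\<close>

definition bda :: "(int \<Rightarrow> 'a::zero) \<Rightarrow> bool" where "bda a \<longleftrightarrow> (\<exists>U. \<forall>p>U. a p = 0)"

text \<open>\<open>a(x + t)\<close> expanded in nonnegative powers of \<open>t\<close>; meaningful when \<open>a\<close> is bounded above.\<close>

definition Tr :: "complex \<Rightarrow> (int \<Rightarrow> complex) \<Rightarrow> int \<Rightarrow> complex" where
  "Tr t a = (\<lambda>p. fsum (\<lambda>i. (ibin (p + int i) i * t ^ i) * a (p + int i)))"

lemma bda_evz: "bda a \<Longrightarrow> evz (\<lambda>i. a (p + int i))"
proof -
  assume "bda a"
  then obtain U where "\<And>p. p > U \<Longrightarrow> a p = 0" by (auto simp: bda_def)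
  then show ?thesis unfolding evz_def by (intro exI[of _ "nat (U - p + 1)"]) auto
qed

lemma Tr_evz: "bda a \<Longrightarrow> evz (\<lambda>i. c i * a (p + int i) :: complex)"
  by (intro evz_mult bda_evz)

lemma bdaE2:
  assumes "bda a" "bda b" obtains U where "\<And>p. p > U \<Longrightarrow> a p = 0" "\<And>p. p > U \<Longrightarrow> b p = 0"
proof -
  obtain U1 U2 where "\<And>p. p > U1 \<Longrightarrow> a p = 0" "\<And>p. p > U2 \<Longrightarrow> b p = 0" using assms by (auto simp: bda_def)
  then show ?thesis by (intro that[of "max U1 U2"]) auto
qed

lemma bda_lin: "bda a \<Longrightarrow> bda b \<Longrightarrow> bda (\<lambda>p. k * a p + b p :: complex)"
proof -
  assume "bda a" "bda b"
  then obtain U where "\<And>p. p > U \<Longrightarrow> a p = 0" "\<And>p. p > U \<Longrightarrow> b p = 0" by (rule bdaE2) blast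
  then show ?thesis unfolding bda_def by (intro exI[of _ U]) auto
qed

lemma bda_zero [simp]: "bda (\<lambda>p. 0)" by (simp add: bda_def)

lemma bda_shift: "bda a \<Longrightarrow> bda (\<lambda>p. a (p - 1))"
  unfolding bda_def by (metis add.commute diff_add_cancel less_diff_eq)

lemma bda_mx: "bda a \<Longrightarrow> bda (mx c a)"
  using bda_lin[of a "\<lambda>p. a (p - 1)" "-c"] bda_shift[of a] by (simp add: mx_def)

lemma bda_mx_pow: "bda a \<Longrightarrow> bda ((mx c ^^ n) a)"
  by (induction n) (auto intro: bda_mx)

lemma Tr_lin: "bda a \<Longrightarrow> bda b \<Longrightarrow> Tr t (\<lambda>p. k * a p + b p) p = k * Tr t a p + Tr t b p"
  unfolding Tr_def by (subst fsum_lin[OF Tr_evz Tr_evz, symmetric]) (simp_all add: algebra_simps)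

lemma Tr_zero [simp]: "Tr t (\<lambda>p. 0) = (\<lambda>p. 0)" by (simp add: Tr_def)

lemma Tr_diff: "bda a \<Longrightarrow> bda b \<Longrightarrow> Tr t (\<lambda>p. a p - b p) p = Tr t a p - Tr t b p"
  using Tr_lin[of b a t "-1"] by simp

lemma Tr_high: "(\<And>p. p > U \<Longrightarrow> a p = 0) \<Longrightarrow> p > U \<Longrightarrow> Tr t a p = 0"
proof -
  assume "\<And>p. p > U \<Longrightarrow> a p = 0" "p > U"
  then have "a (p + int i) = 0" for i by simp
  then show ?thesis by (simp add: Tr_def)
qed

lemma bda_Tr: "bda a \<Longrightarrow> bda (Tr t a)"
  using Tr_high unfolding bda_def by metis

lemma Tr_shift: "bda a \<Longrightarrow> Tr t (\<lambda>p. a (p - 1)) p = Tr t a (p - 1) + t * Tr t a p"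
proof -
  assume b: "bda a"
  have E: "evz (\<lambda>i. c i * a (p - 1 + int i))" for c by (rule Tr_evz[OF b])
  have E': "evz (\<lambda>i. c i * a (p + int i))" for c by (rule Tr_evz[OF b])
  have p1: "p + int (Suc i) - 1 = p + int i" "p - 1 + int (Suc i) = p + int i" "p + int i - 1 = p - 1 + int i" for i by auto
  have ib: "ibin (p + int (Suc i)) (Suc i) = ibin (p + int i) i + ibin (p + int i) (Suc i)" for i
    using ibin_Suc[of "p + int i" i] by (simp add: algebra_simps)
  have "Tr t (\<lambda>p. a (p - 1)) p = a (p - 1) + fsum (\<lambda>i. (ibin (p + int (Suc i)) (Suc i) * t ^ Suc i) * a (p + int i))"
    unfolding Tr_def p1(3) by (subst fsum_shift[OF E], simp only: p1) simp
  also have "fsum (\<lambda>i. (ibin (p + int (Suc i)) (Suc i) * t ^ Suc i) * a (p + int i))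
    = fsum (\<lambda>i. t * ((ibin (p + int i) i * t ^ i) * a (p + int i)) + (ibin (p + int i) (Suc i) * t ^ Suc i) * a (p + int i))"
    by (rule arg_cong[where f = fsum], rule ext, unfold ib) (simp add: algebra_simps)
  also have "\<dots> = t * Tr t a p + fsum (\<lambda>i. (ibin (p + int i) (Suc i) * t ^ Suc i) * a (p + int i))"
    unfolding Tr_def by (rule fsum_lin[OF E' E'])
  also have "a (p - 1) + \<dots> = Tr t a (p - 1) + t * Tr t a p"
  proof -
    have "Tr t a (p - 1) = a (p - 1) + fsum (\<lambda>i. (ibin (p + int i) (Suc i) * t ^ Suc i) * a (p + int i))"
      unfolding Tr_def by (subst fsum_shift[OF E], simp only: p1) simp
    then show ?thesis by simp
  qed
  finally show ?thesis .
qed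

lemma Tr_mx: "bda a \<Longrightarrow> Tr t (mx c a) = mx (c - t) (Tr t a)"
  unfolding mx_def
  by (intro ext) (use Tr_lin[of a "\<lambda>p. a (p - 1)" t "-c"] bda_shift[of a] Tr_shift[of a] in \<open>simp add: algebra_simps\<close>)

lemma Tr_mx_pow: "bda a \<Longrightarrow> Tr t ((mx c ^^ n) a) = (mx (c - t) ^^ n) (Tr t a)"
  by (induction n) (auto simp: Tr_mx bda_mx_pow)

lemma ibin_vanish: "0 \<le> a \<Longrightarrow> a < int r \<Longrightarrow> ibin a r = 0"
proof -
  assume a: "0 \<le> a" "a < int r"
  define n where "n = nat a"
  have n: "a = int n" using a by (simp add: n_def)
  have "(of_nat n gchoose r :: complex) = of_nat (n choose r)" by (simp only: binomial_gbinomial)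
  then show ?thesis using a n by (simp add: ibin_def)
qed

text \<open>If p < 0 <= p + i, then 0 <= p + i < i and the binomial coefficient vanishes: a
  nonnegative power of x translates to a polynomial.\<close>

lemma Tr_nonneg: "(\<And>p. p < 0 \<Longrightarrow> a p = 0) \<Longrightarrow> p < 0 \<Longrightarrow> Tr t a p = 0"
proof -
  assume a: "\<And>p. p < 0 \<Longrightarrow> a p = 0" and p: "p < 0"
  have "ibin (p + int i) i * t ^ i * a (p + int i) = 0" for i
    using a[of "p + int i"] ibin_vanish[of "p + int i" i] p by (cases "p + int i < 0") auto
  then show ?thesis by (simp only: Tr_def fsum_zero)
qed

text \<open>The binomial coefficients with upper entry i - 1 vanish for i > 0. This invariance of
  residues lets \<open>Jcf\<close> commute with translations.\<close>

lemma Tr_res: "Tr t a (-1) = a (-1)"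
  unfolding Tr_def by (subst fsum_eq[of 1]) (auto simp: ibin_vanish)

section \<open>Translation of two variables\<close>

definition T1 where "T1 t G = (\<lambda>a b. Tr t (\<lambda>a. G a b) a)"
definition T2 where "T2 t G = (\<lambda>a b. Tr t (G a) b)" for G :: "int \<Rightarrow> int \<Rightarrow> complex"

text \<open>The truncation of a product X(v, x2) X(u, x1) w: one upper bound for x1, but for x2 a
  bound depending on the exponent of x1.\<close>

definition bd12 :: "(int \<Rightarrow> int \<Rightarrow> complex) \<Rightarrow> bool" where
  "bd12 G \<longleftrightarrow> (\<exists>U. \<forall>a>U. \<forall>b. G a b = 0) \<and> (\<forall>a. bda (G a))"

lemma bd12_col: "bd12 G \<Longrightarrow> bda (\<lambda>a. G a b)" unfolding bd12_def bda_def by blast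
lemma bd12_row: "bd12 G \<Longrightarrow> bda (G a)" unfolding bd12_def by blast

lemma bd12_fin1: "bd12 G \<Longrightarrow> fin1 G"
proof -
  assume "bd12 G"
  then obtain U where U: "\<And>a b. a > U \<Longrightarrow> G a b = 0" by (auto simp: bd12_def)
  show ?thesis unfolding fin1_def evz_def
  proof (intro allI)
    fix a b
    show "\<exists>I. \<forall>i\<ge>I. G (a + int i) (b - int i) = 0"
      by (intro exI[of _ "nat (U - a + 1)"] allI impI U) auto
  qed
qed

lemma bd12_lin: "bd12 G \<Longrightarrow> bd12 H \<Longrightarrow> bd12 (\<lambda>a b. k * G a b + H a b)"
proof -
  assume b: "bd12 G" "bd12 H"
  then obtain U1 U2 where "\<And>a b. a > U1 \<Longrightarrow> G a b = 0" "\<And>a b. a > U2 \<Longrightarrow> H a b = 0" unfolding bd12_def by blast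
  then have 1: "\<exists>U. \<forall>a>U. \<forall>b. k * G a b + H a b = 0" by (intro exI[of _ "max U1 U2"]) auto
  have "\<forall>a. bda (\<lambda>b. k * G a b + H a b)" using b bda_lin unfolding bd12_def by blast
  with 1 show ?thesis unfolding bd12_def by blast
qed

lemma bd12_shift1: "bd12 G \<Longrightarrow> bd12 (\<lambda>a b. G (a - 1) b)"
proof -
  assume b: "bd12 G"
  then obtain U1 where "\<And>a b. a > U1 \<Longrightarrow> G a b = 0" by (auto simp: bd12_def)
  then have "\<forall>a>U1 + 1. \<forall>b. G (a - 1) b = 0" by auto
  then show ?thesis unfolding bd12_def using b by (auto simp: bd12_def)
qed

lemma bd12_shift2: "bd12 G \<Longrightarrow> bd12 (\<lambda>a b. G a (b - 1))"
  unfolding bd12_def using bda_shift by blast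

lemma bd12_m12: "bd12 G \<Longrightarrow> bd12 (m12 s G)"
  unfolding m12_def
  using bd12_lin[OF bd12_shift2[of G] bd12_lin[OF _ bd12_shift1[of G], of G "-s"], of "-1"]
  by (simp add: algebra_simps)

lemma bd12_m12_pow: "bd12 G \<Longrightarrow> bd12 ((m12 s ^^ n) G)"
  by (induction n) (auto intro: bd12_m12)

lemma T1_m12: "bd12 G \<Longrightarrow> T1 t (m12 s G) = m12 (s - t) (T1 t G)"
proof (intro ext)
  fix a b assume G: "bd12 G"
  have "T1 t (m12 s G) a b = Tr t (\<lambda>a. mx s (\<lambda>a. G a b) a - G a (b - 1)) a"
    by (simp add: T1_def m12_def mx_def algebra_simps)
  also have "\<dots> = mx (s - t) (Tr t (\<lambda>a. G a b)) a - Tr t (\<lambda>a. G a (b - 1)) a"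
    using bd12_col[OF G] by (subst Tr_diff) (auto simp: Tr_mx bda_mx)
  also have "\<dots> = m12 (s - t) (T1 t G) a b" by (simp add: T1_def m12_def mx_def algebra_simps)
  finally show "T1 t (m12 s G) a b = m12 (s - t) (T1 t G) a b" .
qed

lemma T2_m12: "bd12 G \<Longrightarrow> T2 t (m12 s G) = m12 (s + t) (T2 t G)"
proof (intro ext)
  fix a b assume G: "bd12 G"
  have "T2 t (m12 s G) a b = Tr t (\<lambda>b. G (a - 1) b - mx (- s) (G a) b) b"
    by (simp add: T2_def m12_def mx_def algebra_simps)
  also have "\<dots> = Tr t (G (a - 1)) b - mx (- s - t) (Tr t (G a)) b"
    using bd12_row[OF G] by (subst Tr_diff) (auto simp: Tr_mx bda_mx)
  also have "\<dots> = m12 (s + t) (T2 t G) a b" by (simp add: T2_def m12_def mx_def algebra_simps)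
  finally show "T2 t (m12 s G) a b = m12 (s + t) (T2 t G) a b" .
qed

lemma bd12_T1: "bd12 G \<Longrightarrow> bd12 (T1 t G)"
  unfolding bd12_def
proof safe
  fix U assume U: "\<forall>a>U. \<forall>b. G a b = 0" and r: "\<forall>a. bda (G a)"
  show "\<exists>U. \<forall>a>U. \<forall>b. T1 t G a b = 0"
    unfolding T1_def by (intro exI[of _ U] allI impI Tr_high[where U = U]) (use U in auto)
  fix a
  have "T1 t G a = (\<lambda>b. \<Sum>i<nat (U - a + 1). (ibin (a + int i) i * t ^ i) * G (a + int i) b)"
    unfolding T1_def Tr_def by (rule ext, rule fsum_eq) (use U in auto)
  moreover have "bda (\<lambda>b. \<Sum>i<n. (ibin (a + int i) i * t ^ i) * G (a + int i) b)" for n :: nat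
    by (induction n) (use r in \<open>auto intro!: bda_lin simp: add.commute[of "sum _ _"]\<close>)
  ultimately show "bda (T1 t G a)" by simp
qed

lemma bd12_T2: "bd12 G \<Longrightarrow> bd12 (T2 t G)"
  unfolding bd12_def
proof safe
  fix U assume U: "\<forall>a>U. \<forall>b. G a b = 0" and r: "\<forall>a. bda (G a)"
  show "\<exists>U. \<forall>a>U. \<forall>b. T2 t G a b = 0"
    unfolding T2_def by (intro exI[of _ U] allI impI) (use U in \<open>simp add: Tr_def\<close>)
  show "bda (T2 t G a)" for a unfolding T2_def using r bda_Tr by auto
qed

lemma T21_m12: "bd12 G \<Longrightarrow> T2 t' (T1 t ((m12 s ^^ n) G)) = (m12 (s + t' - t) ^^ n) (T2 t' (T1 t G))"
proof (induction n)
  case (Suc n)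
  then show ?case
    by (simp add: T1_m12 T2_m12 bd12_m12_pow bd12_T1) (simp add: algebra_simps)
qed simp

lemma T12_swap:
  assumes "\<And>a b. a > U \<Longrightarrow> K a b = 0" "\<And>a b. b > U \<Longrightarrow> K a b = 0"
  shows "T2 t' (T1 t K) = T1 t (T2 t' K)"
proof (intro ext)
  fix a b
  define n where "n = nat (U - min a b + 1)"
  have 1: "Tr t (\<lambda>a. K a b) a = (\<Sum>i<n. (ibin (a + int i) i * t ^ i) * K (a + int i) b)" for b
    unfolding Tr_def by (rule fsum_eq) (use assms in \<open>auto simp: n_def\<close>)
  have 2: "Tr t' (K a) b = (\<Sum>i<n. (ibin (b + int i) i * t' ^ i) * K a (b + int i))" for a
    unfolding Tr_def by (rule fsum_eq) (use assms in \<open>auto simp: n_def\<close>)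
  have h1: "Tr t (\<lambda>a. K a b) a = 0" if "b > U" for b using assms that by (simp add: Tr_def)
  have h2: "Tr t' (K a) b = 0" if "a > U" for a using assms that by (simp add: Tr_def)
  have "T2 t' (T1 t K) a b = (\<Sum>j<n. (ibin (b + int j) j * t' ^ j) * Tr t (\<lambda>a. K a (b + int j)) a)"
    unfolding T1_def T2_def by (subst Tr_def, rule fsum_eq) (use h1 in \<open>auto simp: n_def\<close>)
  also have "\<dots> = (\<Sum>j<n. \<Sum>i<n. (ibin (b + int j) j * t' ^ j) * ((ibin (a + int i) i * t ^ i) * K (a + int i) (b + int j)))"
    by (simp add: 1 sum_distrib_left)
  also have "\<dots> = (\<Sum>i<n. \<Sum>j<n. (ibin (a + int i) i * t ^ i) * ((ibin (b + int j) j * t' ^ j) * K (a + int i) (b + int j)))"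
    by (subst sum.swap) (simp add: mult_ac)
  also have "\<dots> = (\<Sum>i<n. (ibin (a + int i) i * t ^ i) * Tr t' (K (a + int i)) b)"
    by (simp add: 2 sum_distrib_left)
  also have "\<dots> = T1 t (T2 t' K) a b"
    unfolding T1_def T2_def by (subst (2) Tr_def, rule fsum_eq[symmetric]) (use h2 in \<open>auto simp: n_def\<close>)
  finally show "T2 t' (T1 t K) a b = T1 t (T2 t' K) a b" .
qed

lemma T_tr: "T1 t (tr G) = tr (T2 t G)" "T2 t (tr G) = tr (T1 t G)"
  by (auto simp: T1_def T2_def tr_def)

lemma T_scale: "bd12 G \<Longrightarrow> T2 t' (T1 t (\<lambda>a b. k * G a b)) = (\<lambda>a b. k * T2 t' (T1 t G) a b)"
proof -
  assume G: "bd12 G"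
  have "T1 t (\<lambda>a b. k * G a b) = (\<lambda>a b. k * T1 t G a b)"
    unfolding T1_def by (intro ext) (use Tr_lin[OF bd12_col[OF G] bda_zero, of t k] in simp)
  moreover have "T2 t' (\<lambda>a b. k * T1 t G a b) = (\<lambda>a b. k * T2 t' (T1 t G) a b)"
    unfolding T2_def by (intro ext) (use Tr_lin[OF bd12_row[OF bd12_T1[OF G]] bda_zero, of t' k] in simp)
  ultimately show ?thesis by simp
qed

text \<open>The two products are truncated in different ways and translated in opposite orders. They
  are compared at their common multiple by (x1 - x2)^N, which is bounded above in both variables, so
  that the translations commute on it; x1 - x2 becomes x1 - x2 - (t' - t).\<close>

lemma T_local:
  assumes G: "bd12 G" and H: "bd12 (tr H)" and loc: "(m12 0 ^^ N) G = (m12 0 ^^ N) H"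
  shows "(m12 (t' - t) ^^ N) (T2 t' (T1 t G)) = (m12 (t' - t) ^^ N) (T1 t (T2 t' H))"
proof -
  define K where "K = (m12 0 ^^ N) G"
  have K1: "bd12 K" unfolding K_def by (rule bd12_m12_pow[OF G])
  have trK: "(m12 0 ^^ N) (tr H) = (\<lambda>a b. (-1) ^ N * tr K a b)"
    using tr_m12[of N 0 H] by (simp add: K_def loc)
  have "bd12 (\<lambda>a b. (-1) ^ N * tr K a b)" using bd12_m12_pow[OF H, where s = 0 and n = N] unfolding trK .
  from bd12_lin[OF this this, of 0] have K2: "bd12 (tr K)"
    unfolding bd12_def bda_def by simp
  obtain U1 U2 where U: "\<And>a b. a > U1 \<Longrightarrow> K a b = 0" "\<And>a b. b > U2 \<Longrightarrow> K a b = 0"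
    using K1 K2 unfolding bd12_def tr_def by blast
  have sw: "T2 t' (T1 t K) = T1 t (T2 t' K)"
    by (rule T12_swap[of "max U1 U2"]) (use U in auto)
  have "(m12 (t' - t) ^^ N) (T2 t' (T1 t G)) = T1 t (T2 t' K)"
    using T21_m12[OF G, where t' = t' and t = t and s = 0 and n = N] sw by (simp add: K_def)
  moreover have "(m12 (t - t') ^^ N) (T2 t (T1 t' (tr H))) = (\<lambda>a b. (-1) ^ N * tr (T1 t (T2 t' K)) a b)"
    using T21_m12[OF H, where t' = t and t = t' and s = 0 and n = N] T_scale[OF K2, of t t' "(-1)^N"] by (simp add: trK T_tr)
  then have "(m12 (- (t' - t)) ^^ N) (tr (T1 t (T2 t' H))) = (\<lambda>a b. (-1) ^ N * tr (T1 t (T2 t' K)) a b)"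
    by (simp add: T_tr)
  then have "(m12 (t' - t) ^^ N) (T1 t (T2 t' H)) = T1 t (T2 t' K)"
    unfolding tr_m12 by (simp add: fun_eq_iff tr_def)
  ultimately show ?thesis by simp
qed

lemma bd12_Mop: "bd12 G \<Longrightarrow> bd12 (Mop l G)"
  unfolding bd12_def
proof safe
  fix U assume U: "\<forall>a>U. \<forall>b. G a b = 0" and r: "\<forall>a. bda (G a)"
  show "\<exists>U. \<forall>a>U. \<forall>b. Mop l G a b = 0"
    unfolding Mop_def by (intro exI[of _ "U + l"]) (use U in auto)
  fix a
  have "Mop l G a = (\<lambda>b. \<Sum>i<nat (U - a + l + 1). ((-1) ^ i * ibin l i) * G (a - l + int i) (b - int i))"
    unfolding Mop_def by (rule ext, rule fsum_eq) (use U in auto)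
  moreover have "bda (\<lambda>b. \<Sum>i<n. ((-1) ^ i * ibin l i) * G (a - l + int i) (b - int i))" for n :: nat
  proof (induction n)
    case (Suc n)
    obtain V where "\<forall>p>V. G (a - l + int n) p = 0" using r unfolding bda_def by blast
    then have "bda (\<lambda>b. G (a - l + int n) (b - int n))"
      unfolding bda_def by (intro exI[of _ "V + int n"]) auto
    from bda_lin[OF this Suc] show ?case by (simp add: add.commute)
  qed simp
  ultimately show "bda (Mop l G a)" by simp
qed

text \<open>Negative \<open>l\<close> are reached by dividing by \<open>x\<^sub>1 - x\<^sub>2\<close>, which is injective here.\<close>

lemma Mop_T: "bd12 G \<Longrightarrow> Mop l (T2 t (T1 t G)) = T2 t (T1 t (Mop l G))"
proof -
  assume G: "bd12 G"
  have f: "fin1 (T2 t (T1 t G))" by (intro bd12_fin1 bd12_T1 bd12_T2 G)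
  have step: "m12 0 (T2 t (T1 t (Mop l G))) = T2 t (T1 t (Mop (l + 1) G))" for l
    using T21_m12[OF bd12_Mop[OF G, of l], where t' = t and t = t and s = 0 and n = 1] by (simp add: Mop_Suc bd12_fin1[OF G])
  show ?thesis
  proof (induction l rule: int_induct[of _ 0])
    case base
    then show ?case using f by (simp add: Mop_0 bd12_fin1[OF G])
  next
    case (step1 l)
    then show ?case unfolding Mop_Suc[OF f] step[symmetric] by simp
  next
    case (step2 l)
    have "m12 0 (Mop (l - 1) (T2 t (T1 t G))) = m12 0 (T2 t (T1 t (Mop (l - 1) G)))"
      unfolding Mop_Suc[OF f, of "l - 1", symmetric] step by (simp add: step2)
    then show ?case
      by (rule m12_inj_fin1[rotated]) (intro fin1_Mop f bd12_fin1 bd12_T1 bd12_T2 bd12_Mop G)+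
  qed
qed

lemma Jcf_eq: "Jcf l G H p = Mop l G (- 1) p - (-1) powi l * Mop l (tr H) p (- 1)"
  by (simp add: Jcf_def Dcf_def)

text \<open>Translating both variables equally preserves x1 - x2, and the translation in x1
  disappears in the residue.\<close>

lemma Jcf_T:
  assumes G: "bd12 G" and H: "bd12 (tr H)"
  shows "Jcf l (T2 t (T1 t G)) (T1 t (T2 t H)) = Tr t (Jcf l G H)"
proof (intro ext)
  fix p
  have a: "Mop l (T2 t (T1 t G)) (- 1) p = Tr t (Mop l G (-1)) p"
    unfolding Mop_T[OF G] unfolding T1_def T2_def Tr_res ..
  have b: "Mop l (tr (T1 t (T2 t H))) p (- 1) = Tr t (\<lambda>p. Mop l (tr H) p (-1)) p"
    unfolding T_tr[symmetric] Mop_T[OF H] unfolding T1_def T2_def Tr_res ..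
  have "Tr t (Jcf l G H) p = Tr t (\<lambda>p. (- ((-1) powi l)) * Mop l (tr H) p (- 1) + Mop l G (- 1) p) p"
    by (rule arg_cong[where f = "\<lambda>f. Tr t f p"]) (simp add: Jcf_eq fun_eq_iff)
  also have "\<dots> = - ((-1) powi l) * Tr t (\<lambda>p. Mop l (tr H) p (- 1)) p + Tr t (Mop l G (- 1)) p"
    by (rule Tr_lin[OF bd12_col[OF bd12_Mop[OF H]] bd12_row[OF bd12_Mop[OF G]]])
  finally show "Jcf l (T2 t (T1 t G)) (T1 t (T2 t H)) p = Tr t (Jcf l G H) p"
    by (simp add: Jcf_eq a b)
qed

section \<open>Functionals with rational matrix coefficients\<close>

lemma vs_complex: "vector_space ((*) :: complex \<Rightarrow> complex \<Rightarrow> complex)"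
  by unfold_locales (auto simp: algebra_simps)

lemma linD:
  assumes "Vector_Spaces.linear s1 s2 f"
  shows "f (x + y) = f x + f y" "f (s1 c x) = s2 c (f x)" "f 0 = 0"
proof -
  show "f (s1 c x) = s2 c (f x)" using assms by (auto simp: Vector_Spaces.linear_iff)
  have a: "f (x + y) = f x + f y" for x y using assms by (auto simp: Vector_Spaces.linear_iff)
  then show "f (x + y) = f x + f y" .
  show "f 0 = 0" using a[of 0 0] by simp
qed

lemma linI:
  assumes "vector_space s1" "vector_space s2" "\<And>c x y. f (s1 c x + y) = s2 c (f x) + f y"
  shows "Vector_Spaces.linear s1 s2 f"
proof -
  interpret v1: vector_space s1 by fact
  interpret v2: vector_space s2 by fact
  have a: "f (x + y) = f x + f y" for x y using assms(3)[of 1 x y] by simp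
  have "f 0 = 0" using a[of 0 0] by simp
  then have "f (s1 c x) = s2 c (f x)" for c x using assms(3)[of c x 0] by simp
  then show ?thesis using a assms by (auto simp: Vector_Spaces.linear_iff)
qed

lemma lin_sum:
  assumes "Vector_Spaces.linear s1 s2 f"
  shows "f (sum g S) = (\<Sum>x\<in>S. f (g x))"
  by (induction S rule: infinite_finite_induct) (auto simp: linD[OF assms])

text \<open>\<open>X v p\<close> is the coefficient of \<open>x\<^sup>p\<close> of the opposite vertex operator.  The last algebraic assumption is the case
\<open>m = 0\<close> of the opposite Jacobi identity.\<close>

locale oppmod =
  fixes scV :: "complex \<Rightarrow> 'v::ab_group_add \<Rightarrow> 'v" and Yv :: "'v \<Rightarrow> int \<Rightarrow> 'v \<Rightarrow> 'v" and vac :: 'v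
    and scW :: "complex \<Rightarrow> 'w::ab_group_add \<Rightarrow> 'w" and X :: "'v \<Rightarrow> int \<Rightarrow> 'w \<Rightarrow> 'w" and z :: complex
  assumes Xlin: "Vector_Spaces.linear scW scW (X v p)"
    and Xlinv: "Vector_Spaces.linear scV scW (\<lambda>v. X v p w)"
    and Xhigh: "\<exists>U. \<forall>p>U. X v p w = 0"
    and Xvac: "X vac p w = (if p = 0 then w else 0)"
    and Ytrunc: "\<exists>N. \<forall>n\<ge>N. Yv u n v = 0"
    and Xloc: "\<exists>N. \<forall>\<alpha> w. Vector_Spaces.linear scW (*) \<alpha> \<longrightarrow>
      (m12 0 ^^ N) (\<lambda>a b. \<alpha> (X v b (X u a w))) = (m12 0 ^^ N) (\<lambda>a b. \<alpha> (X u a (X v b w)))"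
    and Xjac: "Vector_Spaces.linear scW (*) \<alpha> \<Longrightarrow>
      \<alpha> (X (Yv u l v) p w) = Jcf l (\<lambda>a b. \<alpha> (X v b (X u a w))) (\<lambda>a b. \<alpha> (X u a (X v b w))) p"
    and z0: "z \<noteq> 0"
begin

abbreviation "lin \<equiv> Vector_Spaces.linear scW ((*) :: complex \<Rightarrow> complex \<Rightarrow> complex)"

lemma Wvs: "vector_space scW" using Xlin by (auto simp: Vector_Spaces.linear_iff)
lemma Vvs: "vector_space scV" using Xlinv by (auto simp: Vector_Spaces.linear_iff)

sublocale W: vector_space scW by (rule Wvs)

text \<open>\<open>X(v, x + t)\<close>; for \<open>t = 0\<close> it leads to \<open>Y\<^sup>R\<close> and for \<open>t = z\<close> to \<open>Y\<^sup>L\<close>.\<close>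

definition XT :: "complex \<Rightarrow> 'v \<Rightarrow> int \<Rightarrow> 'w \<Rightarrow> 'w" where
  "XT t v p w = fsum (\<lambda>i. scW (ibin (p + int i) i * t ^ i) (X v (p + int i) w))"

lemma XT_sum: "(\<And>q. q > U \<Longrightarrow> X v q w = 0) \<Longrightarrow> p + int n > U \<Longrightarrow>
  XT t v p w = (\<Sum>i<n. scW (ibin (p + int i) i * t ^ i) (X v (p + int i) w))"
  unfolding XT_def by (rule fsum_eq) auto

lemma XT_lin: "Vector_Spaces.linear scW scW (XT t v p)"
proof (rule linI[OF Wvs Wvs])
  fix c x y
  obtain U1 U2 U3 where U: "\<And>q. q > U1 \<Longrightarrow> X v q x = 0" "\<And>q. q > U2 \<Longrightarrow> X v q y = 0"
    "\<And>q. q > U3 \<Longrightarrow> X v q (scW c x + y) = 0"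
    using Xhigh by metis
  define n where "n = nat (max U1 (max U2 U3) - p + 1)"
  have n: "p + int n > U1" "p + int n > U2" "p + int n > U3" by (auto simp: n_def)
  show "XT t v p (scW c x + y) = scW c (XT t v p x) + XT t v p y"
    unfolding XT_sum[where U = U1, OF U(1) n(1), simplified] XT_sum[where U = U2, OF U(2) n(2), simplified]
      XT_sum[where U = U3, OF U(3) n(3), simplified]
    by (simp add: linD[OF Xlin] W.scale_sum_right sum.distrib W.scale_right_distrib mult.commute)
qed

lemma XT_linv: "Vector_Spaces.linear scV scW (\<lambda>v. XT t v p w)"
proof (rule linI[OF Vvs Wvs])
  fix c x y
  obtain U1 U2 U3 where U: "\<And>q. q > U1 \<Longrightarrow> X x q w = 0" "\<And>q. q > U2 \<Longrightarrow> X y q w = 0"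
    "\<And>q. q > U3 \<Longrightarrow> X (scV c x + y) q w = 0"
    using Xhigh by metis
  define n where "n = nat (max U1 (max U2 U3) - p + 1)"
  have n: "p + int n > U1" "p + int n > U2" "p + int n > U3" by (auto simp: n_def)
  show "XT t (scV c x + y) p w = scW c (XT t x p w) + XT t y p w"
    unfolding XT_sum[where U = U1, OF U(1) n(1), simplified] XT_sum[where U = U2, OF U(2) n(2), simplified]
      XT_sum[where U = U3, OF U(3) n(3), simplified]
    by (simp add: linD[OF Xlinv] W.scale_sum_right sum.distrib W.scale_right_distrib mult.commute)
qed

lemma bda_X: "lin \<alpha> \<Longrightarrow> bda (\<lambda>p. \<alpha> (X v p w))"
  using Xhigh[of v w] unfolding bda_def by (metis linD(3))
lemma XT_ap: "lin \<alpha> \<Longrightarrow> \<alpha> (XT t v p w) = Tr t (\<lambda>p. \<alpha> (X v p w)) p"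
proof -
  assume a: "lin \<alpha>"
  obtain U where U: "\<And>q. q > U \<Longrightarrow> X v q w = 0" using Xhigh by metis
  define n where "n = nat (U - p + 1)"
  have "\<alpha> (XT t v p w) = (\<Sum>i<n. (ibin (p + int i) i * t ^ i) * \<alpha> (X v (p + int i) w))"
    by (subst XT_sum[OF U, where n = n]) (auto simp: n_def lin_sum[OF a] linD[OF a])
  also have "\<dots> = Tr t (\<lambda>p. \<alpha> (X v p w)) p"
    unfolding Tr_def by (rule fsum_eq[symmetric]) (use U in \<open>auto simp: n_def linD[OF a]\<close>)
  finally show ?thesis .
qed

lemma XT_vac: "XT t vac p w = (if p = 0 then w else 0)"
proof -
  have *: "scW (ibin (p + int i) i * t ^ i) (X vac (p + int i) w) = (if p = 0 \<and> i = 0 then w else 0)" for i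
    by (auto simp: Xvac ibin_0')
  show ?thesis unfolding XT_def *
    by (subst fsum_eq[of 1]) auto
qed

lemma XT_0: "XT 0 v p w = X v p w"
  unfolding XT_def by (subst fsum_eq[of 1]) auto

lemma lin_comp: "lin \<alpha> \<Longrightarrow> Vector_Spaces.linear scW scW f \<Longrightarrow> lin (\<lambda>w. \<alpha> (f w))"
  by (rule linI[OF Wvs vs_complex]) (simp add: linD)

lemma G_T: "lin \<alpha> \<Longrightarrow> (\<lambda>a b. \<alpha> (XT t' v b (XT t u a w))) = T2 t' (T1 t (\<lambda>a b. \<alpha> (X v b (X u a w))))"
  unfolding T1_def T2_def
  by (intro ext) (simp add: XT_ap XT_ap[OF lin_comp[OF _ Xlin], symmetric])

lemma H_T: "lin \<alpha> \<Longrightarrow> (\<lambda>a b. \<alpha> (XT t u a (XT t' v b w))) = T1 t (T2 t' (\<lambda>a b. \<alpha> (X u a (X v b w))))"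
  unfolding T1_def T2_def
  by (intro ext) (simp add: XT_ap XT_ap[OF lin_comp[OF _ Xlin], symmetric])

lemma bd12_X: "lin \<alpha> \<Longrightarrow> bd12 (\<lambda>a b. \<alpha> (X v b (X u a w)))"
  unfolding bd12_def
proof safe
  assume a: "lin \<alpha>"
  obtain U where U: "\<And>q. q > U \<Longrightarrow> X u q w = 0" using Xhigh by metis
  then show "\<exists>U. \<forall>a>U. \<forall>b. \<alpha> (X v b (X u a w)) = 0"
    by (intro exI[of _ U]) (simp add: linD[OF Xlin] linD[OF a])
  show "bda (\<lambda>b. \<alpha> (X v b (X u c w)))" for c by (rule bda_X[OF a])
qed

lemma bd12_X': "lin \<alpha> \<Longrightarrow> bd12 (tr (\<lambda>a b. \<alpha> (X u a (X v b w))))"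
  using bd12_X[of \<alpha> u v w] by (simp add: tr_def)

lemma XT_loc: "\<exists>N. \<forall>\<alpha> w. lin \<alpha> \<longrightarrow>
  (m12 (t' - t) ^^ N) (\<lambda>a b. \<alpha> (XT t' v b (XT t u a w))) = (m12 (t' - t) ^^ N) (\<lambda>a b. \<alpha> (XT t u a (XT t' v b w)))"
  using Xloc[of v u] T_local[OF bd12_X bd12_X'] by (metis G_T H_T)

lemma XT_jac: "lin \<alpha> \<Longrightarrow>
  \<alpha> (XT t (Yv u l v) p w) = Jcf l (\<lambda>a b. \<alpha> (XT t v b (XT t u a w))) (\<lambda>a b. \<alpha> (XT t u a (XT t v b w))) p"
  unfolding XT_ap[of _ t "Yv u l v"] G_T H_T by (simp add: Jcf_T bd12_X bd12_X' Xjac)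

text \<open>For \<open>t = 0\<close> the second pole is \<open>z\<close>, for \<open>t = z\<close> it is \<open>-z\<close>.\<close>

definition pole :: "complex \<Rightarrow> complex" where "pole t = z - 2 * t"

text \<open>The P(z)-linear functionals in algebraic form: L encodes the pole order at 0, B that at
  z, and both precede the quantifier over w.\<close>

definition D :: "('w \<Rightarrow> complex) set" where
  "D = {\<alpha>. lin \<alpha> \<and> (\<forall>v. \<exists>B L. \<forall>w. \<forall>p<L. (mx z ^^ B) (\<lambda>p. \<alpha> (X v p w)) p = 0)}"

abbreviation base_pt :: "complex \<Rightarrow> bool" where "base_pt t \<equiv> t = 0 \<or> t = z"

lemma pole_nonzero: "base_pt t \<Longrightarrow> pole t \<noteq> 0" using z0 by (auto simp: pole_def)

lemma D_lin: "\<alpha> \<in> D \<Longrightarrow> lin \<alpha>" by (simp add: D_def)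

text \<open>Under x -> x + z the pole at z moves to 0 and the pole at 0 moves to -z, so for t = z
  the two bounds exchange roles.\<close>

lemma D_rat: "\<alpha> \<in> D \<Longrightarrow> base_pt t \<Longrightarrow> \<exists>B L. \<forall>w. \<forall>p<L. (mx (pole t) ^^ B) (\<lambda>p. \<alpha> (XT t v p w)) p = 0"
proof (elim disjE)
  assume "\<alpha> \<in> D" "t = 0"
  then show ?thesis by (simp add: D_def XT_0 pole_def)
next
  assume a: "\<alpha> \<in> D" and t: "t = z"
  then obtain B L where BL: "\<And>w p. p < L \<Longrightarrow> (mx z ^^ B) (\<lambda>p. \<alpha> (X v p w)) p = 0" unfolding D_def by blast
  define A where "A = nat (- L)"
  have "(mx (pole t) ^^ A) (\<lambda>p. \<alpha> (XT t v p w)) p = 0" if p: "p < - int B" for w p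
  proof -
    note b = bda_X[OF D_lin[OF a], of v w]
    define c where "c = (mx 0 ^^ A) ((mx z ^^ B) (\<lambda>p. \<alpha> (X v p w)))"
    have c: "c p = 0" if "p < 0" for p using BL that by (simp add: c_def mx_0_pow A_def)
    have "Tr z c = (mx (- z) ^^ A) ((mx 0 ^^ B) (Tr z (\<lambda>p. \<alpha> (X v p w))))"
      unfolding c_def using b by (simp add: Tr_mx_pow bda_mx_pow)
    also have "\<dots> = (mx 0 ^^ B) ((mx (- z) ^^ A) (\<lambda>p. \<alpha> (XT z v p w)))"
      using XT_ap[OF D_lin[OF a], of z v _ w] by (simp add: mx_pow_comm)
    finally have "Tr z c (p + int B) = (mx (- z) ^^ A) (\<lambda>p. \<alpha> (XT z v p w)) p"
      by (simp add: mx_0_pow)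
    then show ?thesis using Tr_nonneg[of c "p + int B" z] c p t by (simp add: pole_def)
  qed
  then show ?thesis by blast
qed

lemma D_ratl: "\<alpha> \<in> D \<Longrightarrow> base_pt t \<Longrightarrow> ratl (pole t) (\<lambda>p. \<alpha> (XT t v p w))"
  using D_rat[of \<alpha> t v] unfolding ratl_def by blast

definition Op :: "complex \<Rightarrow> 'v \<Rightarrow> int \<Rightarrow> ('w \<Rightarrow> complex) \<Rightarrow> 'w \<Rightarrow> complex" where
  "Op t v n \<alpha> = (\<lambda>w. expd (pole t) (\<lambda>p. \<alpha> (XT t v p w)) n)"

lemma Op_lin: "\<alpha> \<in> D \<Longrightarrow> base_pt t \<Longrightarrow> lin (Op t v n \<alpha>)"
proof (rule linI[OF Wvs vs_complex])
  fix c x y assume a: "\<alpha> \<in> D" "base_pt t"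
  show "Op t v n \<alpha> (scW c x + y) = c * Op t v n \<alpha> x + Op t v n \<alpha> y"
    unfolding Op_def using expd_lin[OF pole_nonzero D_ratl D_ratl, OF a(2) a a, of c v x v y]
    by (simp add: linD[OF D_lin[OF a(1)]] linD[OF XT_lin])
qed

lemma D_add: "\<alpha> \<in> D \<Longrightarrow> \<beta> \<in> D \<Longrightarrow> (\<lambda>w. c * \<alpha> w + \<beta> w) \<in> D"
proof -
  assume a: "\<alpha> \<in> D" and b: "\<beta> \<in> D"
  have "lin (\<lambda>w. c * \<alpha> w + \<beta> w)"
    by (rule linI[OF Wvs vs_complex]) (simp add: linD[OF D_lin[OF a]] linD[OF D_lin[OF b]] algebra_simps)
  moreover have "\<exists>B L. \<forall>w. \<forall>p<L. (mx z ^^ B) (\<lambda>p. c * \<alpha> (X v p w) + \<beta> (X v p w)) p = 0" for v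
  proof -
    obtain B1 L1 where 1: "\<And>w p. p < L1 \<Longrightarrow> (mx z ^^ B1) (\<lambda>p. \<alpha> (X v p w)) p = 0" using a unfolding D_def by blast
    obtain B2 L2 where 2: "\<And>w p. p < L2 \<Longrightarrow> (mx z ^^ B2) (\<lambda>p. \<beta> (X v p w)) p = 0" using b unfolding D_def by blast
    show ?thesis
    proof (intro exI allI impI)
      fix w p assume p: "p < min L1 L2"
      show "(mx z ^^ max B1 B2) (\<lambda>p. c * \<alpha> (X v p w) + \<beta> (X v p w)) p = 0"
        unfolding mx_lin using mx_low_mono[where L = L1, OF 1, of "max B1 B2" p w] mx_low_mono[where L = L2, OF 2, of "max B1 B2" p w] p by simp
    qed
  qed
  ultimately show ?thesis unfolding D_def by blast
qed

lemma D_zero: "(\<lambda>w. 0) \<in> D"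
proof -
  have "lin (\<lambda>w. 0)" by (rule linI[OF Wvs vs_complex]) simp
  then show ?thesis by (auto simp: D_def mx_zero)
qed

lemma D_sum: "finite S \<Longrightarrow> (\<And>x. x \<in> S \<Longrightarrow> \<alpha> x \<in> D) \<Longrightarrow> (\<lambda>w. \<Sum>x\<in>S. c x * \<alpha> x w) \<in> D"
proof (induction S rule: finite_induct)
  case empty show ?case using D_zero by simp
next
  case (insert x F)
  then show ?case using D_add[of "\<alpha> x" "\<lambda>w. \<Sum>x\<in>F. c x * \<alpha> x w" "c x"] by simp
qed

lemma Op_add: "\<alpha> \<in> D \<Longrightarrow> \<beta> \<in> D \<Longrightarrow> base_pt t \<Longrightarrow> Op t v n (\<lambda>w. c * \<alpha> w + \<beta> w) = (\<lambda>w. c * Op t v n \<alpha> w + Op t v n \<beta> w)"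
  unfolding Op_def by (intro ext) (simp add: expd_lin pole_nonzero D_ratl)

lemma Op_zero: "base_pt t \<Longrightarrow> Op t v n (\<lambda>w. 0) = (\<lambda>w. 0)"
  unfolding Op_def by (simp add: expd_zero pole_nonzero)

lemma Op_sum: "finite S \<Longrightarrow> (\<And>x. x \<in> S \<Longrightarrow> \<alpha> x \<in> D) \<Longrightarrow> base_pt t \<Longrightarrow>
  Op t v n (\<lambda>w. \<Sum>x\<in>S. c x * \<alpha> x w) = (\<lambda>w. \<Sum>x\<in>S. c x * Op t v n (\<alpha> x) w)"
proof (induction S rule: finite_induct)
  case empty then show ?case by (simp add: Op_zero)
next
  case (insert x F)
  then show ?case using Op_add[of "\<alpha> x" "\<lambda>w. \<Sum>x\<in>F. c x * \<alpha> x w" t v n "c x"] D_sum[of F \<alpha> c] by simp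
qed

lemma Op_linv: "\<alpha> \<in> D \<Longrightarrow> base_pt t \<Longrightarrow> Op t (scV c u + v) n \<alpha> = (\<lambda>w. c * Op t u n \<alpha> w + Op t v n \<alpha> w)"
  unfolding Op_def by (intro ext)
    (simp add: linD[OF XT_linv] linD[OF D_lin] expd_lin pole_nonzero D_ratl)

lemma Op_zerov: "\<alpha> \<in> D \<Longrightarrow> base_pt t \<Longrightarrow> Op t 0 n \<alpha> = (\<lambda>w. 0)"
  unfolding Op_def by (intro ext) (simp add: linD[OF XT_linv] linD[OF D_lin] expd_zero pole_nonzero)

lemma Op_vac: "\<alpha> \<in> D \<Longrightarrow> base_pt t \<Longrightarrow> Op t vac n \<alpha> = (if n = 0 then \<alpha> else (\<lambda>w. 0))"
proof
  fix w assume a: "\<alpha> \<in> D" and t: "base_pt t"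
  have "expd (pole t) (\<lambda>p. if p = 0 then \<alpha> w else 0) = (\<lambda>p. if p = 0 then \<alpha> w else 0)"
    by (rule expd_eqI[OF pole_nonzero[OF t], where B = 0 and L = 0]) auto
  moreover have "(\<lambda>p. \<alpha> (XT t vac p w)) = (\<lambda>p. if p = 0 then \<alpha> w else 0)"
    by (auto simp: XT_vac linD[OF D_lin[OF a]])
  ultimately show "Op t vac n \<alpha> w = (if n = 0 then \<alpha> else (\<lambda>w. 0)) w"
    by (simp add: Op_def)
qed

lemma two_sided_ex:
  assumes t: "base_pt t" "base_pt t'"
  shows "\<exists>N0. \<forall>N\<ge>N0. \<forall>\<alpha>\<in>D. \<exists>B B' A A'. \<forall>w. two_sided (pole t) (pole t') (t' - t) N B B' A A'
     (\<lambda>a b. \<alpha> (XT t' v b (XT t u a w))) (\<lambda>a b. \<alpha> (XT t u a (XT t' v b w)))"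
proof -
  obtain N0 where N0: "\<And>\<alpha> w. lin \<alpha> \<Longrightarrow>
    (m12 (t' - t) ^^ N0) (\<lambda>a b. \<alpha> (XT t' v b (XT t u a w))) = (m12 (t' - t) ^^ N0) (\<lambda>a b. \<alpha> (XT t u a (XT t' v b w)))"
    using XT_loc by metis
  show ?thesis
  proof (rule exI[of _ N0], intro allI impI ballI)
    fix N \<alpha> assume N: "N \<ge> N0" and a: "\<alpha> \<in> D"
    obtain B A where 1: "\<And>w p. p < A \<Longrightarrow> (mx (pole t) ^^ B) (\<lambda>p. \<alpha> (XT t u p w)) p = 0"
      using D_rat[OF a t(1), of u] by blast
    obtain B' A' where 2: "\<And>w p. p < A' \<Longrightarrow> (mx (pole t') ^^ B') (\<lambda>p. \<alpha> (XT t' v p w)) p = 0"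
      using D_rat[OF a t(2), of v] by blast
    obtain k where k: "N = k + N0" using N by (metis le_add_diff_inverse2)
    show "\<exists>B B' A A'. \<forall>w. two_sided (pole t) (pole t') (t' - t) N B B' A A'
     (\<lambda>a b. \<alpha> (XT t' v b (XT t u a w))) (\<lambda>a b. \<alpha> (XT t u a (XT t' v b w)))"
    proof (rule exI[of _ B], rule exI[of _ B'], rule exI[of _ A], rule exI[of _ A'], rule allI, unfold_locales)
      fix w
      show "pole t \<noteq> 0" "pole t' \<noteq> 0" using pole_nonzero t by auto
      show "t' - t = 0 \<or> t' - t = pole t" "t' - t = 0 \<or> t' - t = - pole t'" using t by (auto simp: pole_def)
      show "(m12 (t' - t) ^^ N) (\<lambda>a b. \<alpha> (XT t' v b (XT t u a w))) = (m12 (t' - t) ^^ N) (\<lambda>a b. \<alpha> (XT t u a (XT t' v b w)))"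
        using N0[OF D_lin[OF a], of w] by (simp add: k funpow_add)
      show "\<And>a b. a < A \<Longrightarrow> (m1 (pole t) ^^ B) (\<lambda>a b. \<alpha> (XT t u a (XT t' v b w))) a b = 0"
        by (simp add: m1_pow 1)
      show "\<And>a b. b < A' \<Longrightarrow> (m2 (pole t') ^^ B') (\<lambda>a b. \<alpha> (XT t' v b (XT t u a w))) a b = 0"
        by (simp add: m2_pow 2)
    qed
  qed
qed

lemma G2_Op: "one_sided.G2 (pole t') (\<lambda>a b. \<alpha> (XT t' v b (XT t u a w))) = (\<lambda>a b. Op t' v b \<alpha> (XT t u a w))"
  if "two_sided (pole t) (pole t') s N B B' A A' (\<lambda>a b. \<alpha> (XT t' v b (XT t u a w))) (\<lambda>a b. \<alpha> (XT t u a (XT t' v b w)))"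
proof -
  interpret two_sided "pole t" "pole t'" s N B B' A A' "\<lambda>a b. \<alpha> (XT t' v b (XT t u a w))" "\<lambda>a b. \<alpha> (XT t u a (XT t' v b w))"
    by (rule that)
  show ?thesis by (simp add: G2_def Op_def)
qed

lemma Op_low: "\<alpha> \<in> D \<Longrightarrow> base_pt t \<Longrightarrow> \<exists>A. \<forall>n<A. Op t v n \<alpha> = (\<lambda>w. 0)"
proof -
  assume a: "\<alpha> \<in> D" and t: "base_pt t"
  obtain B L where "\<And>w p. p < L \<Longrightarrow> (mx (pole t) ^^ B) (\<lambda>p. \<alpha> (XT t v p w)) p = 0"
    using D_rat[OF a t, of v] by blast
  from expd_props(1)[where L = L, OF pole_nonzero[OF t] this] show ?thesis unfolding Op_def by blast
qed

text \<open>Pair the mode with a test operator at base point 0 and read off \<open>G2_rat\<close>: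
  for fixed n the pole bounds depend on n but not on w. The surplus order N k lands at 0 for t' = 0
  and at z for t' = z.\<close>

lemma Op_D: "\<alpha> \<in> D \<Longrightarrow> base_pt t' \<Longrightarrow> Op t' v n \<alpha> \<in> D"
proof -
  assume a: "\<alpha> \<in> D" and t': "base_pt t'"
  have "\<exists>B L. \<forall>w. \<forall>p<L. (mx z ^^ B) (\<lambda>p. Op t' v n \<alpha> (X u p w)) p = 0" for u
  proof -
    obtain N B B' A A' where ts: "\<And>w. two_sided (pole 0) (pole t') (t' - 0) N B B' A A'
     (\<lambda>a b. \<alpha> (XT t' v b (XT 0 u a w))) (\<lambda>a b. \<alpha> (XT 0 u a (XT t' v b w)))"
      using two_sided_ex[of 0 t' v u] t' a by blast
    define k where "k = nat (n - A' + 1)"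
    have n: "n < A' + int k" by (simp add: k_def)
    have *: "(m1 t' ^^ (N * k)) ((m1 z ^^ B) (\<lambda>a b. Op t' v b \<alpha> (X u a w))) a n = 0" if "a < A" for a w
      using one_sided.G2_rat[OF two_sided.axioms(1)[OF ts[of w]] that n] G2_Op[OF ts[of w]]
      by (simp add: pole_def XT_0)
    show ?thesis
    proof (cases "t' = 0")
      case True
      have "(mx z ^^ B) (\<lambda>p. Op t' v n \<alpha> (X u p w)) p = 0" if "p < A - int (N * k)" for p w
        using *[of "p + int (N * k)" w] that by (simp add: True m1_pow mx_0_pow)
      then show ?thesis by blast
    next
      case False
      then have "t' = z" using t' by auto
      then have "(mx z ^^ (N * k + B)) (\<lambda>p. Op t' v n \<alpha> (X u p w)) p = 0" if "p < A" for p w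
        using *[OF that, of w] by (simp add: m1_pow funpow_add)
      then show ?thesis by blast
    qed
  qed
  then show ?thesis using Op_lin[OF a t'] by (simp add: D_def)
qed

lemma G'_Op:
  assumes "two_sided (pole t) (pole t') s N B B' A A' (\<lambda>a b. \<alpha> (XT t' v b (XT t u a w))) (\<lambda>a b. \<alpha> (XT t u a (XT t' v b w)))"
  shows "one_sided.G' (pole t) (pole t') (\<lambda>a b. \<alpha> (XT t' v b (XT t u a w))) = (\<lambda>a b. Op t u a (Op t' v b \<alpha>) w)"
    "two_sided.H' (pole t) (pole t') (\<lambda>a b. \<alpha> (XT t u a (XT t' v b w))) = (\<lambda>a b. Op t' v b (Op t u a \<alpha>) w)"
proof -
  interpret two_sided "pole t" "pole t'" s N B B' A A' "\<lambda>a b. \<alpha> (XT t' v b (XT t u a w))" "\<lambda>a b. \<alpha> (XT t u a (XT t' v b w))"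
    by (rule assms)
  show "G' = (\<lambda>a b. Op t u a (Op t' v b \<alpha>) w)" by (simp add: G'_def G2_def Op_def)
  show "H' = (\<lambda>a b. Op t' v b (Op t u a \<alpha>) w)" by (simp add: H'_eq Op_def)
qed

lemma Op_commute: "\<alpha> \<in> D \<Longrightarrow> Op 0 u a (Op z v b \<alpha>) = Op z v b (Op 0 u a \<alpha>)"
proof
  fix w assume al: "\<alpha> \<in> D"
  obtain N B B' A A' where ts: "two_sided (pole 0) (pole z) (z - 0) N B B' A A'
     (\<lambda>a b. \<alpha> (XT z v b (XT 0 u a w))) (\<lambda>a b. \<alpha> (XT 0 u a (XT z v b w)))"
    using two_sided_ex[of 0 z v u] al by blast
  from two_sided.commute[OF ts] z0 G'_Op[OF ts]
  show "Op 0 u a (Op z v b \<alpha>) w = Op z v b (Op 0 u a \<alpha>) w" by (simp add: fun_eq_iff)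
qed

definition OpOp :: "complex \<Rightarrow> 'v \<Rightarrow> 'v \<Rightarrow> ('w \<Rightarrow> complex) \<Rightarrow> 'w \<Rightarrow> int \<Rightarrow> int \<Rightarrow> complex" where
  "OpOp t u v \<alpha> w = (\<lambda>a b. Op t u a (Op t v b \<alpha>) w)"

text \<open>What a pair of fields with the same base point supplies to the tensor product: locality,
  lower bounds and the iterate formula, with one A for all w.\<close>

definition local_bound :: "complex \<Rightarrow> 'v \<Rightarrow> 'v \<Rightarrow> nat \<Rightarrow> ('w \<Rightarrow> complex) \<Rightarrow> int \<Rightarrow> bool" where
  "local_bound t u v N \<alpha> A \<longleftrightarrow> (\<forall>w. let G = OpOp t u v \<alpha> w; H = tr (OpOp t v u \<alpha> w) in
     (m12 0 ^^ N) G = (m12 0 ^^ N) H \<and>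
     (\<forall>a b. a < A \<or> b < A \<longrightarrow> (m12 0 ^^ N) G a b = 0) \<and>
     (\<forall>a b. b < A \<longrightarrow> G a b = 0) \<and> (\<forall>a b. a < A \<longrightarrow> H a b = 0) \<and>
     (\<forall>l p. Op t (Yv u l v) p \<alpha> w = Jcf l G H p))"

lemma local_boundD:
  assumes "local_bound t u v N \<alpha> A"
  shows "(m12 0 ^^ N) (OpOp t u v \<alpha> w) = (m12 0 ^^ N) (tr (OpOp t v u \<alpha> w))"
    "a < A \<or> b < A \<Longrightarrow> (m12 0 ^^ N) (OpOp t u v \<alpha> w) a b = 0"
    "b < A \<Longrightarrow> OpOp t u v \<alpha> w a b = 0" "a < A \<Longrightarrow> tr (OpOp t v u \<alpha> w) a b = 0"
    "Op t (Yv u l v) p \<alpha> w = Jcf l (OpOp t u v \<alpha> w) (tr (OpOp t v u \<alpha> w)) p"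
  using assms unfolding local_bound_def Let_def by blast+

text \<open>For equal base points s = 0, so the nested expansions agree with the original products
  after multiplication by powers of x1 and x2 minus the pole whose exponents do not depend on the
  coefficient; \<open>Jcf_expd\<close> requires exactly this.\<close>

lemma Op_local:
  assumes t: "base_pt t"
  obtains N0 where "\<And>N \<alpha>. N \<ge> N0 \<Longrightarrow> \<alpha> \<in> D \<Longrightarrow> \<exists>A. local_bound t u v N \<alpha> A"
proof -
  obtain N0 where N0: "\<And>N \<alpha>. N \<ge> N0 \<Longrightarrow> \<alpha> \<in> D \<Longrightarrow> \<exists>B B' A A'. \<forall>w. two_sided (pole t) (pole t) (t - t) N B B' A A'
     (\<lambda>a b. \<alpha> (XT t v b (XT t u a w))) (\<lambda>a b. \<alpha> (XT t u a (XT t v b w)))"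
    using two_sided_ex[OF t t, of v u] by blast
  show ?thesis
  proof (rule that[of N0])
    fix N \<alpha> assume N: "N \<ge> N0" and al: "\<alpha> \<in> D"
    obtain B B' A1 A2 where ts: "\<And>w. two_sided (pole t) (pole t) 0 N B B' A1 A2
     (\<lambda>a b. \<alpha> (XT t v b (XT t u a w))) (\<lambda>a b. \<alpha> (XT t u a (XT t v b w)))"
      using N0[OF N al] by (auto)
    define A where "A = min A1 A2"
    show "\<exists>A. local_bound t u v N \<alpha> A"
      unfolding local_bound_def Let_def
    proof (intro exI[of _ A] allI conjI)
      fix w
      let ?G = "\<lambda>a b. \<alpha> (XT t v b (XT t u a w))" and ?H = "\<lambda>a b. \<alpha> (XT t u a (XT t v b w))"
      let ?G' = "OpOp t u v \<alpha> w" and ?H' = "tr (OpOp t v u \<alpha> w)"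
      interpret ts: two_sided "pole t" "pole t" 0 N B B' A1 A2 ?G ?H by (rule ts)
      have e: "ts.G' = ?G'" "ts.H' = ?H'" using G'_Op[OF ts[of w]] by (simp_all add: OpOp_def tr_def)
      show loc: "(m12 0 ^^ N) ?G' = (m12 0 ^^ N) ?H'" using ts.local unfolding e .
      have low: "(m12 0 ^^ N) ?G' a b = 0" if "a < A1 \<or> b < A2" for a b
        using ts.K'_low[OF that] unfolding e .
      show "a < A \<or> b < A \<longrightarrow> (m12 0 ^^ N) ?G' a b = 0" for a b using low by (auto simp: A_def)
      have g: "?G' a b = 0" if "b < A2" for a b using ts.G'_low[OF that] unfolding e .
      then show "b < A \<longrightarrow> ?G' a b = 0" for a b by (auto simp: A_def)
      have h: "?H' a b = 0" if "a < A1" for a b using ts.op.G'_low[OF that, of b] ts.H'_def e(2)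
        by (metis tr_def)
      then show "a < A \<longrightarrow> ?H' a b = 0" for a b by (auto simp: A_def)
      have f': "fins ?G' ?H'" by (rule low_fins[where A = A1 and A' = A2]) (use g h in auto)
      have f: "fins ?G ?H" unfolding fins_def
        using bd12_fin1[OF bd12_T2[OF bd12_T1[OF bd12_X[OF D_lin[OF al]]]], of t t v u w]
          bd12_fin1[OF bd12_T2[OF bd12_T1[OF bd12_X'[OF D_lin[OF al]]]], of t t u v w]
        by (simp add: G_T[OF D_lin[OF al]] H_T[OF D_lin[OF al]] T_tr)
      fix l p
      have "expd (pole t) (Jcf l ?G ?H) = Jcf l ?G' ?H'"
      proof (rule Jcf_expd[OF ts.z f f' ts.loc loc, of B B'])
        show "(m1 (pole t) ^^ B) ((m2 (pole t) ^^ B') ?G') = (m1 (pole t) ^^ B) ((m2 (pole t) ^^ B') ?G)"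
          using ts.G'_full unfolding e by simp
        show "(m1 (pole t) ^^ B) ((m2 (pole t) ^^ B') ?H') = (m1 (pole t) ^^ B) ((m2 (pole t) ^^ B') ?H)"
          using ts.H'_full unfolding e by simp
        show "p < A1 + A2 - \<bar>int N - l\<bar> \<Longrightarrow> Jcf l ?G' ?H' p = 0" for p
          by (rule Jcf_low[OF f' loc low])
      qed
      moreover have "(\<lambda>p. \<alpha> (XT t (Yv u l v) p w)) = Jcf l ?G ?H"
        using XT_jac[OF D_lin[OF al]] by blast
      ultimately show "Op t (Yv u l v) p \<alpha> w = Jcf l ?G' ?H' p" by (simp add: Op_def)
    qed
  qed
qed

end

section \<open>The tensor product of the two actions\<close>

lemma isum_eq: "finite S \<Longrightarrow> (\<And>i. i \<notin> S \<Longrightarrow> t i = 0) \<Longrightarrow> isum t = sum t S"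
  unfolding isum_def by (rule sum.mono_neutral_left) auto

lemma sum_int_shift:
  fixes f :: "int \<Rightarrow> 'a::comm_monoid_add"
  assumes "finite S" "finite E" "\<And>x. x \<notin> S \<Longrightarrow> f x = 0" "\<And>x. x \<in> S \<Longrightarrow> x - d \<in> E"
  shows "(\<Sum>e\<in>E. f (e + d)) = (\<Sum>x\<in>S. f x)"
proof -
  have "(\<Sum>e\<in>E. f (e + d)) = (\<Sum>x\<in>(\<lambda>e. e + d) ` E. f x)"
    by (subst sum.reindex) (auto simp: inj_on_def)
  also have "\<dots> = (\<Sum>x\<in>S. f x)"
  proof (rule sum.mono_neutral_right)
    show "S \<subseteq> (\<lambda>e. e + d) ` E" using assms(4) by force
  qed (use assms in auto)
  finally show ?thesis .
qed

lemma has_sum_diff: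
  fixes f g :: "'a \<Rightarrow> complex"
  assumes "(f has_sum a) A" "(g has_sum b) A"
  shows "((\<lambda>x. f x - g x) has_sum (a - b)) A"
  using has_sum_add[OF assms(1) has_sum_cmult_right[OF assms(2), of "-1"]] by simp

text \<open>The coefficients are signed binomials, but what matters is that the sum is finite and
  they do not depend on G: (x1 - x2)^N then passes through the linear operators
  \<open>Op\<close>.\<close>

lemma m12_pow_sum: "\<exists>\<kappa>. \<forall>G a b. (m12 0 ^^ N) G a b = (\<Sum>j\<le>N. \<kappa> j * G (a - int N + int j) (b - int j))"
proof (induction N)
  case 0
  show ?case by (rule exI[of _ "\<lambda>_. 1"]) simp
next
  case (Suc N)
  then obtain \<kappa> where \<kappa>: "\<And>G a b. (m12 0 ^^ N) G a b = (\<Sum>j\<le>N. \<kappa> j * G (a - int N + int j) (b - int j))" by blast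
  show ?case
  proof (intro exI allI)
    fix G :: "int \<Rightarrow> int \<Rightarrow> complex" and a b
    let ?\<kappa> = "\<lambda>j. (if j \<le> N then \<kappa> j else 0) - (case j of 0 \<Rightarrow> 0 | Suc i \<Rightarrow> \<kappa> i)"
    let ?G = "\<lambda>j. G (a - int (Suc N) + int j) (b - int j)"
    have "(\<Sum>j\<le>Suc N. ?\<kappa> j * ?G j) = (\<Sum>j\<le>Suc N. (if j \<le> N then \<kappa> j else 0) * ?G j)
        - (\<Sum>j\<le>Suc N. (case j of 0 \<Rightarrow> 0 | Suc i \<Rightarrow> \<kappa> i) * ?G j)"
      by (simp add: left_diff_distrib sum_subtractf)
    also have "(\<Sum>j\<le>Suc N. (if j \<le> N then \<kappa> j else 0) * ?G j) = (m12 0 ^^ N) G (a - 1) b"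
      by (simp add: \<kappa> algebra_simps)
    also have "(\<Sum>j\<le>Suc N. (case j of 0 \<Rightarrow> 0 | Suc i \<Rightarrow> \<kappa> i) * ?G j) = (m12 0 ^^ N) G a (b - 1)"
      by (simp only: sum.atMost_Suc_shift) (simp add: \<kappa> algebra_simps)
    finally have e: "(\<Sum>j\<le>Suc N. ?\<kappa> j * ?G j) = (m12 0 ^^ N) G (a - 1) b - (m12 0 ^^ N) G a (b - 1)" .
    have "m12 0 V a b = V (a - 1) b - V a (b - 1)" for V by (simp add: m_ap)
    then show "(m12 0 ^^ Suc N) G a b = (\<Sum>j\<le>Suc N. ?\<kappa> j * ?G j)" unfolding e by simp
  qed
qed

section \<open>Series in four variables and their restriction to the diagonal\<close>

type_synonym arr4 = "int \<Rightarrow> int \<Rightarrow> int \<Rightarrow> int \<Rightarrow> complex"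

text \<open>The first two indices are the exponents of the left variables x1, x2, the last two those
  of the right variables x3, x4. On the diagonal both multiplications become x1 - x2.\<close>

definition mL :: "arr4 \<Rightarrow> arr4" where "mL F = (\<lambda>i i' c c'. F (i - 1) i' c c' - F i (i' - 1) c c')"
definition mR :: "arr4 \<Rightarrow> arr4" where "mR F = (\<lambda>i i' c c'. F i i' (c - 1) c' - F i i' c (c' - 1))"

lemma mL_pow: "(mL ^^ N) F i i' c c' = (m12 0 ^^ N) (\<lambda>i i'. F i i' c c') i i'"
  by (induction N arbitrary: i i') (auto simp: mL_def m_ap)
lemma mR_pow: "(mR ^^ N) F i i' c c' = (m12 0 ^^ N) (F i i') c c'"
  by (induction N arbitrary: c c') (auto simp: mR_def m_ap)

lemma mLR_comm: "(mL ^^ N) ((mR ^^ M) F) = (mR ^^ M) ((mL ^^ N) F)"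
  by (rule funpow_swap) (auto simp: mL_def mR_def fun_eq_iff)

text \<open>\<open>G\<close> arises from \<open>F\<close> by setting \<open>x\<^sub>3 = x\<^sub>1\<close> and \<open>x\<^sub>4 = x\<^sub>2\<close>.\<close>

definition DG :: "arr4 \<Rightarrow> (int \<Rightarrow> int \<Rightarrow> complex) \<Rightarrow> bool" where
  "DG F G \<longleftrightarrow> (\<forall>p q. ((\<lambda>(i, i'). F i i' (p - i) (q - i')) has_sum G p q) UNIV)"

lemma DG_unique: "DG F G \<Longrightarrow> DG F H \<Longrightarrow> G = H"
  unfolding DG_def by (intro ext) (blast intro: has_sum_unique)

lemma DG_mR: "DG F G \<Longrightarrow> DG (mR F) (m12 0 G)"
  unfolding DG_def
proof (intro allI)
  fix p q
  assume a: "\<forall>p q. ((\<lambda>(i, i'). F i i' (p - i) (q - i')) has_sum G p q) UNIV"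
  have "((\<lambda>x. (case x of (i, i') \<Rightarrow> F i i' (p - 1 - i) (q - i')) - (case x of (i, i') \<Rightarrow> F i i' (p - i) (q - 1 - i')))
    has_sum (G (p - 1) q - G p (q - 1))) UNIV"
    by (intro has_sum_diff a[rule_format])
  then show "((\<lambda>(i, i'). mR F i i' (p - i) (q - i')) has_sum m12 0 G p q) UNIV"
    by (simp add: mR_def m_ap case_prod_unfold algebra_simps)
qed

lemma DG_mL: "DG F G \<Longrightarrow> DG (mL F) (m12 0 G)"
  unfolding DG_def
proof (intro allI)
  fix p q
  assume a: "\<forall>p q. ((\<lambda>(i, i'). F i i' (p - i) (q - i')) has_sum G p q) UNIV"
  have b1: "bij_betw (\<lambda>(i::int, i'::int). (i - 1, i')) UNIV UNIV"
    by (rule bij_betwI[where g = "\<lambda>(i, i'). (i + 1, i')"]) auto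
  have b2: "bij_betw (\<lambda>(i::int, i'::int). (i, i' - 1)) UNIV UNIV"
    by (rule bij_betwI[where g = "\<lambda>(i, i'). (i, i' + 1)"]) auto
  have 1: "((\<lambda>(i, i'). F (i - 1) i' (p - i) (q - i')) has_sum G (p - 1) q) UNIV"
    using has_sum_reindex_bij_betw[OF b1, of "\<lambda>(i, i'). F i i' (p - 1 - i) (q - i')" "G (p - 1) q"] a
    by (simp add: case_prod_unfold)
  have 2: "((\<lambda>(i, i'). F i (i' - 1) (p - i) (q - i')) has_sum G p (q - 1)) UNIV"
    using has_sum_reindex_bij_betw[OF b2, of "\<lambda>(i, i'). F i i' (p - i) (q - 1 - i')" "G p (q - 1)"] a
    by (simp add: case_prod_unfold)
  show "((\<lambda>(i, i'). mL F i i' (p - i) (q - i')) has_sum m12 0 G p q) UNIV"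
    using has_sum_diff[OF 1 2] by (simp add: mL_def m_ap case_prod_unfold)
qed

lemma DG_pow: "DG F G \<Longrightarrow> DG ((mL ^^ N) ((mR ^^ M) F)) ((m12 0 ^^ (N + M)) G)"
proof -
  assume "DG F G"
  then have "DG ((mR ^^ M) F) ((m12 0 ^^ M) G)" by (induction M) (auto intro: DG_mR)
  then have "DG ((mL ^^ N) ((mR ^^ M) F)) ((m12 0 ^^ N) ((m12 0 ^^ M) G))" by (induction N) (auto intro: DG_mL)
  then show ?thesis by (simp add: funpow_add)
qed

text \<open>The four exponents add up to p + q and each is at least A, so each is at most p + q - 3
  A. The box depends only on p + q, hence one box serves all coefficients in
  \<open>tensor_sum\<close>.\<close>

lemma DG_box:
  assumes "DG K G" and low: "\<And>i i' c c'. i < A \<or> i' < A \<or> c < A \<or> c' < A \<Longrightarrow> K i i' c c' = 0"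
    and U: "U \<ge> p + q - 3 * A"
  shows "G p q = (\<Sum>i\<in>{A..U}. \<Sum>i'\<in>{A..U}. K i i' (p - i) (q - i'))"
proof -
  have "((\<lambda>(i, i'). K i i' (p - i) (q - i')) has_sum (\<Sum>x\<in>{A..U} \<times> {A..U}. case x of (i, i') \<Rightarrow> K i i' (p - i) (q - i'))) UNIV"
  proof (rule has_sum_finite_neutralI)
    fix x assume "x \<in> UNIV - {A..U} \<times> {A..U}"
    then obtain i i' where x: "x = (i, i')" "\<not> (A \<le> i \<and> i \<le> U \<and> A \<le> i' \<and> i' \<le> U)" by (cases x) auto
    then have "i < A \<or> i' < A \<or> p - i < A \<or> q - i' < A" using U by linarith
    then show "(case x of (i, i') \<Rightarrow> K i i' (p - i) (q - i')) = 0" using low x(1) by auto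
  qed auto
  then have "G p q = (\<Sum>x\<in>{A..U} \<times> {A..U}. case x of (i, i') \<Rightarrow> K i i' (p - i) (q - i'))"
    using assms(1) has_sum_unique unfolding DG_def by blast
  then show ?thesis by (simp add: sum.cartesian_product)
qed

lemma DG_low:
  assumes "DG K G" and low: "\<And>i i' c c'. i < A \<or> i' < A \<or> c < A \<or> c' < A \<Longrightarrow> K i i' c c' = 0"
    and "p < 2 * A \<or> q < 2 * A"
  shows "G p q = 0"
proof -
  have "K i i' (p - i) (q - i') = 0" for i i' by (rule low) (use assms(3) in linarith)
  then show ?thesis using DG_box[where A = A, OF assms(1) low order_refl] by simp
qed

text \<open>Taylor coefficients of a product; Vandermonde's identity splits the binomial coefficient between the two factors.\<close>

lemma tensor_sum:
  assumes "DG K KT" and low: "\<And>i i' c c'. i < A \<or> i' < A \<or> c < A \<or> c' < A \<Longrightarrow> K i i' c c' = 0"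
    and U: "U = P + int R - 3 * A"
  shows "Jcf (- int R - 1) KT KT P =
    (\<Sum>r\<le>R. \<Sum>e\<in>{2 * A - int r..2 * U - int r}. \<Sum>i\<in>{A..U}. \<Sum>c\<in>{A..U}.
      ibin i r * ibin c (R - r) * K i (e + int r - i) c (P - e + int (R - r) - c))"
proof -
  let ?S = "{A..U}" and ?E = "\<lambda>r. {2 * A - int r..2 * U - int r}"
    and ?t = "\<lambda>r e i c. ibin i r * ibin c (R - r) * K i (e + int r - i) c (P - e + int (R - r) - c)"
  \<comment> \<open>The total degree is P + R, so three exponents determine the fourth.\<close>
  define g where "g = (\<lambda>i i' c. K i i' c (P + int R - i - c - i'))"
  have g0: "g i i' c = 0" if "i \<notin> ?S \<or> i' \<notin> ?S \<or> c \<notin> ?S" for i i' c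
    unfolding g_def by (rule low) (use that in \<open>auto simp: U\<close>)
  have "Jcf (- int R - 1) KT KT P = (\<Sum>a\<in>{2 * A..2 * U}. ibin a R * KT a (P + int R - a))"
    by (rule Jcf_res[where A = "2 * A" and A' = "2 * A"]) (use DG_low[OF assms(1) low] in \<open>auto simp: U\<close>)
  also have "\<dots> = (\<Sum>a\<in>{2 * A..2 * U}. \<Sum>i\<in>?S. \<Sum>i'\<in>?S. ibin a R * g i i' (a - i))"
    by (intro sum.cong refl, subst DG_box[OF assms(1) low, where U = U])
      (auto simp: U g_def sum_distrib_left algebra_simps)
  also have "\<dots> = (\<Sum>i\<in>?S. \<Sum>i'\<in>?S. \<Sum>a\<in>{2 * A..2 * U}. ibin a R * g i i' (a - i))"
    by (rule trans[OF sum.swap], rule sum.cong[OF refl], rule sum.swap)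
  also have "\<dots> = (\<Sum>i\<in>?S. \<Sum>i'\<in>?S. \<Sum>c\<in>?S. ibin (i + c) R * g i i' c)"
  proof (rule sum.cong[OF refl], rule sum.cong[OF refl])
    fix i i' assume "i \<in> ?S" "i' \<in> ?S"
    then show "(\<Sum>a\<in>{2 * A..2 * U}. ibin a R * g i i' (a - i)) = (\<Sum>c\<in>?S. ibin (i + c) R * g i i' c)"
      using sum_int_shift[of ?S "{2 * A..2 * U}" "\<lambda>c. ibin (i + c) R * g i i' c" "- i"] g0 by auto
  qed
  finally have lhs: "Jcf (- int R - 1) KT KT P = (\<Sum>i\<in>?S. \<Sum>i'\<in>?S. \<Sum>c\<in>?S. ibin (i + c) R * g i i' c)" .
  have V: "ibin (i + c) R = (\<Sum>r\<le>R. ibin i r * ibin c (R - r))" for i c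
    unfolding ibin_def using gbinomial_Vandermonde[of "of_int i :: complex" "of_int c" R] by (simp add: atLeast0AtMost)
  have rr: "(\<Sum>e\<in>?E r. \<Sum>i\<in>?S. \<Sum>c\<in>?S. ?t r e i c)
    = (\<Sum>i\<in>?S. \<Sum>i'\<in>?S. \<Sum>c\<in>?S. ibin i r * ibin c (R - r) * g i i' c)" if r: "r \<le> R" for r
  proof -
    have e: "K i (e + int r - i) c (P - e + int (R - r) - c) = g i (e + (int r - i)) c" for i e c
      unfolding g_def using r by (simp add: of_nat_diff algebra_simps)
    have "(\<Sum>e\<in>?E r. \<Sum>i\<in>?S. \<Sum>c\<in>?S. ?t r e i c)
      = (\<Sum>i\<in>?S. \<Sum>e\<in>?E r. \<Sum>c\<in>?S. ibin i r * ibin c (R - r) * g i (e + (int r - i)) c)"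
      unfolding e by (rule sum.swap)
    also have "\<dots> = (\<Sum>i\<in>?S. \<Sum>i'\<in>?S. \<Sum>c\<in>?S. ibin i r * ibin c (R - r) * g i i' c)"
    proof (rule sum.cong[OF refl])
      fix i assume "i \<in> ?S"
      then show "(\<Sum>e\<in>?E r. \<Sum>c\<in>?S. ibin i r * ibin c (R - r) * g i (e + (int r - i)) c)
        = (\<Sum>i'\<in>?S. \<Sum>c\<in>?S. ibin i r * ibin c (R - r) * g i i' c)"
        using sum_int_shift[of ?S "?E r" "\<lambda>i'. \<Sum>c\<in>?S. ibin i r * ibin c (R - r) * g i i' c" "int r - i"] g0
        by auto
    qed
    finally show ?thesis .
  qed
  have "(\<Sum>r\<le>R. \<Sum>e\<in>?E r. \<Sum>i\<in>?S. \<Sum>c\<in>?S. ?t r e i c)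
    = (\<Sum>r\<le>R. \<Sum>i\<in>?S. \<Sum>i'\<in>?S. \<Sum>c\<in>?S. ibin i r * ibin c (R - r) * g i i' c)"
    by (intro sum.cong refl rr) auto
  also have "\<dots> = (\<Sum>i\<in>?S. \<Sum>i'\<in>?S. \<Sum>c\<in>?S. \<Sum>r\<le>R. ibin i r * ibin c (R - r) * g i i' c)"
    by (rule trans[OF sum.swap], rule sum.cong[OF refl], rule trans[OF sum.swap], rule sum.cong[OF refl], rule sum.swap)
  also have "\<dots> = (\<Sum>i\<in>?S. \<Sum>i'\<in>?S. \<Sum>c\<in>?S. ibin (i + c) R * g i i' c)"
    by (simp add: V sum_distrib_right)
  finally show ?thesis using lhs by simp
qed

section \<open>The diagonal action built from the left and right fields\<close>

context oppmod
begin

abbreviation "L \<equiv> Op z"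
abbreviation "R \<equiv> Op 0"

definition YP :: "'v \<times> 'v \<Rightarrow> int \<Rightarrow> ('w \<Rightarrow> complex) \<Rightarrow> 'w \<Rightarrow> complex" where
  "YP a k \<alpha> = (\<lambda>w. isum (\<lambda>i. L (fst a) i (R (snd a) (- k - 1 - i) \<alpha>) w))"

lemma LR_comm: "\<alpha> \<in> D \<Longrightarrow> R v c (L u i \<alpha>) = L u i (R v c \<alpha>)"
  by (rule Op_commute)

text \<open>The bound in c is that of R on \<alpha>; the bound in i needs the commutation, which
  brings L next to \<alpha>. It makes the product at a common variable a finite sum.\<close>

lemma LR_low: "\<alpha> \<in> D \<Longrightarrow> \<exists>A. \<forall>i c. i < A \<or> c < A \<longrightarrow> L u i (R v c \<alpha>) = (\<lambda>w. 0)"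
proof -
  assume a: "\<alpha> \<in> D"
  obtain A1 where 1: "\<And>n. n < A1 \<Longrightarrow> L u n \<alpha> = (\<lambda>w. 0)" using Op_low[OF a, of z u] by blast
  obtain A2 where 2: "\<And>n. n < A2 \<Longrightarrow> R v n \<alpha> = (\<lambda>w. 0)" using Op_low[OF a, of 0 v] by blast
  show ?thesis
  proof (intro exI[of _ "min A1 A2"] allI impI)
    fix i c assume "i < min A1 A2 \<or> c < min A1 A2"
    then show "L u i (R v c \<alpha>) = (\<lambda>w. 0)"
      using 1[of i] 2[of c] LR_comm[OF a, of v c u i] Op_zero[of z u i] Op_zero[of 0 v c] by auto
  qed
qed

lemma YP_sum: "finite S \<Longrightarrow> (\<And>i. i \<notin> S \<Longrightarrow> L u i (R v (- k - 1 - i) \<alpha>) w = 0) \<Longrightarrow>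
  YP (u, v) k \<alpha> w = (\<Sum>i\<in>S. L u i (R v (- k - 1 - i) \<alpha>) w)"
  unfolding YP_def by (rule trans[OF isum_eq]) auto

text \<open>The factor 1 gives the sum the shape expected by \<open>D_sum\<close> and
  \<open>Op_sum\<close>.\<close>

lemma YP_sum':
  assumes "\<alpha> \<in> D"
  obtains A where "\<And>i c. i < A \<or> c < A \<Longrightarrow> L u i (R v c \<alpha>) = (\<lambda>w. 0)"
    "\<And>k. YP (u, v) k \<alpha> = (\<lambda>w. \<Sum>i\<in>{A..- k - 1 - A}. 1 * L u i (R v (- k - 1 - i) \<alpha>) w)"
proof -
  obtain A where A: "\<And>i c. i < A \<or> c < A \<Longrightarrow> L u i (R v c \<alpha>) = (\<lambda>w. 0)"
    using LR_low[OF assms, of u v] by blast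
  have "YP (u, v) k \<alpha> w = (\<Sum>i\<in>{A..- k - 1 - A}. 1 * L u i (R v (- k - 1 - i) \<alpha>) w)" for k w
    by (subst YP_sum[where S = "{A..- k - 1 - A}"]) (use A in auto)
  then show ?thesis using that A by blast
qed

lemma LR_D: "\<alpha> \<in> D \<Longrightarrow> L u i \<alpha> \<in> D" "\<alpha> \<in> D \<Longrightarrow> R u i \<alpha> \<in> D"
  by (auto intro: Op_D)

lemma YP_D: "\<alpha> \<in> D \<Longrightarrow> YP a k \<alpha> \<in> D"
proof -
  assume a: "\<alpha> \<in> D"
  obtain u v where uv: "a = (u, v)" by (cases a)
  obtain A where "\<And>i c. i < A \<or> c < A \<Longrightarrow> L u i (R v c \<alpha>) = (\<lambda>w. 0)"
    and "\<And>k. YP (u, v) k \<alpha> = (\<lambda>w. \<Sum>i\<in>{A..- k - 1 - A}. 1 * L u i (R v (- k - 1 - i) \<alpha>) w)"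
    by (rule YP_sum'[OF a, of u v], rule that; assumption)
  then show ?thesis unfolding uv by (simp only:) (rule D_sum, auto intro!: LR_D a)
qed

lemma YP_low: "\<alpha> \<in> D \<Longrightarrow> \<exists>N. \<forall>n\<ge>N. YP a n \<alpha> = (\<lambda>w. 0)"
proof -
  assume a: "\<alpha> \<in> D"
  obtain u v where uv: "a = (u, v)" by (cases a)
  obtain A where "\<And>i c. i < A \<or> c < A \<Longrightarrow> L u i (R v c \<alpha>) = (\<lambda>w. 0)"
    and "\<And>k. YP (u, v) k \<alpha> = (\<lambda>w. \<Sum>i\<in>{A..- k - 1 - A}. 1 * L u i (R v (- k - 1 - i) \<alpha>) w)"
    by (rule YP_sum'[OF a, of u v], rule that; assumption)
  then show ?thesis unfolding uv by (intro exI[of _ "- 2 * A"]) auto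
qed

lemma YP_add: "\<alpha> \<in> D \<Longrightarrow> \<beta> \<in> D \<Longrightarrow> YP a n (\<lambda>w. c * \<alpha> w + \<beta> w) = (\<lambda>w. c * YP a n \<alpha> w + YP a n \<beta> w)"
proof
  fix w assume a: "\<alpha> \<in> D" and b: "\<beta> \<in> D"
  obtain u v where uv: "a = (u, v)" by (cases a)
  obtain A1 where 1: "\<And>i c. i < A1 \<or> c < A1 \<Longrightarrow> L u i (R v c \<alpha>) = (\<lambda>w. 0)" using LR_low[OF a, of u v] by blast
  obtain A2 where 2: "\<And>i c. i < A2 \<or> c < A2 \<Longrightarrow> L u i (R v c \<beta>) = (\<lambda>w. 0)" using LR_low[OF b, of u v] by blast
  define S where "S = {min A1 A2..- n - 1 - min A1 A2}"
  have S: "i \<notin> S \<Longrightarrow> i < A1 \<or> - n - 1 - i < A1" "i \<notin> S \<Longrightarrow> i < A2 \<or> - n - 1 - i < A2" "finite S" for i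
    by (auto simp: S_def)
  have e: "L u i (R v j (\<lambda>w. c * \<alpha> w + \<beta> w)) = (\<lambda>w. c * L u i (R v j \<alpha>) w + L u i (R v j \<beta>) w)" for i j
    by (simp add: Op_add a b LR_D)
  show "YP a n (\<lambda>w. c * \<alpha> w + \<beta> w) w = c * YP a n \<alpha> w + YP a n \<beta> w"
    unfolding uv using S 1 2
    by (subst (1 2 3) YP_sum[OF S(3)]) (auto simp: e sum.distrib sum_distrib_left)
qed

lemma YP_linv:
  assumes a: "\<alpha> \<in> D"
  shows "YP (scV c u1 + u2, v) n \<alpha> = (\<lambda>w. c * YP (u1, v) n \<alpha> w + YP (u2, v) n \<alpha> w)"
    "YP (v, scV c u1 + u2) n \<alpha> = (\<lambda>w. c * YP (v, u1) n \<alpha> w + YP (v, u2) n \<alpha> w)"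
proof -
  obtain A1 where 1: "\<And>i c. i < A1 \<or> c < A1 \<Longrightarrow> L u1 i (R v c \<alpha>) = (\<lambda>w. 0)" using LR_low[OF a, of u1 v] by blast
  obtain A2 where 2: "\<And>i c. i < A2 \<or> c < A2 \<Longrightarrow> L u2 i (R v c \<alpha>) = (\<lambda>w. 0)" using LR_low[OF a, of u2 v] by blast
  obtain A3 where 3: "\<And>i c. i < A3 \<or> c < A3 \<Longrightarrow> L v i (R u1 c \<alpha>) = (\<lambda>w. 0)" using LR_low[OF a, of v u1] by blast
  obtain A4 where 4: "\<And>i c. i < A4 \<or> c < A4 \<Longrightarrow> L v i (R u2 c \<alpha>) = (\<lambda>w. 0)" using LR_low[OF a, of v u2] by blast
  define A where "A = min (min A1 A2) (min A3 A4)"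
  define S where "S = {A..- n - 1 - A}"
  have S: "i \<notin> S \<Longrightarrow> i < A1 \<or> - n - 1 - i < A1" "i \<notin> S \<Longrightarrow> i < A2 \<or> - n - 1 - i < A2"
    "i \<notin> S \<Longrightarrow> i < A3 \<or> - n - 1 - i < A3" "i \<notin> S \<Longrightarrow> i < A4 \<or> - n - 1 - i < A4" "finite S" for i
    by (auto simp: S_def A_def)
  have e1: "L (scV c u1 + u2) i (R v j \<alpha>) = (\<lambda>w. c * L u1 i (R v j \<alpha>) w + L u2 i (R v j \<alpha>) w)" for i j
    by (simp add: Op_linv a LR_D)
  have e2: "L v i (R (scV c u1 + u2) j \<alpha>) = (\<lambda>w. c * L v i (R u1 j \<alpha>) w + L v i (R u2 j \<alpha>) w)" for i j
    by (simp add: Op_linv Op_add a LR_D)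
  show "YP (scV c u1 + u2, v) n \<alpha> = (\<lambda>w. c * YP (u1, v) n \<alpha> w + YP (u2, v) n \<alpha> w)"
    using S 1 2 by (intro ext, subst (1 2 3) YP_sum[OF S(5)]) (auto simp: e1 sum.distrib sum_distrib_left)
  show "YP (v, scV c u1 + u2) n \<alpha> = (\<lambda>w. c * YP (v, u1) n \<alpha> w + YP (v, u2) n \<alpha> w)"
    using S 3 4 by (intro ext, subst (1 2 3) YP_sum[OF S(5)]) (auto simp: e2 sum.distrib sum_distrib_left)
qed

lemma YP_zerov: "\<alpha> \<in> D \<Longrightarrow> u = 0 \<or> v = 0 \<Longrightarrow> YP (u, v) k \<alpha> w = 0"
  by (subst YP_sum[where S = "{}"]) (auto simp: Op_zerov Op_zero LR_D)

lemma YP_vac: "\<alpha> \<in> D \<Longrightarrow> YP (vac, vac) n \<alpha> = (if n = -1 then \<alpha> else (\<lambda>w. 0))"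
  by (rule ext, subst YP_sum[where S = "{0}"]) (auto simp: Op_vac LR_D D_zero)

text \<open>Since L and R commute, a product of two operators \<open>YP\<close> is the fourfold
  product with both left factors in front, restricted to the diagonal.\<close>

lemma YP_DG:
  assumes a: "\<alpha> \<in> D"
  shows "DG (\<lambda>i i' c c'. L u1 i (L u2 i' (R v1 c (R v2 c' \<alpha>))) w)
    (\<lambda>p q. YP (u1, v1) (- p - 1) (YP (u2, v2) (- q - 1) \<alpha>) w)"
  unfolding DG_def
proof (intro allI)
  fix p q
  obtain A where A: "\<And>i c. i < A \<or> c < A \<Longrightarrow> L u2 i (R v2 c \<alpha>) = (\<lambda>w. 0)"
    and Y: "\<And>k. YP (u2, v2) k \<alpha> = (\<lambda>w. \<Sum>i\<in>{A..- k - 1 - A}. 1 * L u2 i (R v2 (- k - 1 - i) \<alpha>) w)"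
    by (rule YP_sum'[OF a, of u2 v2], rule that; assumption)
  define S where "S = {A..q - A}"
  define \<theta> where "\<theta> = (\<lambda>i'. L u2 i' (R v2 (q - i') \<alpha>))"
  have fS: "finite S" by (simp add: S_def)
  have \<theta>D: "\<theta> i' \<in> D" for i' by (simp add: \<theta>_def LR_D a)
  have \<theta>0: "\<theta> i' = (\<lambda>w. 0)" if "i' \<notin> S" for i' using that A[of i' "q - i'"] by (auto simp: S_def \<theta>_def)
  have Y2: "YP (u2, v2) (- q - 1) \<alpha> = (\<lambda>w. \<Sum>i'\<in>S. 1 * \<theta> i' w)"
    unfolding Y by (simp add: S_def \<theta>_def)
  obtain Af where Af: "\<And>i' i c. i < Af i' \<or> c < Af i' \<Longrightarrow> L u1 i (R v1 c (\<theta> i')) = (\<lambda>w. 0)"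
    using LR_low[OF \<theta>D, of u1 v1] by metis
  \<comment> \<open>The bound for the outer operator depends on the functional
    \<open>\<theta> i'\<close>; only finitely many of these are nonzero, so a minimum
    exists.\<close>
  define A1 where "A1 = Min (insert 0 (Af ` S))"
  have A1: "A1 \<le> Af i'" if "i' \<in> S" for i' unfolding A1_def by (rule Min_le) (use fS that in auto)
  define T where "T = {A1..p - A1}"
  have fT: "finite T" by (simp add: T_def)
  have z1: "L u1 i (R v1 (p - i) (\<theta> i')) = (\<lambda>w. 0)" if "i \<notin> T" for i i'
  proof (cases "i' \<in> S")
    case True
    then show ?thesis using Af[of i i' "p - i"] A1[OF True] that by (auto simp: T_def)
  next
    case False
    then show ?thesis by (simp add: \<theta>0 Op_zero)
  qed
  have f: "L u1 i (L u2 i' (R v1 (p - i) (R v2 (q - i') \<alpha>))) = L u1 i (R v1 (p - i) (\<theta> i'))" for i i'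
    by (simp add: \<theta>_def LR_comm LR_D a)
  have e: "L u1 i (R v1 (p - i) (YP (u2, v2) (- q - 1) \<alpha>)) w = (\<Sum>i'\<in>S. L u1 i (R v1 (p - i) (\<theta> i')) w)" for i
    unfolding Y2 using Op_sum[OF fS, of \<theta> 0 v1 "p - i" "\<lambda>_. 1"] Op_sum[OF fS, of "\<lambda>i'. R v1 (p - i) (\<theta> i')" z u1 i "\<lambda>_. 1"]
    by (simp add: \<theta>D LR_D)
  have "YP (u1, v1) (- p - 1) (YP (u2, v2) (- q - 1) \<alpha>) w
    = (\<Sum>i\<in>T. L u1 i (R v1 (- (- p - 1) - 1 - i) (YP (u2, v2) (- q - 1) \<alpha>)) w)"
    by (rule YP_sum[OF fT]) (simp add: e z1)
  also have "\<dots> = (\<Sum>i\<in>T. \<Sum>i'\<in>S. L u1 i (R v1 (p - i) (\<theta> i')) w)" by (simp add: e)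
  also have "\<dots> = (\<Sum>x\<in>T \<times> S. case x of (i, i') \<Rightarrow> L u1 i (R v1 (p - i) (\<theta> i')) w)"
    by (simp add: sum.cartesian_product)
  finally have Yv: "YP (u1, v1) (- p - 1) (YP (u2, v2) (- q - 1) \<alpha>) w = \<dots>" .
  show "((\<lambda>(i, i'). L u1 i (L u2 i' (R v1 (p - i) (R v2 (q - i') \<alpha>))) w) has_sum
    YP (u1, v1) (- p - 1) (YP (u2, v2) (- q - 1) \<alpha>) w) UNIV"
    unfolding Yv f
  proof (rule has_sum_finite_neutralI)
    fix x assume "x \<in> UNIV - T \<times> S"
    then show "(case x of (i, i') \<Rightarrow> L u1 i (R v1 (p - i) (\<theta> i')) w) = 0"
      by (cases x) (auto simp: z1 \<theta>0 Op_zero)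
  qed (use fT fS in auto)
qed

lemma YP_DG':
  assumes a: "\<alpha> \<in> D"
  shows "DG (\<lambda>i i' c c'. L u2 i' (L u1 i (R v2 c' (R v1 c \<alpha>))) w)
    (\<lambda>p q. YP (u2, v2) (- q - 1) (YP (u1, v1) (- p - 1) \<alpha>) w)"
  unfolding DG_def
proof (intro allI)
  fix p q
  have b: "bij_betw (\<lambda>(i::int, i'::int). (i', i)) UNIV UNIV"
    by (rule bij_betwI[where g = "\<lambda>(i, i'). (i', i)"]) auto
  show "((\<lambda>(i, i'). L u2 i' (L u1 i (R v2 (q - i') (R v1 (p - i) \<alpha>))) w) has_sum
    YP (u2, v2) (- q - 1) (YP (u1, v1) (- p - 1) \<alpha>) w) UNIV"
    using has_sum_reindex_bij_betw[OF b, of "\<lambda>(i, i'). L u2 i (L u1 i' (R v2 (q - i) (R v1 (p - i') \<alpha>))) w"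
      "YP (u2, v2) (- q - 1) (YP (u1, v1) (- p - 1) \<alpha>) w"]
      YP_DG[OF a, of u2 u1 v2 v1 w] by (simp add: DG_def case_prod_unfold)
qed

lemma m12_push:
  assumes T: "\<And>c c'. \<Theta> c c' \<in> D" and t: "base_pt t"
  shows "(m12 0 ^^ N) (\<lambda>c c'. Op t u i (\<Theta> c c') w) c c' = Op t u i (\<lambda>w. (m12 0 ^^ N) (\<lambda>c c'. \<Theta> c c' w) c c') w"
    "(\<lambda>w. (m12 0 ^^ N) (\<lambda>c c'. \<Theta> c c' w) c c') \<in> D"
proof -
  obtain \<kappa> where k: "\<And>G a b. (m12 0 ^^ N) G a b = (\<Sum>j\<le>N. \<kappa> j * G (a - int N + int j) (b - int j))"
    using m12_pow_sum by metis
  show "(\<lambda>w. (m12 0 ^^ N) (\<lambda>c c'. \<Theta> c c' w) c c') \<in> D"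
    unfolding k by (rule D_sum) (auto simp: T)
  show "(m12 0 ^^ N) (\<lambda>c c'. Op t u i (\<Theta> c c') w) c c' = Op t u i (\<lambda>w. (m12 0 ^^ N) (\<lambda>c c'. \<Theta> c c' w) c c') w"
    unfolding k using Op_sum[of "{..N}" "\<lambda>j. \<Theta> (c - int N + int j) (c' - int j)" t u i \<kappa>] T t by simp
qed

text \<open>Writing the mode as N - r - 1 turns the iterate into the r-th Taylor coefficient along
  the diagonal, once (x1 - x2)^N has been absorbed.\<close>

lemma local_bound_res:
  assumes A: "local_bound t u v N \<alpha> A" and S: "finite S" "{A..p + int r - A} \<subseteq> S"
  shows "Op t (Yv u (int N - int r - 1) v) p \<alpha> w = (\<Sum>a\<in>S. ibin a r * (m12 0 ^^ N) (OpOp t u v \<alpha> w) a (p + int r - a))"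
proof -
  note A = local_boundD[OF A]
  have f: "fins (OpOp t u v \<alpha> w) (tr (OpOp t v u \<alpha> w))" by (rule low_fins[where A = A and A' = A]) (use A in auto)
  have "int N - int r - 1 - int N = - int r - 1" by simp
  then show ?thesis
    unfolding A(5) Jcf_shift[OF f, where N = N] A(1)[symmetric]
    using Jcf_res[where A = A and A' = A, OF A(2) S] by simp
qed

definition YY :: "'v \<times> 'v \<Rightarrow> 'v \<times> 'v \<Rightarrow> ('w \<Rightarrow> complex) \<Rightarrow> 'w \<Rightarrow> int \<Rightarrow> int \<Rightarrow> complex" where
  "YY x y \<alpha> w = (\<lambda>p q. YP x (- p - 1) (YP y (- q - 1) \<alpha>) w)"

text \<open>After multiplication by \<open>(x\<^sub>1 - x\<^sub>2)\<^sup>N (x\<^sub>3 - x\<^sub>4)\<^sup>N\<close> the four-fold product \<open>L L R R \<alpha>\<close> becomes a series \<open>K\<close> bounded below in all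
four variables, because the left and right actions commute; then \<open>Jcf_res\<close> applies to both factors and to
their product.\<close>

lemma tensor_main:
  assumes a: "\<alpha> \<in> D"
  shows "\<exists>N. (m12 0 ^^ N) (YY (u1, v1) (u2, v2) \<alpha> w) = (m12 0 ^^ N) (tr (YY (u2, v2) (u1, v1) \<alpha> w))
     \<and> fins (YY (u1, v1) (u2, v2) \<alpha> w) (tr (YY (u2, v2) (u1, v1) \<alpha> w))
     \<and> (\<forall>l P. Jcf l (YY (u1, v1) (u2, v2) \<alpha> w) (tr (YY (u2, v2) (u1, v1) \<alpha> w)) P
        = tensor_mode_op Yv YP (u1, v1) (u2, v2) l (- P - 1) \<alpha> w)"
proof -
  let ?G = "YY (u1, v1) (u2, v2) \<alpha> w" and ?H = "tr (YY (u2, v2) (u1, v1) \<alpha> w)"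
  obtain N1 where N1: "\<And>N \<beta>. N \<ge> N1 \<Longrightarrow> \<beta> \<in> D \<Longrightarrow> \<exists>A. local_bound z u1 u2 N \<beta> A"
    by (rule Op_local[of z u1 u2], simp, rule that, assumption)
  obtain N2 where N2: "\<And>N \<beta>. N \<ge> N2 \<Longrightarrow> \<beta> \<in> D \<Longrightarrow> \<exists>A. local_bound 0 v1 v2 N \<beta> A"
    by (rule Op_local[of 0 v1 v2], simp, rule that, assumption)
  obtain N3 where N3: "\<And>n. n \<ge> N3 \<Longrightarrow> Yv u1 n u2 = 0" using Ytrunc by blast
  obtain N4 where N4: "\<And>n. n \<ge> N4 \<Longrightarrow> Yv v1 n v2 = 0" using Ytrunc by blast
  \<comment> \<open>The last two bounds give u1_p u2 = 0 and v1_p v2 = 0 for p >= N, so every mode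
    that contributes has the form N - r - 1 with r >= 0.\<close>
  define N where "N = max (max N1 N2) (nat (max N3 N4))"
  have N: "N \<ge> N1" "N \<ge> N2" "int N \<ge> N3" "int N \<ge> N4" by (auto simp: N_def)
  note NL = N1[OF N(1)] and NR = N2[OF N(2)]
  define KR where "KR = (\<lambda>c c' w. (m12 0 ^^ N) (OpOp 0 v1 v2 \<alpha> w) c c')"
  define KL where "KL = (\<lambda>i i' w. (m12 0 ^^ N) (OpOp z u1 u2 \<alpha> w) i i')"
  have KRD: "KR c c' \<in> D" for c c' unfolding KR_def OpOp_def by (rule m12_push(2)[where t = 0]) (auto intro!: LR_D a)
  have KLD: "KL c c' \<in> D" for c c' unfolding KL_def OpOp_def by (rule m12_push(2)[where t = 0]) (auto intro!: LR_D a)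
  obtain AR where AR0: "local_bound 0 v1 v2 N \<alpha> AR" using NR[OF a] by blast
  have AR: "\<And>c c'. c < AR \<or> c' < AR \<Longrightarrow> KR c c' = (\<lambda>w. 0)"
    "\<And>r p S w. finite S \<Longrightarrow> {AR..p + int r - AR} \<subseteq> S \<Longrightarrow>
       R (Yv v1 (int N - int r - 1) v2) p \<alpha> w = (\<Sum>c\<in>S. ibin c r * KR c (p + int r - c) w)"
    unfolding KR_def using local_boundD(2)[OF AR0] local_bound_res[OF AR0] by (simp_all add: fun_eq_iff)
  obtain AL where AL0: "local_bound z u1 u2 N \<alpha> AL" using NL[OF a] by blast
  have AL: "\<And>c c'. c < AL \<or> c' < AL \<Longrightarrow> KL c c' = (\<lambda>w. 0)"
    unfolding KL_def using local_boundD(2)[OF AL0] by (simp add: fun_eq_iff)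
  define A where "A = min AL AR"
  \<comment> \<open>\<open>F\<close> and \<open>F3\<close> are the fourfold products for the two
    orders of the factors; \<open>F2\<close> is intermediate, with only the right operators
    exchanged.\<close>
  define F where "F = (\<lambda>i i' c c'. L u1 i (L u2 i' (R v1 c (R v2 c' \<alpha>))) w)"
  define F2 where "F2 = (\<lambda>i i' c c'. L u1 i (L u2 i' (R v2 c' (R v1 c \<alpha>))) w)"
  define F3 where "F3 = (\<lambda>i i' c c'. L u2 i' (L u1 i (R v2 c' (R v1 c \<alpha>))) w)"
  define K where "K = (mL ^^ N) ((mR ^^ N) F)"
  have F': "F = (\<lambda>i i' c c'. R v1 c (R v2 c' (L u1 i (L u2 i' \<alpha>))) w)"
    unfolding F_def by (simp add: LR_comm LR_D a)
  have F2': "F2 = (\<lambda>i i' c c'. R v2 c' (R v1 c (L u1 i (L u2 i' \<alpha>))) w)"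
    unfolding F2_def by (simp add: LR_comm LR_D a)
  have mRF: "(mR ^^ N) F i i' c c' = L u1 i (L u2 i' (KR c c')) w" for i i' c c'
    unfolding mR_pow F_def KR_def OpOp_def by (subst m12_push, simp add: LR_D a, simp, subst m12_push) (simp_all add: LR_D a)
  have mLF: "(mL ^^ N) F i i' c c' = R v1 c (R v2 c' (KL i i')) w" for i i' c c'
    unfolding mL_pow F' KL_def OpOp_def by (subst m12_push, simp add: LR_D a, simp, subst m12_push) (simp_all add: LR_D a)
  have K1: "K i i' c c' = (m12 0 ^^ N) (\<lambda>i i'. L u1 i (L u2 i' (KR c c')) w) i i'" for i i' c c'
    unfolding K_def mL_pow mRF ..
  have K2: "K i i' c c' = (m12 0 ^^ N) (\<lambda>c c'. R v1 c (R v2 c' (KL i i')) w) c c'" for i i' c c'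
  proof -
    have "K = (mR ^^ N) ((mL ^^ N) F)" unfolding K_def by (rule mLR_comm)
    moreover have "(mL ^^ N) F i i' = (\<lambda>c c'. R v1 c (R v2 c' (KL i i')) w)" by (intro ext) (rule mLF)
    ultimately show ?thesis by (simp add: mR_pow)
  qed
  have m0: "(m12 0 ^^ N) (\<lambda>c c'. 0) a b = 0" for a b
    by (rule m12_low[where P = "\<lambda>a b. True"]) auto
  \<comment> \<open>\<open>K1\<close> applies left operators to \<open>KR\<close>, which gives the
    bounds in c and c'; \<open>K2\<close> applies right operators to \<open>KL\<close>, which gives
    those in i and i'.\<close>
  have K0: "K i i' c c' = 0" if "i < A \<or> i' < A \<or> c < A \<or> c' < A" for i i' c c'
  proof -
    from that consider "c < AR \<or> c' < AR" | "i < AL \<or> i' < AL" by (auto simp: A_def)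
    then show ?thesis
    proof cases
      case 1 then show ?thesis unfolding K1 by (simp add: AR Op_zero m0)
    next
      case 2 then show ?thesis unfolding K2 by (simp add: AL Op_zero m0)
    qed
  qed
  have e1: "(mR ^^ N) F = (mR ^^ N) F2"
  proof (intro ext)
    fix i i' c c'
    have "(m12 0 ^^ N) (\<lambda>c c'. R v1 c (R v2 c' (L u1 i (L u2 i' \<alpha>))) w) = (m12 0 ^^ N) (\<lambda>c c'. R v2 c' (R v1 c (L u1 i (L u2 i' \<alpha>))) w)"
      using NR[of "L u1 i (L u2 i' \<alpha>)"] a LR_D local_boundD(1) unfolding OpOp_def tr_def by metis
    then show "(mR ^^ N) F i i' c c' = (mR ^^ N) F2 i i' c c'"
      unfolding mR_pow F' F2' by simp
  qed
  have e2: "(mL ^^ N) F2 = (mL ^^ N) F3"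
  proof (intro ext)
    fix i i' c c'
    have "(m12 0 ^^ N) (\<lambda>i i'. L u1 i (L u2 i' (R v2 c' (R v1 c \<alpha>))) w) = (m12 0 ^^ N) (\<lambda>i i'. L u2 i' (L u1 i (R v2 c' (R v1 c \<alpha>))) w)"
      using NL[of "R v2 c' (R v1 c \<alpha>)"] a LR_D local_boundD(1) unfolding OpOp_def tr_def by metis
    then show "(mL ^^ N) F2 i i' c c' = (mL ^^ N) F3 i i' c c'"
      unfolding mL_pow F2_def F3_def by simp
  qed
  have e3: "K = (mL ^^ N) ((mR ^^ N) F3)"
    unfolding K_def e1 by (simp only: mLR_comm e2)
  have DK: "DG K ((m12 0 ^^ (N + N)) ?G)" unfolding K_def by (rule DG_pow) (unfold F_def YY_def, rule YP_DG[OF a])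
  have DK': "DG K ((m12 0 ^^ (N + N)) ?H)" unfolding e3 by (rule DG_pow) (unfold F3_def YY_def tr_def, rule YP_DG'[OF a])
  have loc: "(m12 0 ^^ (N + N)) ?G = (m12 0 ^^ (N + N)) ?H"
    by (rule DG_unique[OF DK DK'])
  obtain M2 where M2: "\<And>n. n \<ge> M2 \<Longrightarrow> YP (u2, v2) n \<alpha> = (\<lambda>w. 0)" using YP_low[OF a] by blast
  obtain M1 where M1: "\<And>n. n \<ge> M1 \<Longrightarrow> YP (u1, v1) n \<alpha> = (\<lambda>w. 0)" using YP_low[OF a] by blast
  have YP0: "YP b n (\<lambda>w. 0) = (\<lambda>w. 0)" for b n
    using YP_add[OF D_zero D_zero, of b n "-1"] by simp
  have f: "fins ?G ?H"
    by (rule low_fins[where A = "- M1" and A' = "- M2"]) (auto simp: M1 M2 YP0 YY_def tr_def)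
  have J: "Jcf l ?G ?H P = tensor_mode_op Yv YP (u1, v1) (u2, v2) l (- P - 1) \<alpha> w" for l P
  proof -
    define X where "X = (\<lambda>p. YP (Yv u1 p u2, Yv v1 (l - 1 - p) v2) (- P - 1) \<alpha> w)"
    \<comment> \<open>Both products can be nonzero only if p < N and l - 1 - p < N.\<close>
    define I where "I = {l - int N..int N - 1}"
    have X0: "X p = 0" if "Yv u1 p u2 = 0 \<or> Yv v1 (l - 1 - p) v2 = 0" for p
      unfolding X_def using that by (rule YP_zerov[OF a])
    have "tensor_mode_op Yv YP (u1, v1) (u2, v2) l (- P - 1) \<alpha> w = sum X {p. Yv u1 p u2 \<noteq> 0 \<and> Yv v1 (l - 1 - p) v2 \<noteq> 0}"
      by (simp add: tensor_mode_op_def X_def)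
    also have "\<dots> = sum X I"
    proof (rule sum.mono_neutral_left)
      show "{p. Yv u1 p u2 \<noteq> 0 \<and> Yv v1 (l - 1 - p) v2 \<noteq> 0} \<subseteq> I"
      proof
        fix p assume "p \<in> {p. Yv u1 p u2 \<noteq> 0 \<and> Yv v1 (l - 1 - p) v2 \<noteq> 0}"
        then have "\<not> N3 \<le> p" "\<not> N4 \<le> l - 1 - p" using N3 N4 by auto
        then show "p \<in> I" using N by (auto simp: I_def)
      qed
      show "\<forall>i\<in>I - {p. Yv u1 p u2 \<noteq> 0 \<and> Yv v1 (l - 1 - p) v2 \<noteq> 0}. X i = 0" using X0 by blast
    qed (simp add: I_def)
    finally have T: "tensor_mode_op Yv YP (u1, v1) (u2, v2) l (- P - 1) \<alpha> w = sum X I" .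
    show ?thesis
    proof (cases "l \<ge> int (N + N)")
      \<comment> \<open>The range I is empty for these l, and the residue vanishes by
        locality.\<close>
      case True
      then show ?thesis unfolding T using Dcf_local[OF f loc True] by (simp add: Jcf_def I_def)
    next
      case False
      \<comment> \<open>Absorbing (x1 - x2)^(2N) leaves the exponent - Q - 1, that is, a Taylor
        coefficient of total order Q, to be split as r + (Q - r).\<close>
      define Q where "Q = nat (int (N + N) - l - 1)"
      have l: "l - int (N + N) = - int Q - 1" using False by (simp add: Q_def)
      define U where "U = P + int Q - 3 * A"
      let ?t = "\<lambda>r e i c. ibin i r * ibin c (Q - r) * K i (e + int r - i) c (P - e + int (Q - r) - c)"
      have "Jcf l ?G ?H P = Jcf (- int Q - 1) ((m12 0 ^^ (N + N)) ?G) ((m12 0 ^^ (N + N)) ?G) P"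
        unfolding Jcf_shift[OF f, of l "N + N"] loc[symmetric] l ..
      also have "\<dots> = (\<Sum>r\<le>Q. \<Sum>e\<in>{2 * A - int r..2 * U - int r}. \<Sum>i\<in>{A..U}. \<Sum>c\<in>{A..U}. ?t r e i c)"
        by (rule tensor_sum[OF DK K0 U_def])
      also have "\<dots> = (\<Sum>r\<le>Q. X (int N - int r - 1))"
      proof (rule sum.cong[OF refl])
        fix r assume "r \<in> {..Q}"
        then have r: "r \<le> Q" by simp
        define x where "x = Yv u1 (int N - int r - 1) u2"
        define y where "y = Yv v1 (int N - int (Q - r) - 1) v2"
        have X: "X (int N - int r - 1) = YP (x, y) (- P - 1) \<alpha> w"
        proof -
          have "l - 1 - (int N - int r - 1) = int N - int (Q - r) - 1" using r l by (simp add: of_nat_diff)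
          then show ?thesis by (simp only: X_def x_def y_def)
        qed
        \<comment> \<open>The right iterate is expanded first; the left one is then expanded on each
          functional \<open>KR c c'\<close>, which is why \<open>KR\<close> has to take values in
          D.\<close>
        have E: "L x e (R y (P - e) \<alpha>) w = (\<Sum>i\<in>{A..U}. \<Sum>c\<in>{A..U}. ?t r e i c)" for e
        proof -
          let ?f = "P - e" and ?s = "Q - r"
          define S where "S = {A..U} \<union> {A..?f + int ?s - A}"
          have fS: "finite S" by (simp add: S_def)
          have "{AR..?f + int ?s - AR} \<subseteq> {AR..?f + int ?s - AR} \<union> S" "finite ({AR..?f + int ?s - AR} \<union> S)" using fS by auto
          note Ry = AR(2)[OF this(2,1), folded y_def]
          have "R y ?f \<alpha> = (\<lambda>w. \<Sum>c\<in>{AR..?f + int ?s - AR} \<union> S. ibin c ?s * KR c (?f + int ?s - c) w)"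
            using Ry by blast
          then have "L x e (R y ?f \<alpha>) w = (\<Sum>c\<in>{AR..?f + int ?s - AR} \<union> S. ibin c ?s * L x e (KR c (?f + int ?s - c)) w)"
            using fun_cong[OF Op_sum[of "{AR..?f + int ?s - AR} \<union> S" "\<lambda>c. KR c (?f + int ?s - c)" z x e "\<lambda>c. ibin c ?s"], of w]
            by (simp only: KRD fS finite_Un finite_atLeastAtMost_int simp_thms)
          also have "\<dots> = (\<Sum>c\<in>{AR..?f + int ?s - AR} \<union> S. \<Sum>i\<in>{A..U}. ?t r e i c)"
          proof (rule sum.cong[OF refl])
            fix c
            let ?\<gamma> = "KR c (?f + int ?s - c)"
            \<comment> \<open>This bound depends on the functional, so the sum is taken over a union
              with the common box and then cut back to the box.\<close>
            obtain A' where "local_bound z u1 u2 N ?\<gamma> A'" using NL[OF KRD] by blast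
            from local_bound_res[OF this] have A': "\<And>S. finite S \<Longrightarrow> {A'..e + int r - A'} \<subseteq> S \<Longrightarrow>
               L x e ?\<gamma> w = (\<Sum>a\<in>S. ibin a r * (m12 0 ^^ N) (\<lambda>a b. L u1 a (L u2 b ?\<gamma>) w) a (e + int r - a))"
              unfolding x_def OpOp_def .
            have z: "K i (e + int r - i) c (?f + int ?s - c) = 0" if "i \<notin> {A..U}" for i
              by (rule K0) (use that r in \<open>auto simp: U_def of_nat_diff\<close>)
            have "L x e ?\<gamma> w = (\<Sum>i\<in>{A'..e + int r - A'} \<union> {A..U}. ibin i r * K i (e + int r - i) c (?f + int ?s - c))"
              unfolding K1 by (rule A') auto
            also have "\<dots> = (\<Sum>i\<in>{A..U}. ibin i r * K i (e + int r - i) c (?f + int ?s - c))"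
              by (rule sum.mono_neutral_right) (use z in auto)
            finally show "ibin c ?s * L x e ?\<gamma> w = (\<Sum>i\<in>{A..U}. ?t r e i c)"
              by (simp add: sum_distrib_left mult_ac)
          qed
          also have "\<dots> = (\<Sum>c\<in>{A..U}. \<Sum>i\<in>{A..U}. ?t r e i c)"
          proof (rule sum.mono_neutral_right)
            show "\<forall>c\<in>{AR..?f + int ?s - AR} \<union> S - {A..U}. (\<Sum>i\<in>{A..U}. ?t r e i c) = 0"
            proof
              fix c assume c: "c \<in> {AR..?f + int ?s - AR} \<union> S - {A..U}"
              have "K i (e + int r - i) c (?f + int ?s - c) = 0" for i
                by (rule K0) (use c r in \<open>auto simp: U_def of_nat_diff\<close>)
              then show "(\<Sum>i\<in>{A..U}. ?t r e i c) = 0" by simp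
            qed
          qed (auto simp: S_def)
          finally show ?thesis by (rule trans) (rule sum.swap)
        qed
        have "YP (x, y) (- P - 1) \<alpha> w = (\<Sum>e\<in>{2 * A - int r..2 * U - int r}. L x e (R y (- (- P - 1) - 1 - e) \<alpha>) w)"
        proof (rule YP_sum)
          fix e assume e: "e \<notin> {2 * A - int r..2 * U - int r}"
          have "K i (e + int r - i) c (P - e + int (Q - r) - c) = 0" for i c
            by (rule K0) (use e r in \<open>auto simp: U_def of_nat_diff\<close>)
          then show "L x e (R y (- (- P - 1) - 1 - e) \<alpha>) w = 0" using E[of e] by simp
        qed simp
        then show "(\<Sum>e\<in>{2 * A - int r..2 * U - int r}. \<Sum>i\<in>{A..U}. \<Sum>c\<in>{A..U}. ?t r e i c) = X (int N - int r - 1)"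
          unfolding X by (simp add: E)
      qed
      also have "\<dots> = sum X I"
        by (rule sum.reindex_bij_witness[of _ "\<lambda>p. nat (int N - p - 1)" "\<lambda>r. int N - int r - 1"])
          (use l in \<open>auto simp: I_def\<close>)
      finally show ?thesis unfolding T .
    qed
  qed
  show ?thesis using loc f J by blast
qed

theorem tensor_module: "weak_tensor_module scV Yv vac D YP"
  unfolding weak_tensor_module_def
proof (intro conjI allI ballI)
  show "(\<lambda>w. 0) \<in> D" by (rule D_zero)
  fix \<alpha> assume a: "\<alpha> \<in> D"
  show "YP x n \<alpha> \<in> D" for x n using a by (rule YP_D)
  show "YP (scV c u1 + u2, v) n \<alpha> = (\<lambda>w. c * YP (u1, v) n \<alpha> w + YP (u2, v) n \<alpha> w)"
    "YP (v, scV c u1 + u2) n \<alpha> = (\<lambda>w. c * YP (v, u1) n \<alpha> w + YP (v, u2) n \<alpha> w)" for u1 u2 v n c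
    using YP_linv[OF a] by blast+
  show "\<exists>N. \<forall>n\<ge>N. YP x n \<alpha> = (\<lambda>w. 0)" for x by (rule YP_low[OF a])
  show "YP (vac, vac) n \<alpha> = (if n = - 1 then \<alpha> else (\<lambda>w. 0))" for n by (rule YP_vac[OF a])
  show "fsum (\<lambda>i. (-1) ^ i * ibin l i * YP x (l + m - int i) (YP y (n + int i) \<alpha>) w)
        - (-1) powi l * fsum (\<lambda>i. (-1) ^ i * ibin l i * YP y (l + n - int i) (YP x (m + int i) \<alpha>) w)
        = fsum (\<lambda>i. ibin m i * tensor_mode_op Yv YP x y (l + int i) (m + n - int i) \<alpha> w)" for x y l m n w
  proof -
    obtain u1 v1 u2 v2 where xy: "x = (u1, v1)" "y = (u2, v2)" by (cases x, cases y)
    let ?G = "YY x y \<alpha> w" and ?H = "tr (YY y x \<alpha> w)"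
    obtain N where N: "(m12 0 ^^ N) ?G = (m12 0 ^^ N) ?H" "fins ?G ?H"
      "\<And>l P. Jcf l ?G ?H P = tensor_mode_op Yv YP x y l (- P - 1) \<alpha> w"
      using tensor_main[OF a, of u1 v1 u2 v2 w] unfolding xy by blast
    have J: "Dcf l 0 n ?G ?H = tensor_mode_op Yv YP x y l n \<alpha> w" for l n
      using N(3)[of l "- n - 1"] by (simp add: Jcf_def)
    have 1: "Mop l ?G (- m - 1) (- n - 1) = fsum (\<lambda>i. (-1) ^ i * ibin l i * YP x (l + m - int i) (YP y (n + int i) \<alpha>) w)"
      unfolding Mop_def YY_def by (simp add: algebra_simps)
    have 2: "Mop l (tr ?H) (- n - 1) (- m - 1) = fsum (\<lambda>i. (-1) ^ i * ibin l i * YP y (l + n - int i) (YP x (m + int i) \<alpha>) w)"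
      unfolding Mop_def YY_def tr_def by (simp add: algebra_simps)
    have "Dcf l m n ?G ?H = fsum (\<lambda>i. ibin m i * Dcf (l + int i) 0 (m + n - int i) ?G ?H)"
      by (rule Dcf_full[OF N(2,1)])
    then show ?thesis unfolding J unfolding Dcf_def 1 2 .
  qed
next
  fix \<alpha> \<beta> c assume a: "\<alpha> \<in> D" "\<beta> \<in> D"
  show "(\<lambda>w. c * \<alpha> w + \<beta> w) \<in> D" by (rule D_add[OF a])
  show "YP x n (\<lambda>w. c * \<alpha> w + \<beta> w) = (\<lambda>w. c * YP x n \<alpha> w + YP x n \<beta> w)" for x n by (rule YP_add[OF a])
qed

lemma LR_finite: "\<alpha> \<in> D \<Longrightarrow> finite {i. L u i (R v (- k - 1 - i) \<alpha>) w \<noteq> 0}"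
proof -
  assume a: "\<alpha> \<in> D"
  obtain A where A: "\<And>i c. i < A \<or> c < A \<Longrightarrow> L u i (R v c \<alpha>) = (\<lambda>w. 0)" using LR_low[OF a, of u v] by blast
  have "{i. L u i (R v (- k - 1 - i) \<alpha>) w \<noteq> 0} \<subseteq> {A..- k - 1 - A}"
  proof
    fix i assume i: "i \<in> {i. L u i (R v (- k - 1 - i) \<alpha>) w \<noteq> 0}"
    then have "\<not> (i < A \<or> - k - 1 - i < A)" using A by auto
    then show "i \<in> {A..- k - 1 - A}" by auto
  qed
  then show ?thesis using finite_subset by blast
qed

end

section \<open>Laurent expansions\<close>

lemma conv_abs_iff: "conv_abs a x s \<longleftrightarrow> ((\<lambda>p. a p * x powi p) has_sum s) UNIV"
  unfolding conv_abs_def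
  using summable_on_iff_abs_summable_on_complex[of "\<lambda>p. a p * x powi p" UNIV]
    has_sum_imp_summable[of "\<lambda>p. a p * x powi p" UNIV s] by blast

lemma has_sum_finsum:
  fixes f :: "'i \<Rightarrow> 'a \<Rightarrow> complex"
  assumes "\<And>j. j \<in> J \<Longrightarrow> (f j has_sum s j) A"
  shows "((\<lambda>x. \<Sum>j\<in>J. f j x) has_sum (\<Sum>j\<in>J. s j)) A"
  using assms by (induction J rule: infinite_finite_induct) (auto intro: has_sum_add has_sum_0)

text \<open>A geometric sum whose ratio is an N-th root of unity. The second fact removes the
  indices near the chosen one, the first bounds the contribution of the others.\<close>

lemma roots_of_unity_sum:
  assumes N: "N > 0"
  defines "\<omega> \<equiv> (\<lambda>j::nat. cis (2 * pi * real j / real N))"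
  shows "(\<Sum>j<N. \<omega> j powi k) \<in> {0, of_nat N}"
    "k \<noteq> 0 \<Longrightarrow> \<bar>k\<bar> < int N \<Longrightarrow> (\<Sum>j<N. \<omega> j powi k) = 0"
proof -
  define \<eta> where "\<eta> = cis (2 * pi * of_int k / real N)"
  have w: "\<omega> j powi k = \<eta> ^ j" for j
    unfolding \<omega>_def \<eta>_def cis_power_int Complex.DeMoivre by (simp add: mult_ac)
  have eN: "\<eta> ^ N = 1"
    using N unfolding \<eta>_def Complex.DeMoivre by (simp add: cis_multiple_2pi)
  have 0: "(\<Sum>j<N. \<omega> j powi k) = 0" if "\<eta> \<noteq> 1"
    unfolding w using geometric_sum[OF that, of N] eN by simp
  then show "(\<Sum>j<N. \<omega> j powi k) \<in> {0, of_nat N}"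
    by (cases "\<eta> = 1") (simp_all add: w)
  assume k: "k \<noteq> 0" "\<bar>k\<bar> < int N"
  have "\<eta> \<noteq> 1"
  proof
    assume "\<eta> = 1"
    then have "cos (2 * pi * of_int k / real N) = 1" by (simp add: \<eta>_def complex_eq_iff)
    then obtain n :: int where "2 * pi * of_int k / real N = of_int n * 2 * pi" by (auto simp: cos_one_2pi_int)
    then have "real_of_int k = of_int n * of_int (int N)" using N by (simp add: field_simps)
    then have "k = n * int N" by (metis of_int_eq_iff of_int_mult)
    then have "int N dvd k" by simp
    then show False using k by (metis abs_of_nat dvd_imp_le_int not_less)
  qed
  then show "(\<Sum>j<N. \<omega> j powi k) = 0" by (rule 0)
qed

text \<open>Averaging over the \<open>n\<close>-th roots of unity isolates the coefficients with index congruent to \<open>m\<close> modulo \<open>n\<close>.\<close>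

lemma laurent_zero:
  fixes d :: "int \<Rightarrow> complex"
  assumes r: "r > 0" and s: "\<And>x. norm x = r \<Longrightarrow> ((\<lambda>p. d p * x powi p) has_sum 0) (UNIV :: int set)"
  shows "d m = 0"
proof -
  define e where "e = (\<lambda>p. d p * complex_of_real r powi p)"
  have es: "(\<lambda>p. norm (e p)) summable_on UNIV"
    using s[of "complex_of_real r"] r has_sum_imp_summable
    unfolding e_def summable_on_iff_abs_summable_on_complex[symmetric] by auto
  have "norm (e m) \<le> \<epsilon>" if \<epsilon>: "\<epsilon> > 0" for \<epsilon>
  proof -
    obtain F where F: "finite F" "dist (sum (\<lambda>p. norm (e p)) F) (infsum (\<lambda>p. norm (e p)) UNIV) \<le> \<epsilon>"
      using infsum_finite_approximation[OF es \<epsilon>] by blast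
    \<comment> \<open>More roots than the distance from m to any index in F, so averaging leaves no
      index of F other than m; what remains is controlled by a tail of norm at most
      \<epsilon>.\<close>
    define n where "n = Max (insert 0 ((\<lambda>p. nat \<bar>p - m\<bar>) ` F)) + 1"
    have nF: "\<bar>p - m\<bar> < int n" if "p \<in> F" for p
    proof -
      have "nat \<bar>p - m\<bar> \<le> Max (insert 0 ((\<lambda>p. nat \<bar>p - m\<bar>) ` F))" by (rule Max_ge) (use F that in auto)
      then show ?thesis unfolding n_def by linarith
    qed
    have n0: "n > 0" by (simp add: n_def)
    define \<omega> where "\<omega> = (\<lambda>j::nat. cis (2 * pi * real j / real n))"
    define t where "t = (\<lambda>k. \<Sum>j<n. \<omega> j powi k)"
    have t: "t k \<in> {0, of_nat n}" "k \<noteq> 0 \<Longrightarrow> \<bar>k\<bar> < int n \<Longrightarrow> t k = 0" for k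
      unfolding t_def \<omega>_def by (rule roots_of_unity_sum(1)[OF n0], rule roots_of_unity_sum(2)[OF n0])
    have t0: "t 0 = of_nat n" by (simp add: t_def)
    have "((\<lambda>p. \<omega> j powi (- m) * (d p * (of_real r * \<omega> j) powi p)) has_sum (\<omega> j powi (- m) * 0)) UNIV" for j
      by (intro has_sum_cmult_right s) (use r in \<open>simp add: norm_mult \<omega>_def\<close>)
    moreover have "\<omega> j powi (- m) * (d p * (of_real r * \<omega> j) powi p) = e p * \<omega> j powi (p - m)" for j p
      by (simp add: e_def power_int_mult_distrib power_int_diff power_int_minus field_simps \<omega>_def)
    ultimately have "((\<lambda>p. e p * \<omega> j powi (p - m)) has_sum 0) UNIV" for j by simp
    then have "((\<lambda>p. \<Sum>j<n. e p * \<omega> j powi (p - m)) has_sum (\<Sum>j<n. 0)) UNIV"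
      by (intro has_sum_finsum)
    then have "((\<lambda>p. e p * t (p - m)) has_sum 0) UNIV" by (simp add: t_def sum_distrib_left)
    from has_sum_Diff[OF this has_sum_finite[of "{m}"]]
    have 1: "((\<lambda>p. e p * t (p - m)) has_sum (- (e m * of_nat n))) (UNIV - {m})" by (simp add: t0)
    have 2: "((\<lambda>p. norm (e p)) has_sum (infsum (\<lambda>p. norm (e p)) UNIV - sum (\<lambda>p. norm (e p)) F)) (UNIV - F)"
      by (intro has_sum_Diff has_sum_infsum es has_sum_finite F) auto
    have 3: "((\<lambda>p. if p \<in> F then 0 else norm (e p)) has_sum (infsum (\<lambda>p. norm (e p)) UNIV - sum (\<lambda>p. norm (e p)) F)) UNIV"
      using 2 by (subst has_sum_cong_neutral[where T = "UNIV - F" and g = "\<lambda>p. norm (e p)"]) auto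
    define g where "g = (\<lambda>p. real n * (if p \<in> F then 0 else norm (e p)))"
    have 4: "(g has_sum (real n * (infsum (\<lambda>p. norm (e p)) UNIV - sum (\<lambda>p. norm (e p)) F))) UNIV"
      unfolding g_def by (rule has_sum_cmult_right[OF 3])
    then have gs: "g summable_on (UNIV - {m})" using has_sum_imp_summable summable_on_subset_banach by blast
    have 5: "infsum g (UNIV - {m}) \<le> real n * (infsum (\<lambda>p. norm (e p)) UNIV - sum (\<lambda>p. norm (e p)) F)"
      by (rule has_sum_mono'[OF has_sum_infsum[OF gs] 4]) (auto simp: g_def)
    have "norm (- (e m * of_nat n)) \<le> infsum g (UNIV - {m})"
    proof (rule norm_infsum_le[OF 1 has_sum_infsum[OF gs]])
      fix p assume p: "p \<in> UNIV - {m}"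
      show "norm (e p * t (p - m)) \<le> g p"
      proof (cases "p \<in> F")
        case True
        then have "t (p - m) = 0" using t(2)[of "p - m"] nF[OF True] p by auto
        then show ?thesis by (simp add: g_def)
      next
        case False
        then show ?thesis using t(1)[of "p - m"] by (auto simp: g_def norm_mult)
      qed
    qed
    also note 5
    also have "infsum (\<lambda>p. norm (e p)) UNIV - sum (\<lambda>p. norm (e p)) F \<le> \<epsilon>" using F(2) by (simp add: dist_real_def)
    finally have "norm (e m) * real n \<le> real n * \<epsilon>" using n0 by (simp add: norm_mult)
    then show ?thesis using n0 by (simp add: mult.commute)
  qed
  then have "norm (e m) \<le> 0" by (metis dense_ge)
  then show ?thesis using r by (simp add: e_def)
qed

lemma laurent_unique:
  assumes r: "r > 0" and s: "\<And>x. norm x = r \<Longrightarrow> conv_abs a x (s x)" "\<And>x. norm x = r \<Longrightarrow> conv_abs b x (s x)"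
  shows "a = b"
proof
  fix m
  have "((\<lambda>p. (a p - b p) * x powi p) has_sum 0) UNIV" if "norm x = r" for x
    using has_sum_diff[OF s(1)[OF that, unfolded conv_abs_iff] s(2)[OF that, unfolded conv_abs_iff]]
    by (simp add: left_diff_distrib)
  from laurent_zero[OF r this] show "a m = b m" by simp
qed

lemma conv_mx: "x \<noteq> 0 \<Longrightarrow> conv_abs a x s \<Longrightarrow> conv_abs (mx c a) x ((x - c) * s)"
proof -
  assume x: "x \<noteq> 0" and "conv_abs a x s"
  then have s: "((\<lambda>p. a p * x powi p) has_sum s) UNIV" by (simp add: conv_abs_iff)
  have b: "bij_betw (\<lambda>p::int. p - 1) UNIV UNIV" by (rule bij_betwI[where g = "\<lambda>p. p + 1"]) auto
  have "((\<lambda>p. a (p - 1) * x powi (p - 1)) has_sum s) UNIV"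
    using has_sum_reindex_bij_betw[OF b, of "\<lambda>p. a p * x powi p" s] s by simp
  from has_sum_cmult_right[OF this, of x]
  have "((\<lambda>p. a (p - 1) * x powi p) has_sum x * s) UNIV"
    using x by (simp add: power_int_diff)
  from has_sum_diff[OF this has_sum_cmult_right[OF s, of c]]
  show ?thesis by (simp add: conv_abs_iff mx_ap algebra_simps)
qed

lemma conv_mx_pow: "x \<noteq> 0 \<Longrightarrow> conv_abs a x s \<Longrightarrow> conv_abs ((mx c ^^ n) a) x ((x - c) ^ n * s)"
  by (induction n) (auto dest: conv_mx[where c = c] simp: mult.assoc)

lemma conv_unique: "conv_abs a x s \<Longrightarrow> conv_abs a x t \<Longrightarrow> s = t"
  unfolding conv_abs_iff by (rule has_sum_unique)

section \<open>Absolute convergence after division by x - c\<close>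

lemma nonneg_summable_int:
  fixes f :: "int \<Rightarrow> real"
  assumes "\<And>p. f p \<ge> 0" "\<And>n. sum f {- int n..int n} \<le> C"
  shows "f summable_on UNIV"
proof (rule nonneg_bdd_above_summable_on)
  show "bdd_above (sum f ` {F. F \<subseteq> UNIV \<and> finite F})"
  proof (rule bdd_aboveI[of _ C])
    fix y assume "y \<in> sum f ` {F. F \<subseteq> UNIV \<and> finite F}"
    then obtain F where F: "finite F" "y = sum f F" by auto
    define n where "n = Max (insert 0 ((\<lambda>p. nat \<bar>p\<bar>) ` F))"
    have "p \<in> {- int n..int n}" if "p \<in> F" for p
    proof -
      have "nat \<bar>p\<bar> \<le> n" unfolding n_def by (rule Max_ge) (use F that in auto)
      then show ?thesis by auto
    qed
    then have "sum f F \<le> sum f {- int n..int n}" using assms(1) by (intro sum_mono2) auto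
    then show "y \<le> C" using assms(2)[of n] F by simp
  qed
qed (use assms in auto)

lemma sum_int_pred:
  fixes f :: "int \<Rightarrow> real"
  assumes "\<And>p. f p \<ge> 0"
  shows "sum (\<lambda>p. f (p - 1)) {- int n..int n} + f (int n) = sum f {- int n..int n} + f (- int n - 1)"
proof -
  have "sum (\<lambda>p. f (p - 1)) {- int n..int n} = sum f {- int n - 1..int n - 1}"
    by (rule sum.reindex_bij_witness[of _ "\<lambda>p. p + 1" "\<lambda>p. p - 1"]) auto
  moreover have "{- int n - 1..int n} = insert (int n) {- int n - 1..int n - 1}"
    "{- int n - 1..int n} = insert (- int n - 1) {- int n..int n}" by auto
  then have "f (int n) + sum f {- int n - 1..int n - 1} = f (- int n - 1) + sum f {- int n..int n}"
    by (metis (no_types, lifting) atLeastAtMost_iff diff_add_cancel finite_atLeastAtMost_int less_irrefl minus_less_iff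
        sum.insert linorder_not_le less_add_one zless_iff_Suc_zadd diff_less_eq)
  ultimately show ?thesis by simp
qed

lemma partial_bound:
  assumes "conv_abs (mx c a) x s" "x \<noteq> 0"
  obtains C where "\<And>n. sum (\<lambda>p. norm (mx c a p * x powi p)) {- int n..int n} \<le> C"
proof -
  have "(\<lambda>p. norm (mx c a p * x powi p)) summable_on UNIV" using assms by (simp add: conv_abs_def)
  then have "sum (\<lambda>p. norm (mx c a p * x powi p)) {- int n..int n} \<le> infsum (\<lambda>p. norm (mx c a p * x powi p)) UNIV" for n
    by (intro finite_sum_le_infsum) auto
  then show ?thesis by (rule that)
qed

lemma mx_terms:
  assumes "x \<noteq> 0"
  shows "mx c a p * x powi p = x * (a (p - 1) * x powi (p - 1)) - c * (a p * x powi p)"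
  using assms by (simp add: mx_ap power_int_diff algebra_simps)

lemma conv_of_abs:
  assumes "(\<lambda>p. norm (a p * x powi p)) summable_on UNIV" "x \<noteq> 0" "x \<noteq> c" "conv_abs (mx c a) x s"
  shows "conv_abs a x (s / (x - c))"
proof -
  have "(\<lambda>p. a p * x powi p) summable_on UNIV" using assms(1) by (simp add: summable_on_iff_abs_summable_on_complex)
  then have 1: "conv_abs a x (infsum (\<lambda>p. a p * x powi p) UNIV)" unfolding conv_abs_iff by (rule has_sum_infsum)
  from conv_mx[OF assms(2) this, of c] assms(4) have "(x - c) * infsum (\<lambda>p. a p * x powi p) UNIV = s"
    by (rule conv_unique)
  then have "infsum (\<lambda>p. a p * x powi p) UNIV = s / (x - c)" using assms(3) by (simp add: field_simps)
  then show ?thesis using 1 by simp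
qed

text \<open>With f(p) = |a_p x^p| the recursion gives |x| f(p - 1) <= |term p of (x - c) a| + |c|
  f(p). On large symmetric intervals the upper truncation removes the boundary term, and (|x| - |c|)
  times the partial sum stays bounded.\<close>

lemma conv_div_high:
  assumes a: "bda a" and x: "norm x > norm c" and s: "conv_abs (mx c a) x s"
  shows "conv_abs a x (s / (x - c))"
proof -
  have x0: "x \<noteq> 0" using x by auto
  define f where "f = (\<lambda>p. norm (a p * x powi p))"
  obtain C where C: "\<And>n. sum (\<lambda>p. norm (mx c a p * x powi p)) {- int n..int n} \<le> C"
    by (rule partial_bound[OF s x0], rule that, assumption)
  obtain U where U: "\<And>p. p > U \<Longrightarrow> a p = 0" using a unfolding bda_def by blast
  have f0: "f p \<ge> 0" for p by (simp add: f_def)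
  have st: "norm x * f (p - 1) \<le> norm (mx c a p * x powi p) + norm c * f p" for p
  proof -
    have "x * (a (p - 1) * x powi (p - 1)) = mx c a p * x powi p + c * (a p * x powi p)" using mx_terms[OF x0] by simp
    then have "norm (x * (a (p - 1) * x powi (p - 1))) \<le> norm (mx c a p * x powi p) + norm (c * (a p * x powi p))"
      by (metis norm_triangle_ineq)
    then show ?thesis by (simp add: f_def norm_mult)
  qed
  have b: "sum f {- int n..int n} \<le> C / (norm x - norm c)" if n: "int n > U" for n
  proof -
    have "f (int n) = 0" using U[OF n] by (simp add: f_def)
    then have "sum f {- int n..int n} \<le> sum (\<lambda>p. f (p - 1)) {- int n..int n}"
      using sum_int_pred[of f n, OF f0] f0[of "- int n - 1"] by linarith
    then have "norm x * sum f {- int n..int n} \<le> sum (\<lambda>p. norm x * f (p - 1)) {- int n..int n}"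
      by (simp add: sum_distrib_left[symmetric] mult_left_mono)
    also have "\<dots> \<le> sum (\<lambda>p. norm (mx c a p * x powi p) + norm c * f p) {- int n..int n}"
      by (rule sum_mono) (rule st)
    also have "\<dots> = sum (\<lambda>p. norm (mx c a p * x powi p)) {- int n..int n} + norm c * sum f {- int n..int n}"
      by (simp add: sum.distrib sum_distrib_left)
    finally have "(norm x - norm c) * sum f {- int n..int n} \<le> C" using C[of n] by (simp add: algebra_simps)
    then show ?thesis using x by (simp add: pos_le_divide_eq mult.commute)
  qed
  have "f summable_on UNIV"
  proof (rule nonneg_summable_int[OF f0])
    fix n
    have "sum f {- int n..int n} \<le> sum f {- int (n + nat \<bar>U\<bar> + 1)..int (n + nat \<bar>U\<bar> + 1)}"
      by (rule sum_mono2) (auto simp: f0)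
    also have "\<dots> \<le> C / (norm x - norm c)" by (rule b) linarith
    finally show "sum f {- int n..int n} \<le> C / (norm x - norm c)" .
  qed
  then show ?thesis unfolding f_def by (rule conv_of_abs[OF _ x0 _ s]) (use x in auto)
qed

text \<open>The mirror image for |x| < |c|: the recursion is solved for the other coefficient and
  the boundary term vanishes by the lower bound.\<close>

lemma conv_div_low:
  assumes a: "\<And>p. p < L \<Longrightarrow> a p = 0" and x: "norm x < norm c" "x \<noteq> 0" and s: "conv_abs (mx c a) x s"
  shows "conv_abs a x (s / (x - c))"
proof -
  note x0 = x(2)
  define f where "f = (\<lambda>p. norm (a p * x powi p))"
  obtain C where C: "\<And>n. sum (\<lambda>p. norm (mx c a p * x powi p)) {- int n..int n} \<le> C"
    by (rule partial_bound[OF s x0], rule that, assumption)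
  have f0: "f p \<ge> 0" for p by (simp add: f_def)
  have st: "norm c * f p \<le> norm (mx c a p * x powi p) + norm x * f (p - 1)" for p
  proof -
    have "c * (a p * x powi p) = x * (a (p - 1) * x powi (p - 1)) - mx c a p * x powi p" using mx_terms[OF x0] by simp
    then have "norm (c * (a p * x powi p)) \<le> norm (x * (a (p - 1) * x powi (p - 1))) + norm (mx c a p * x powi p)"
      by (metis norm_triangle_ineq4)
    then show ?thesis by (simp add: f_def norm_mult)
  qed
  have b: "sum f {- int n..int n} \<le> C / (norm c - norm x)" if n: "- int n - 1 < L" for n
  proof -
    have "f (- int n - 1) = 0" using a[OF n] by (simp add: f_def)
    then have 1: "sum (\<lambda>p. f (p - 1)) {- int n..int n} \<le> sum f {- int n..int n}"
      using sum_int_pred[of f n, OF f0] f0[of "int n"] by linarith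
    have "norm c * sum f {- int n..int n} \<le> sum (\<lambda>p. norm (mx c a p * x powi p) + norm x * f (p - 1)) {- int n..int n}"
      unfolding sum_distrib_left by (rule sum_mono) (rule st)
    also have "\<dots> = sum (\<lambda>p. norm (mx c a p * x powi p)) {- int n..int n} + norm x * sum (\<lambda>p. f (p - 1)) {- int n..int n}"
      by (simp add: sum.distrib sum_distrib_left)
    also have "\<dots> \<le> C + norm x * sum f {- int n..int n}"
      by (intro add_mono C mult_left_mono 1) auto
    finally have "(norm c - norm x) * sum f {- int n..int n} \<le> C" by (simp add: algebra_simps)
    then show ?thesis using x by (simp add: pos_le_divide_eq mult.commute)
  qed
  have "f summable_on UNIV"
  proof (rule nonneg_summable_int[OF f0])
    fix n
    have "sum f {- int n..int n} \<le> sum f {- int (n + nat \<bar>L\<bar> + 1)..int (n + nat \<bar>L\<bar> + 1)}"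
      by (rule sum_mono2) (auto simp: f0)
    also have "\<dots> \<le> C / (norm c - norm x)" by (rule b) linarith
    finally show "sum f {- int n..int n} \<le> C / (norm c - norm x)" .
  qed
  then show ?thesis unfolding f_def by (rule conv_of_abs[OF _ x0 _ s]) (use x in auto)
qed

lemma conv_div_high_pow:
  "bda a \<Longrightarrow> norm x > norm c \<Longrightarrow> conv_abs ((mx c ^^ n) a) x s \<Longrightarrow> conv_abs a x (s / (x - c) ^ n)"
proof (induction n arbitrary: s)
  case (Suc n)
  then have "conv_abs ((mx c ^^ n) a) x (s / (x - c))" by (intro conv_div_high bda_mx_pow) auto
  from Suc.IH[OF Suc.prems(1,2) this] show ?case by (simp add: mult.commute)
qed simp

lemma conv_div_low_pow:
  assumes "\<And>p. p < L \<Longrightarrow> a p = 0" "norm x < norm c" "x \<noteq> 0"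
  shows "conv_abs ((mx c ^^ n) a) x s \<Longrightarrow> conv_abs a x (s / (x - c) ^ n)"
proof (induction n arbitrary: s)
  case (Suc n)
  have "conv_abs ((mx c ^^ n) a) x (s / (x - c))"
    by (rule conv_div_low[where L = L]) (use Suc.prems assms mx_low[where L = L] in auto)
  from Suc.IH[OF this] show ?case by (simp add: mult.commute)
qed simp

lemma conv_mx0_pow: "x \<noteq> 0 \<Longrightarrow> conv_abs ((mx 0 ^^ n) a) x s \<Longrightarrow> conv_abs a x (s / x ^ n)"
proof -
  assume x: "x \<noteq> 0" and "conv_abs ((mx 0 ^^ n) a) x s"
  then have s: "((\<lambda>p. a (p - int n) * x powi p) has_sum s) UNIV" by (simp add: conv_abs_iff mx_0_pow)
  have b: "bij_betw (\<lambda>p::int. p + int n) UNIV UNIV" by (rule bij_betwI[where g = "\<lambda>p. p - int n"]) auto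
  have "((\<lambda>p. a p * x powi (p + int n)) has_sum s) UNIV"
    using has_sum_reindex_bij_betw[OF b, of "\<lambda>p. a (p - int n) * x powi p" s] s by simp
  from has_sum_cmult_right[OF this, of "inverse (x ^ n)"]
  show ?thesis using x by (simp add: conv_abs_iff power_int_add field_simps)
qed

section \<open>Polynomials and rational functions as series\<close>

definition pc :: "complex poly \<Rightarrow> int \<Rightarrow> complex" where
  "pc q = (\<lambda>p. if p < 0 then 0 else poly.coeff q (nat p))"

lemma pc_pCons: "pc (pCons a q) = (\<lambda>p. mx 0 (pc q) p + (if p = 0 then a else 0))"
proof
  fix p :: int
  consider "p < 0" | "p = 0" | n where "p = int (Suc n)"
  proof (cases "p > 0")
    case True
    then have "p = int (Suc (nat (p - 1)))" by simp
    then show ?thesis by (rule that(3))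
  qed (use that in linarith)
  then show "pc (pCons a q) p = mx 0 (pc q) p + (if p = 0 then a else 0)"
    by cases (auto simp: pc_def mx_ap coeff_pCons nat_diff_distrib nat_add_distrib split: nat.split)
qed

lemma pc_lin: "pc (smult k q + r) = (\<lambda>p. k * pc q p + pc r p)"
  by (auto simp: pc_def)

lemma pc_0: "pc 0 = (\<lambda>p. 0)" by (auto simp: pc_def)

lemma bda_pc: "bda (pc q)"
  unfolding bda_def pc_def by (intro exI[of _ "int (degree q)"]) (auto simp: coeff_eq_0)

lemma conv_pc: "x \<noteq> 0 \<Longrightarrow> conv_abs (pc q) x (poly q x)"
proof (induction q rule: pCons_induct)
  case 0 then show ?case by (simp add: pc_0 conv_abs_iff has_sum_0)
next
  case (pCons a q)
  have "conv_abs (mx 0 (pc q)) x (x * poly q x)" using conv_mx[of x "pc q" _ 0] pCons by simp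
  moreover have "conv_abs (\<lambda>p. if p = 0 then a else 0) x a" unfolding conv_abs_iff
    by (rule has_sum_finite_neutralI[of "{0}"]) auto
  ultimately show ?case unfolding pc_pCons conv_abs_iff
    using has_sum_add[of "\<lambda>p. mx 0 (pc q) p * x powi p" UNIV "x * poly q x" "\<lambda>p. (if p = 0 then a else 0) * x powi p" a]
    by (simp add: algebra_simps)
qed

lemma pc_exists:
  assumes "bda b" "\<And>p. p < 0 \<Longrightarrow> b p = 0"
  obtains q where "pc q = b"
proof -
  obtain U where U: "\<And>p. p > U \<Longrightarrow> b p = 0" using assms(1) unfolding bda_def by blast
  have fin: "\<forall>\<^sub>\<infinity> n. b (int n) = 0"
    unfolding MOST_nat by (intro exI[of _ "nat U"]) (auto intro: U)
  have "pc (Abs_poly (\<lambda>n. b (int n))) = b"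
    unfolding pc_def coeff_Abs_poly_If_le using assms(2) fin by (auto simp: Abs_poly_inverse)
  then show ?thesis by (rule that)
qed

lemma Tr_pc: "Tr t (pc q) = pc (pcompose q [:t, 1:])"
proof (induction q rule: pCons_induct)
  case 0 then show ?case by (simp add: pc_0)
next
  case (pCons a q)
  let ?d = "\<lambda>p::int. if p = 0 then a else 0"
  have d: "Tr t ?d = ?d"
  proof
    fix p
    have "(ibin (p + int i) i * t ^ i) * ?d (p + int i) = (if i = 0 then ?d p else 0)" for i
      by (auto simp: ibin_0')
    then show "Tr t ?d p = ?d p" unfolding Tr_def by (subst fsum_eq[of 1]) auto
  qed
  have bd: "bda ?d" unfolding bda_def by (intro exI[of _ 0]) auto
  have "Tr t (pc (pCons a q)) = (\<lambda>p. Tr t (mx 0 (pc q)) p + ?d p)"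
    unfolding pc_pCons using Tr_lin[OF bda_mx[OF bda_pc, of 0 q] bd, of t 1] d by (simp add: fun_eq_iff)
  also have "\<dots> = (\<lambda>p. mx (- t) (pc (pcompose q [:t, 1:])) p + ?d p)"
    by (simp add: Tr_mx bda_pc pCons)
  also have "\<dots> = pc (pcompose (pCons a q) [:t, 1:])"
  proof -
    have "pcompose (pCons a q) [:t, 1:] = smult t (pcompose q [:t, 1:]) + pCons a (pcompose q [:t, 1:])"
      by (simp add: pcompose_pCons)
    then show ?thesis by (simp only: pc_lin pc_pCons) (simp add: mx_ap fun_eq_iff)
  qed
  finally show ?case .
qed

lemma ratfun_high:
  assumes a: "bda a" and e: "(mx 0 ^^ A) ((mx z ^^ B) a) = pc q" and x: "norm x > norm z"
  shows "conv_abs a x (ratfun_z z A B q x)"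
proof -
  have x0: "x \<noteq> 0" using x by auto
  have "conv_abs ((mx 0 ^^ A) ((mx z ^^ B) a)) x (poly q x)" unfolding e by (rule conv_pc[OF x0])
  from conv_div_high_pow[OF a x conv_mx0_pow[OF x0 this]]
  show ?thesis by (simp add: ratfun_z_def)
qed

lemma ratfun_low:
  assumes c: "\<And>p. p < L \<Longrightarrow> c p = 0" and e: "(mx 0 ^^ A) ((mx z ^^ B) c) = pc q" and x: "norm x < norm z" "x \<noteq> 0"
  shows "conv_abs c x (ratfun_z z A B q x)"
proof -
  have "conv_abs ((mx 0 ^^ A) ((mx z ^^ B) c)) x (poly q x)" unfolding e by (rule conv_pc[OF x(2)])
  from conv_div_low_pow[OF c x conv_mx0_pow[OF x(2) this]]
  show ?thesis by (simp add: ratfun_z_def)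
qed

text \<open>On the circle |x| = |z| + 1 the denominators can be cleared, and uniqueness of Laurent
  coefficients on one circle gives the formal identity.\<close>

lemma ratfun_high_conv:
  assumes "\<And>x. norm x > norm z \<Longrightarrow> conv_abs a x (ratfun_z z A B q x)"
  shows "(mx 0 ^^ A) ((mx z ^^ B) a) = pc q"
proof (rule laurent_unique[where r = "norm z + 1" and s = "poly q"])
  show "norm z + 1 > 0" by (simp add: add_nonneg_pos)
  fix x :: complex assume x: "norm x = norm z + 1"
  then have x0: "x \<noteq> 0" "x \<noteq> z" "norm x > norm z" by (auto simp: add_nonneg_eq_0_iff)
  show "conv_abs (pc q) x (poly q x)" by (rule conv_pc[OF x0(1)])
  from conv_mx_pow[OF x0(1) conv_mx_pow[OF x0(1) assms[OF x0(3)], where c = z and n = B], where c = 0 and n = A]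
  show "conv_abs ((mx 0 ^^ A) ((mx z ^^ B) a)) x (poly q x)"
    using x0 by (simp add: ratfun_z_def)
qed

lemma iota0_eqI:
  assumes "r > 0" "\<And>x. 0 < norm x \<Longrightarrow> norm x < r \<Longrightarrow> conv_abs c x (f x)"
  shows "iota0 r f = c"
  unfolding iota0_def
proof (rule the_equality)
  fix d assume d: "\<forall>x. 0 < norm x \<and> norm x < r \<longrightarrow> conv_abs d x (f x)"
  show "d = c"
    by (rule laurent_unique[of "r / 2" _ f]) (use assms d in auto)
qed (use assms in auto)

text \<open>Both expansions have the same numerator. The exponent C that witnesses
  \<open>ratl\<close> may differ from B, so the identity is proved with a further factor (x - z)^C,
  which is then cancelled.\<close>

lemma expd_poly:
  assumes z: "z \<noteq> 0" and a: "ratl z a" and e: "(mx 0 ^^ A) ((mx z ^^ B) a) = pc q"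
  shows "(mx 0 ^^ A) ((mx z ^^ B) (expd z a)) = pc q" "\<exists>L. \<forall>p<L. expd z a p = 0"
proof -
  obtain C L where C: "\<And>p. p < L \<Longrightarrow> (mx z ^^ C) a p = 0" using a unfolding ratl_def by blast
  note ep = expd_props[where L = L, OF z C]
  show 1: "\<exists>L. \<forall>p<L. expd z a p = 0" using ep(1) by blast
  have low: "(mx 0 ^^ A) ((mx z ^^ B) (expd z a)) p = 0" if "p < L" for p
    by (rule mx_low[where L = L], rule mx_low[where L = L]) (use ep(1) that in auto)
  have "(mx z ^^ C) ((mx 0 ^^ A) ((mx z ^^ B) (expd z a))) = (mx 0 ^^ A) ((mx z ^^ B) ((mx z ^^ C) (expd z a)))"
    by (simp add: mx_pow_comm)
  also have "(mx z ^^ C) (expd z a) = (mx z ^^ C) a" by (rule ep(2))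
  also have "(mx 0 ^^ A) ((mx z ^^ B) ((mx z ^^ C) a)) = (mx z ^^ C) (pc q)"
    unfolding e[symmetric] by (simp add: mx_pow_comm)
  finally have "(mx z ^^ C) ((mx 0 ^^ A) ((mx z ^^ B) (expd z a))) = (mx z ^^ C) (pc q)" .
  from mx_inj[where L = L and L' = 0, OF z low this]
  show "(mx 0 ^^ A) ((mx z ^^ B) (expd z a)) = pc q" by (simp add: pc_def)
qed

section \<open>Agreement of the algebraic and the analytic descriptions\<close>

context oppmod
begin

definition D_conv :: "('w \<Rightarrow> complex) set" where
  "D_conv = {\<alpha>. lin \<alpha> \<and> (\<forall>v. \<exists>A B. \<forall>w. \<exists>q. \<forall>x. norm x > norm z \<longrightarrow>
          conv_abs (\<lambda>p. \<alpha> (X v p w)) x (ratfun_z z A B q x))}"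

text \<open>A pole of order A at 0 becomes the lower bound -A. Conversely, the numerator is a
  polynomial because the matrix coefficients of X are bounded above.\<close>

lemma D_eq: "D_conv = D"
proof -
  have "(\<exists>A B. \<forall>w. \<exists>q. \<forall>x. norm x > norm z \<longrightarrow> conv_abs (\<lambda>p. \<alpha> (X v p w)) x (ratfun_z z A B q x))
    \<longleftrightarrow> (\<exists>B L. \<forall>w. \<forall>p<L. (mx z ^^ B) (\<lambda>p. \<alpha> (X v p w)) p = 0)" if al: "lin \<alpha>" for \<alpha> v
  proof
    assume "\<exists>A B. \<forall>w. \<exists>q. \<forall>x. norm x > norm z \<longrightarrow> conv_abs (\<lambda>p. \<alpha> (X v p w)) x (ratfun_z z A B q x)"
    then obtain A B where AB: "\<And>w. \<exists>q. \<forall>x. norm x > norm z \<longrightarrow> conv_abs (\<lambda>p. \<alpha> (X v p w)) x (ratfun_z z A B q x)" by blast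
    have "(mx z ^^ B) (\<lambda>p. \<alpha> (X v p w)) p = 0" if "p < - int A" for w p
    proof -
      obtain q where "\<And>x. norm x > norm z \<Longrightarrow> conv_abs (\<lambda>p. \<alpha> (X v p w)) x (ratfun_z z A B q x)" using AB by blast
      from fun_cong[OF ratfun_high_conv[OF this], of "p + int A"] that show ?thesis by (simp add: mx_0_pow pc_def)
    qed
    then show "\<exists>B L. \<forall>w. \<forall>p<L. (mx z ^^ B) (\<lambda>p. \<alpha> (X v p w)) p = 0" by blast
  next
    assume "\<exists>B L. \<forall>w. \<forall>p<L. (mx z ^^ B) (\<lambda>p. \<alpha> (X v p w)) p = 0"
    then obtain B L where BL: "\<And>w p. p < L \<Longrightarrow> (mx z ^^ B) (\<lambda>p. \<alpha> (X v p w)) p = 0" by blast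
    show "\<exists>A B. \<forall>w. \<exists>q. \<forall>x. norm x > norm z \<longrightarrow> conv_abs (\<lambda>p. \<alpha> (X v p w)) x (ratfun_z z A B q x)"
    proof (rule exI[of _ "nat (- L)"], rule exI[of _ B], rule allI)
      fix w
      obtain q where q: "pc q = (mx 0 ^^ nat (- L)) ((mx z ^^ B) (\<lambda>p. \<alpha> (X v p w)))"
        by (rule pc_exists[of "(mx 0 ^^ nat (- L)) ((mx z ^^ B) (\<lambda>p. \<alpha> (X v p w)))"])
          (auto intro!: bda_mx_pow bda_X al simp: mx_0_pow BL)
      show "\<exists>q. \<forall>x. norm x > norm z \<longrightarrow> conv_abs (\<lambda>p. \<alpha> (X v p w)) x (ratfun_z z (nat (- L)) B q x)"
        using ratfun_high[OF bda_X[OF al] q[symmetric]] by blast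
    qed
  qed
  then show ?thesis unfolding D_conv_def D_def by auto
qed

definition rat_fun :: "'v \<Rightarrow> ('w \<Rightarrow> complex) \<Rightarrow> 'w \<Rightarrow> complex \<Rightarrow> complex" where
  "rat_fun v \<alpha> w = (SOME f. \<exists>A B q. f = ratfun_z z A B q \<and>
      (\<forall>x. norm x > norm z \<longrightarrow> conv_abs (\<lambda>p. \<alpha> (X v p w)) x (f x)))"

text \<open>The chosen representative may have its own A, B, q for each w; the identity of
  coefficients holds for any choice and is all that the comparison uses.\<close>

lemma rat_fun_spec:
  assumes "\<alpha> \<in> D"
  obtains A B q where "rat_fun v \<alpha> w = ratfun_z z A B q" "(mx 0 ^^ A) ((mx z ^^ B) (\<lambda>p. \<alpha> (X v p w))) = pc q"
proof -
  have "\<exists>f A B q. f = ratfun_z z A B q \<and> (\<forall>x. norm x > norm z \<longrightarrow> conv_abs (\<lambda>p. \<alpha> (X v p w)) x (f x))"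
    using assms unfolding D_eq[symmetric] D_conv_def by blast
  from someI_ex[OF this] obtain A B q where f: "rat_fun v \<alpha> w = ratfun_z z A B q"
    "\<And>x. norm x > norm z \<Longrightarrow> conv_abs (\<lambda>p. \<alpha> (X v p w)) x (rat_fun v \<alpha> w x)"
    unfolding rat_fun_def by blast
  show ?thesis by (rule that[OF f(1) ratfun_high_conv]) (use f in simp)
qed

lemma iota_R:
  assumes a: "\<alpha> \<in> D"
  shows "iota0 (norm z) (rat_fun v \<alpha> w) n = Op 0 v n \<alpha> w"
proof -
  obtain A B q where f: "rat_fun v \<alpha> w = ratfun_z z A B q" and e: "(mx 0 ^^ A) ((mx z ^^ B) (\<lambda>p. \<alpha> (X v p w))) = pc q"
    using rat_fun_spec[OF a] .
  have r: "ratl z (\<lambda>p. \<alpha> (X v p w))" using D_ratl[OF a, of 0 v w] by (simp add: XT_0 pole_def)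
  note ep = expd_poly[OF z0 r e]
  obtain L where L: "\<And>p. p < L \<Longrightarrow> expd z (\<lambda>p. \<alpha> (X v p w)) p = 0" using ep(2) by blast
  have "iota0 (norm z) (rat_fun v \<alpha> w) = expd z (\<lambda>p. \<alpha> (X v p w))"
    unfolding f by (rule iota0_eqI) (use z0 ratfun_low[where L = L, OF L ep(1)] in auto)
  then show ?thesis by (simp add: Op_def XT_0 pole_def)
qed

text \<open>Substituting x + z turns x^A (x - z)^B into (x + z)^A x^B: the exponents change places
  and the numerator becomes q(x + z).\<close>

lemma iota_L:
  assumes a: "\<alpha> \<in> D"
  shows "iota0 (norm z) (\<lambda>x. rat_fun v \<alpha> w (x + z)) n = Op z v n \<alpha> w"
proof -
  obtain A B q where f: "rat_fun v \<alpha> w = ratfun_z z A B q" and e: "(mx 0 ^^ A) ((mx z ^^ B) (\<lambda>p. \<alpha> (X v p w))) = pc q"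
    using rat_fun_spec[OF a] .
  define a' where "a' = (\<lambda>p. \<alpha> (XT z v p w))"
  have a': "a' = Tr z (\<lambda>p. \<alpha> (X v p w))" unfolding a'_def using XT_ap[OF D_lin[OF a]] by blast
  have r: "ratl (- z) a'" using D_ratl[OF a, of z v w] by (simp add: a'_def pole_def)
  have b: "bda (\<lambda>p. \<alpha> (X v p w))" by (rule bda_X[OF D_lin[OF a]])
  have "Tr z ((mx 0 ^^ A) ((mx z ^^ B) (\<lambda>p. \<alpha> (X v p w)))) = (mx (- z) ^^ A) ((mx 0 ^^ B) a')"
    using b by (simp add: Tr_mx_pow bda_mx_pow a')
  then have e': "(mx 0 ^^ B) ((mx (- z) ^^ A) a') = pc (pcompose q [:z, 1:])"
    unfolding e Tr_pc by (simp add: mx_pow_comm)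
  have z0': "- z \<noteq> 0" using z0 by simp
  note ep = expd_poly[OF z0' r e']
  obtain L where L: "\<And>p. p < L \<Longrightarrow> expd (- z) a' p = 0" using ep(2) by blast
  have "iota0 (norm z) (\<lambda>x. rat_fun v \<alpha> w (x + z)) = expd (- z) a'"
  proof (rule iota0_eqI)
    fix x :: complex assume x: "0 < norm x" "norm x < norm z"
    have "conv_abs (expd (- z) a') x (ratfun_z (- z) B A (pcompose q [:z, 1:]) x)"
      by (rule ratfun_low[where L = L, OF L ep(1)]) (use x in auto)
    then show "conv_abs (expd (- z) a') x (rat_fun v \<alpha> w (x + z))"
      unfolding f by (simp add: ratfun_z_def poly_pcompose add.commute mult.commute)
  qed (use z0 in simp)
  then show ?thesis by (simp add: Op_def a'_def pole_def)
qed

end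

section \<open>Opposite vertex operators\<close>

lemma lin_fsum:
  assumes "Vector_Spaces.linear s1 s2 f" "evz t"
  shows "f (fsum t) = fsum (\<lambda>i. f (t i))"
proof -
  obtain I where I: "\<And>i. i \<ge> I \<Longrightarrow> t i = 0" using assms(2) unfolding evz_def by blast
  have "fsum (\<lambda>i. f (t i)) = (\<Sum>i<I. f (t i))" by (rule fsum_eq) (simp add: I linD(3)[OF assms(1)])
  also have "\<dots> = f (fsum t)" by (simp add: fsum_eq[OF I] lin_sum[OF assms(1)])
  finally show ?thesis by simp
qed

lemma lin_diff:
  assumes "Vector_Spaces.linear s1 s2 f"
  shows "f (x - y) = f x - f y"
  using linD(1)[OF assms, of "x - y" y] by simp

section \<open>Coefficients of the conjugation by the exponential of L(1)\<close>

definition triples :: "nat \<Rightarrow> (nat \<times> nat \<times> nat) set" where "triples N = {(i, j, s). i + j + s = N}"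

lemma finite_triples [simp]: "finite (triples N)"
  by (rule finite_subset[of _ "{..N} \<times> {..N} \<times> {..N}"]) (auto simp: triples_def)

text \<open>In L(1)^N / N! applied to u_n v, the coefficient of the term with L(1)^j on u, L(1)^i on
  v and the mode raised by s; here y = 2k - n - 2 for u of weight k.\<close>

definition conj_coef :: "int \<Rightarrow> nat \<Rightarrow> nat \<Rightarrow> nat \<Rightarrow> complex" where
  "conj_coef y i j s = ibin (y - int j) s / (fact i * fact j)"

text \<open>The three summands are the three ways to reach (i, j, s) by one more application of
  L(1). Clearing factorials leaves Pascal's rule and the absorption identity for binomials.\<close>

lemma conj_coef_rec:
  "of_nat (i + j + s) * conj_coef y i j s = (if i = 0 then 0 else conj_coef y (i - 1) j s) + (if j = 0 then 0 else conj_coef y i (j - 1) s)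
    + (if s = 0 then 0 else of_int (y + 1 - 2 * int j - int s) * conj_coef y i j (s - 1))"
proof -
  have 1: "(if i = 0 then 0 else conj_coef y (i - 1) j s) = of_nat i * conj_coef y i j s"
    by (cases i) (simp_all add: conj_coef_def fact_Suc del: of_nat_Suc)
  have 2: "(if j = 0 then 0 else conj_coef y i (j - 1) s) = of_nat j * (ibin (y - int j + 1) s / (fact i * fact j))"
  proof (cases j)
    case (Suc r)
    have e: "y - int (Suc r) + 1 = y - int r" by simp
    show ?thesis unfolding Suc e by (simp add: conj_coef_def fact_Suc del: of_nat_Suc)
  qed simp
  show ?thesis
  proof (cases s)
    case 0
    then show ?thesis unfolding 1 2 by (simp add: conj_coef_def distrib_right add_divide_distrib)
  next
    case (Suc r)
    define Z :: complex where "Z = of_int (y - int j)"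
    have a: "Z * (Z gchoose r) = of_nat r * (Z gchoose r) + of_nat (Suc r) * (Z gchoose Suc r)"
      by (rule gbinomial_mult_1)
    have b: "ibin (y - int j + 1) (Suc r) = (Z gchoose r) + (Z gchoose Suc r)"
      by (simp add: ibin_Suc) (simp add: ibin_def Z_def)
    have c: "(of_int (y + 1 - 2 * int j - int s) :: complex) = Z - of_nat j - of_nat r"
      by (simp add: Z_def Suc)
    have d: "conj_coef y i j s = (Z gchoose Suc r) / (fact i * fact j)" "conj_coef y i j (s - 1) = (Z gchoose r) / (fact i * fact j)"
      by (simp_all add: conj_coef_def ibin_def Z_def Suc)
    have e: "(of_nat j + of_nat (Suc r)) * (Z gchoose Suc r) = of_nat j * ((Z gchoose r) + (Z gchoose Suc r)) + (Z - of_nat j - of_nat r) * (Z gchoose r)"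
      using a by (simp add: algebra_simps)
    have "(of_nat j + of_nat (Suc r)) * conj_coef y i j s = of_nat j * (ibin (y - int j + 1) s / (fact i * fact j))
      + (Z - of_nat j - of_nat r) * conj_coef y i j (s - 1)"
      unfolding d unfolding Suc b times_divide_eq_right e by (simp add: add_divide_distrib)
    moreover have "of_nat (i + j + s) * conj_coef y i j s = of_nat i * conj_coef y i j s + (of_nat j + of_nat (Suc r)) * conj_coef y i j s"
      unfolding Suc by (simp add: algebra_simps)
    ultimately show ?thesis unfolding 1 2 c using Suc by (simp add: add.assoc)
  qed
qed

lemma triples_sum_rec:
  fixes F :: "nat \<Rightarrow> nat \<Rightarrow> nat \<Rightarrow> complex"
  shows "of_nat (Suc N) * (\<Sum>(i, j, s)\<in>triples (Suc N). conj_coef y i j s * F i j s)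
    = (\<Sum>(i, j, s)\<in>triples N. conj_coef y i j s * (F (Suc i) j s + F i (Suc j) s + of_int (y - 2 * int j - int s) * F i j (Suc s)))"
proof -
  have "of_nat (Suc N) * (\<Sum>(i, j, s)\<in>triples (Suc N). conj_coef y i j s * F i j s)
     = (\<Sum>(i, j, s)\<in>triples (Suc N). (of_nat (i + j + s) * conj_coef y i j s) * F i j s)"
    unfolding sum_distrib_left
  proof (rule sum.cong[OF refl])
    fix x assume "x \<in> triples (Suc N)"
    then obtain i j s where x: "x = (i, j, s)" "i + j + s = Suc N" by (auto simp: triples_def)
    show "of_nat (Suc N) * (case x of (i, j, s) \<Rightarrow> conj_coef y i j s * F i j s) = (case x of (i, j, s) \<Rightarrow> (of_nat (i + j + s) * conj_coef y i j s) * F i j s)"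
      unfolding x(1) prod.case x(2) by (simp only: mult.assoc)
  qed
  also have "\<dots> = (\<Sum>(i, j, s)\<in>triples (Suc N). (if i = 0 then 0 else conj_coef y (i - 1) j s) * F i j s)
     + (\<Sum>(i, j, s)\<in>triples (Suc N). (if j = 0 then 0 else conj_coef y i (j - 1) s) * F i j s)
     + (\<Sum>(i, j, s)\<in>triples (Suc N). (if s = 0 then 0 else of_int (y + 1 - 2 * int j - int s) * conj_coef y i j (s - 1)) * F i j s)"
    unfolding conj_coef_rec by (simp add: sum.distrib[symmetric] case_prod_unfold distrib_right)
  also have "(\<Sum>(i, j, s)\<in>triples (Suc N). (if i = 0 then 0 else conj_coef y (i - 1) j s) * F i j s)
     = (\<Sum>(i, j, s)\<in>{x \<in> triples (Suc N). fst x \<noteq> 0}. (if i = 0 then 0 else conj_coef y (i - 1) j s) * F i j s)"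
    by (rule sum.mono_neutral_right) (auto split: if_splits)
  also have "\<dots> = (\<Sum>(i, j, s)\<in>triples N. conj_coef y i j s * F (Suc i) j s)"
    by (rule sum.reindex_bij_witness[of _ "\<lambda>(i, j, s). (Suc i, j, s)" "\<lambda>(i, j, s). (i - 1, j, s)"]) (auto simp: triples_def)
  also have "(\<Sum>(i, j, s)\<in>triples (Suc N). (if j = 0 then 0 else conj_coef y i (j - 1) s) * F i j s)
     = (\<Sum>(i, j, s)\<in>{x \<in> triples (Suc N). fst (snd x) \<noteq> 0}. (if j = 0 then 0 else conj_coef y i (j - 1) s) * F i j s)"
    by (rule sum.mono_neutral_right) (auto split: if_splits)
  also have "\<dots> = (\<Sum>(i, j, s)\<in>triples N. conj_coef y i j s * F i (Suc j) s)"
    by (rule sum.reindex_bij_witness[of _ "\<lambda>(i, j, s). (i, Suc j, s)" "\<lambda>(i, j, s). (i, j - 1, s)"]) (auto simp: triples_def)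
  also have "(\<Sum>(i, j, s)\<in>triples (Suc N). (if s = 0 then 0 else of_int (y + 1 - 2 * int j - int s) * conj_coef y i j (s - 1)) * F i j s)
     = (\<Sum>(i, j, s)\<in>{x \<in> triples (Suc N). snd (snd x) \<noteq> 0}. (if s = 0 then 0 else of_int (y + 1 - 2 * int j - int s) * conj_coef y i j (s - 1)) * F i j s)"
    by (rule sum.mono_neutral_right) (auto split: if_splits)
  also have "\<dots> = (\<Sum>(i, j, s)\<in>triples N. conj_coef y i j s * (of_int (y - 2 * int j - int s) * F i j (Suc s)))"
    by (rule sum.reindex_bij_witness[of _ "\<lambda>(i, j, s). (i, j, Suc s)" "\<lambda>(i, j, s). (i, j, s - 1)"])
      (auto simp: triples_def of_nat_diff)
  finally show ?thesis by (simp add: sum.distrib[symmetric] case_prod_unfold distrib_left)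
qed

section \<open>Weights and the operator L(1)\<close>

locale voamod =
  fixes scV :: "complex \<Rightarrow> 'v::ab_group_add \<Rightarrow> 'v" and Y :: "'v \<Rightarrow> int \<Rightarrow> 'v \<Rightarrow> 'v" and vac om :: 'v
    and scW :: "complex \<Rightarrow> 'w::ab_group_add \<Rightarrow> 'w" and YW :: "'v \<Rightarrow> int \<Rightarrow> 'w \<Rightarrow> 'w" and z :: complex
  assumes voa: "voa scV Y vac om" and wm: "weak_module scV Y vac scW YW" and z0: "z \<noteq> 0"
begin

lemma voaD:
  "vector_space scV"
  "\<forall>u n. Vector_Spaces.linear scV scV (Y u n)"
  "\<forall>n v. Vector_Spaces.linear scV scV (\<lambda>u. Y u n v)"
  "\<forall>u v. \<exists>N. \<forall>n\<ge>N. Y u n v = 0"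
  "\<forall>u. (\<forall>n\<ge>0. Y u n vac = 0) \<and> Y u (-1) vac = u"
  "\<forall>u v w l m n. jacobi_coeff scV (Y u) (Y v) (\<lambda>k. Y (Y u k v)) l m n w"
  "\<exists>c::complex. \<forall>m n v.
        Lop Y om m (Lop Y om n v) - Lop Y om n (Lop Y om m v)
        = scV (of_int (m-n)) (Lop Y om (m+n) v)
          + (if m + n = 0 then scV ((of_int m ^ 3 - of_int m) / 12 * c) v else 0)"
  "\<forall>v n w. Y (Lop Y om (-1) v) n w = scV (- of_int n) (Y v (n-1) w)"
  "\<forall>v. \<exists>c::int \<Rightarrow> 'v. finite {k. c k \<noteq> 0} \<and> (\<forall>k. c k \<in> hom_space scV Y om k)
          \<and> v = sum c {k. c k \<noteq> 0}"
  "\<exists>N. \<forall>k<N. hom_space scV Y om k = {0}"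
  by (insert voa, unfold voa_def, elim conjE, assumption)+

lemma wmD:
  "vector_space scW"
  "\<forall>v n. Vector_Spaces.linear scW scW (YW v n)"
  "\<forall>n w. Vector_Spaces.linear scV scW (\<lambda>v. YW v n w)"
  "\<forall>v w. \<exists>N. \<forall>n\<ge>N. YW v n w = 0"
  "\<forall>n w. YW vac n w = (if n = -1 then w else 0)"
  "\<forall>u v w l m n. jacobi_coeff scW (YW u) (YW v) (\<lambda>k. YW (Y u k v)) l m n w"
  by (insert wm, unfold weak_module_def, elim conjE, assumption)+

lemmas Vvs = voaD(1) and Wvs = wmD(1)

sublocale V: vector_space scV by (rule Vvs)
sublocale W: vector_space scW by (rule Wvs)

lemmas Ylin = voaD(2)[rule_format] and Ylinu = voaD(3)[rule_format] and Ytr = voaD(4)[rule_format]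
  and YJ = voaD(6)[rule_format] and Vdec = voaD(9)[rule_format] and Vlow = voaD(10)

lemmas YWlin = wmD(2)[rule_format] and YWlinu = wmD(3)[rule_format] and YWtr = wmD(4)[rule_format]
  and YWvac = wmD(5)[rule_format] and YWJ = wmD(6)[rule_format]

lemma Ycreate: "n \<ge> 0 \<Longrightarrow> Y u n vac = 0" using voaD(5) by blast

lemma Lm1: "Y (Y om 0 v) n w = scV (- of_int n) (Y v (n - 1) w)"
  using voaD(8) by (simp add: Lop_def)

abbreviation "hom \<equiv> hom_space scV Y om"
definition L1 :: "'v \<Rightarrow> 'v" where "L1 = Y om 2"
abbreviation "lin \<equiv> Vector_Spaces.linear scW ((*) :: complex \<Rightarrow> complex \<Rightarrow> complex)"

lemma Lop1: "Lop Y om 1 = L1" by (simp add: Lop_def L1_def)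
lemma hom_iff: "v \<in> hom k \<longleftrightarrow> Y om 1 v = scV (of_int k) v" by (simp add: hom_space_def Lop_def)
lemma hom0: "0 \<in> hom k" by (simp add: hom_iff linD[OF Ylin])

lemma hom_lin: "u \<in> hom k \<Longrightarrow> v \<in> hom k \<Longrightarrow> scV c u + v \<in> hom k"
  by (simp add: hom_iff linD[OF Ylin] V.scale_right_distrib mult.commute)

lemma L1_pow_zero: "(L1 ^^ j) 0 = 0" by (induction j) (auto simp: L1_def linD[OF Ylin])
lemma L1_pow_lin: "(L1 ^^ j) (scV c u + v) = scV c ((L1 ^^ j) u) + (L1 ^^ j) v"
  by (induction j) (auto simp: L1_def linD[OF Ylin])

lemma ibin_nat_zero: "0 \<le> m \<Longrightarrow> nat m < i \<Longrightarrow> ibin m i = 0"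
  by (rule ibin_vanish) auto

text \<open>The commutator formula, the case l = 0 of the Jacobi identity. For L(0) and L(1), that
  is m = 1 and m = 2, only L(-1), L(0) and L(1) acting on u remain.\<close>

lemma om_comm:
  assumes "m = 1 \<or> m = 2"
  shows "Y om m (Y u n w) = Y u n (Y om m w) + (Y (Y om 0 u) (m + n) w
    + scV (ibin m 1) (Y (Y om 1 u) (m + n - 1) w) + scV (ibin m 2) (Y (Y om 2 u) (m + n - 2) w))"
proof -
  have v: "ibin m i = 0" if "i \<ge> 3" for i by (rule ibin_nat_zero) (use assms that in auto)
  have 1: "fsum (\<lambda>i. scV ((-1) ^ i * ibin 0 i) (Y om (0 + m - int i) (Y u (n + int i) w))) = Y om m (Y u n w)"
    by (subst fsum_eq[of 1]) (auto simp: ibin_0')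
  have 2: "fsum (\<lambda>i. scV ((-1) ^ i * ibin 0 i) (Y u (0 + n - int i) (Y om (m + int i) w))) = Y u n (Y om m w)"
    by (subst fsum_eq[of 1]) (auto simp: ibin_0')
  have 3: "fsum (\<lambda>i. scV (ibin m i) (Y (Y om (0 + int i) u) (m + n - int i) w))
     = Y (Y om 0 u) (m + n) w + scV (ibin m 1) (Y (Y om 1 u) (m + n - 1) w) + scV (ibin m 2) (Y (Y om 2 u) (m + n - 2) w)"
  proof -
    have "fsum (\<lambda>i. scV (ibin m i) (Y (Y om (0 + int i) u) (m + n - int i) w))
       = (\<Sum>i<3. scV (ibin m i) (Y (Y om (0 + int i) u) (m + n - int i) w))"
      by (rule fsum_eq) (simp add: v)
    also have "{..<3::nat} = {0, 1, 2}" by auto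
    finally show ?thesis by (simp add: add.assoc)
  qed
  show ?thesis using YJ[of om u 0 m n w] unfolding jacobi_coeff_def 1 2 3 by (simp add: algebra_simps)
qed

lemma ibin_small: "ibin 1 1 = 1" "ibin 1 2 = 0" "ibin 2 1 = 2" "ibin 2 2 = 1" "ibin 1 (Suc 0) = 1" "ibin 2 (Suc 0) = 2"
proof -
  have "ibin 2 2 = 1" using ibin_Suc[of 1 1] ibin_Suc[of 0 0] ibin_vanish[of 1 2] ibin_vanish[of 0 1]
    by (simp add: numeral_2_eq_2)
  then show "ibin 2 2 = 1" .
  show "ibin 1 1 = 1" "ibin 2 1 = 2" "ibin 1 (Suc 0) = 1" "ibin 2 (Suc 0) = 2" by (simp_all add: ibin_def)
  show "ibin 1 2 = 0" by (rule ibin_vanish) auto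
qed

lemma hom_Y: "u \<in> hom k \<Longrightarrow> v \<in> hom k' \<Longrightarrow> Y u n v \<in> hom (k + k' - n - 1)"
proof -
  assume u: "u \<in> hom k" and v: "v \<in> hom k'"
  have "Y om 1 (Y u n v) = Y u n (Y om 1 v) + (Y (Y om 0 u) (1 + n) v + Y (Y om 1 u) n v)"
    using om_comm[of 1 u n v] by (simp add: ibin_small)
  also have "\<dots> = scV (of_int k') (Y u n v) + (scV (- of_int (1 + n)) (Y u n v) + scV (of_int k) (Y u n v))"
    using u v unfolding hom_iff by (simp add: Lm1 ibin_small linD[OF Ylin] linD[OF Ylinu])
  also have "\<dots> = scV (of_int k' + (- of_int (1 + n) + of_int k)) (Y u n v)"
    by (simp only: V.scale_left_distrib)
  also have "of_int k' + (- of_int (1 + n) + of_int k) = (of_int (k + k' - n - 1) :: complex)" by simp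
  finally show ?thesis by (simp add: hom_iff)
qed

lemma L1_Y: "u \<in> hom k \<Longrightarrow> L1 (Y u n v) = Y u n (L1 v) + Y (L1 u) n v + scV (of_int (2 * k - n - 2)) (Y u (n + 1) v)"
proof -
  assume u: "u \<in> hom k"
  have "L1 (Y u n v) = Y u n (L1 v) + (Y (Y om 0 u) (2 + n) v + scV 2 (Y (Y om 1 u) (n + 1) v)
      + Y (Y om 2 u) n v)"
    using om_comm[of 2 u n v] by (simp add: ibin_small L1_def algebra_simps)
  also have "\<dots> = Y u n (L1 v) + (scV (- of_int (2 + n)) (Y u (n + 1) v) + scV (2 * of_int k) (Y u (n + 1) v) + Y (L1 u) n v)"
    using u unfolding hom_iff by (simp add: Lm1 ibin_small linD[OF Ylin] linD[OF Ylinu] L1_def add.commute)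
  also have "scV (- of_int (2 + n)) (Y u (n + 1) v) + scV (2 * of_int k) (Y u (n + 1) v) = scV (- of_int (2 + n) + 2 * of_int k) (Y u (n + 1) v)"
    by (simp only: V.scale_left_distrib)
  also have "- of_int (2 + n) + 2 * of_int k = (of_int (2 * k - n - 2) :: complex)" by simp
  finally show ?thesis by (simp add: algebra_simps)
qed

lemma hom_L1: "u \<in> hom k \<Longrightarrow> L1 u \<in> hom (k - 1)"
proof -
  assume u: "u \<in> hom k"
  obtain c where c: "\<And>m n v. Lop Y om m (Lop Y om n v) - Lop Y om n (Lop Y om m v)
        = scV (of_int (m-n)) (Lop Y om (m+n) v)
          + (if m + n = 0 then scV ((of_int m ^ 3 - of_int m) / 12 * c) v else 0)"
    using voaD(7) by blast
  have "Y om 1 (L1 u) - L1 (Y om 1 u) = scV (-1) (L1 u)"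
    using c[of 0 1 u] by (simp add: Lop_def L1_def)
  then have "Y om 1 (L1 u) = scV (of_int k) (L1 u) + scV (-1) (L1 u)"
    using u unfolding hom_iff by (simp add: L1_def linD[OF Ylin] algebra_simps)
  also have "\<dots> = scV (of_int (k - 1)) (L1 u)" by (simp only: V.scale_left_distrib[symmetric]) simp
  finally show ?thesis by (simp add: hom_iff)
qed

lemma hom_L1_pow: "u \<in> hom k \<Longrightarrow> (L1 ^^ j) u \<in> hom (k - int j)"
proof (induction j)
  case (Suc j)
  then have "L1 ((L1 ^^ j) u) \<in> hom (k - int j - 1)" by (intro hom_L1) auto
  then show ?case by (simp add: algebra_simps)
qed simp

definition wt_low :: int where "wt_low = (SOME N. \<forall>k<N. hom k = {0})"
text \<open>L(1) lowers the weight by one and weights are bounded below. The final + 1 keeps the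
  bound positive, so that the term j = 0 is always included.\<close>

definition nil_bound :: "int \<Rightarrow> nat" where "nil_bound k = nat (k - wt_low + 1) + 1"

lemma L1_nil: "u \<in> hom k \<Longrightarrow> j \<ge> nil_bound k \<Longrightarrow> (L1 ^^ j) u = 0"
proof -
  assume u: "u \<in> hom k" and j: "j \<ge> nil_bound k"
  have N: "\<forall>k<wt_low. hom k = {0}" unfolding wt_low_def using Vlow by (rule someI_ex)
  have "k - int j < wt_low" using j unfolding nil_bound_def by linarith
  then show ?thesis using N hom_L1_pow[OF u, of j] by blast
qed

lemma hom_indep: "finite S \<Longrightarrow> (\<And>k. k \<in> S \<Longrightarrow> c k \<in> hom k) \<Longrightarrow> (\<Sum>k\<in>S. c k) = 0 \<Longrightarrow> k \<in> S \<Longrightarrow> c k = 0"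
proof (induction S arbitrary: c k rule: finite_induct)
  case (insert k0 S)
  define d where "d = (\<lambda>k. scV (of_int (k - k0)) (c k))"
  have "Y om 1 (\<Sum>k\<in>insert k0 S. c k) = 0" using insert.prems(2) by (simp add: linD[OF Ylin])
  then have "(\<Sum>k\<in>insert k0 S. scV (of_int k) (c k)) = 0"
    using insert.prems(1) unfolding lin_sum[OF Ylin] by (simp add: hom_iff)
  moreover have "(\<Sum>k\<in>insert k0 S. scV (of_int k0) (c k)) = 0"
    unfolding V.scale_sum_right[symmetric] insert.prems(2) by simp
  ultimately have "(\<Sum>k\<in>insert k0 S. d k) = 0"
    unfolding d_def of_int_diff V.scale_left_diff_distrib by (simp add: sum_subtractf)
  then have "(\<Sum>k\<in>S. d k) = 0" using insert.hyps by (simp add: d_def)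
  moreover have "d k \<in> hom k" if "k \<in> S" for k
    using insert.prems(1)[of k] that hom_lin[OF _ hom0, of "c k" k "of_int (k - k0)"] by (simp add: d_def)
  ultimately have "d k = 0" if "k \<in> S" for k using insert.IH[of d k] that by blast
  then have S: "c k = 0" if "k \<in> S" for k using that insert.hyps by (auto simp: d_def)
  then have "c k0 = 0" using insert.prems(2) insert.hyps by simp
  then show ?case using S insert.prems(3) by blast
qed simp

section \<open>Homogeneous components\<close>

abbreviation "wt_comp \<equiv> hcomp scV Y om"

lemma wt_comp_eqI:
  assumes "finite S" "\<And>k. k \<notin> S \<Longrightarrow> c k = 0" "\<And>k. c k \<in> hom k" "v = sum c S"
  shows "wt_comp v = c"
  unfolding hcomp_def
proof (rule the_equality)
  have s: "{k. c k \<noteq> 0} \<subseteq> S" using assms by blast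
  have "sum c {k. c k \<noteq> 0} = sum c S" by (rule sum.mono_neutral_left) (use assms s in auto)
  then show "finite {k. c k \<noteq> 0} \<and> (\<forall>k. c k \<in> hom k) \<and> v = sum c {k. c k \<noteq> 0}"
    using finite_subset[OF s] assms by auto
  fix d assume d: "finite {k. d k \<noteq> 0} \<and> (\<forall>k. d k \<in> hom k) \<and> v = sum d {k. d k \<noteq> 0}"
  define T where "T = S \<union> {k. d k \<noteq> 0}"
  have fT: "finite T" using assms d by (simp add: T_def)
  have "sum d {k. d k \<noteq> 0} = sum d T" by (rule sum.mono_neutral_left) (use fT in \<open>auto simp: T_def\<close>)
  moreover have "sum c S = sum c T" by (rule sum.mono_neutral_left) (use fT assms in \<open>auto simp: T_def\<close>)
  ultimately have "(\<Sum>k\<in>T. scV (-1) (d k) + c k) = 0" using d assms by (simp add: sum.distrib sum_negf sum_subtractf)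
  note s0 = this
  have "scV (-1) (d k) + c k = 0" if "k \<in> T" for k
  proof (rule hom_indep[OF fT _ s0 that])
    show "scV (-1) (d k) + c k \<in> hom k" for k by (rule hom_lin) (use d assms in auto)
  qed
  moreover have "d k = 0 \<and> c k = 0" if "k \<notin> T" for k using that assms by (auto simp: T_def)
  ultimately have "d k = c k" for k by (cases "k \<in> T") (auto simp: add_eq_0_iff)
  then show "d = c" by blast
qed

lemma wt_comp_spec: "finite {k. wt_comp v k \<noteq> 0}" "wt_comp v k \<in> hom k" "v = sum (wt_comp v) {k. wt_comp v k \<noteq> 0}"
proof -
  obtain c where c: "finite {k. c k \<noteq> 0}" "\<forall>k. c k \<in> hom k" "v = sum c {k. c k \<noteq> 0}" using Vdec[of v] by blast
  have "wt_comp v = c" by (rule wt_comp_eqI[OF c(1)]) (use c in auto)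
  then show "finite {k. wt_comp v k \<noteq> 0}" "wt_comp v k \<in> hom k" "v = sum (wt_comp v) {k. wt_comp v k \<noteq> 0}" using c by auto
qed

lemma wt_comp_lin: "wt_comp (scV a u + v) = (\<lambda>k. scV a (wt_comp u k) + wt_comp v k)"
proof (rule wt_comp_eqI)
  let ?S = "{k. wt_comp u k \<noteq> 0} \<union> {k. wt_comp v k \<noteq> 0}"
  show fS: "finite ?S" using wt_comp_spec by blast
  have u: "u = sum (wt_comp u) ?S" by (subst wt_comp_spec(3), rule sum.mono_neutral_left) (use fS in auto)
  have v: "v = sum (wt_comp v) ?S" by (subst wt_comp_spec(3), rule sum.mono_neutral_left) (use fS in auto)
  show "scV a u + v = (\<Sum>k\<in>?S. scV a (wt_comp u k) + wt_comp v k)"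
    unfolding sum.distrib V.scale_sum_right[symmetric] u[symmetric] v[symmetric] ..
qed (auto intro: hom_lin wt_comp_spec)

lemma wt_comp_hom: "v \<in> hom k \<Longrightarrow> wt_comp v = (\<lambda>i. if i = k then v else 0)"
  by (rule wt_comp_eqI[where S = "{k}"]) (auto simp: hom0)

section \<open>The opposite operators and their Jacobi identity\<close>

definition X :: "'v \<Rightarrow> int \<Rightarrow> 'w \<Rightarrow> 'w" where "X = Yopp scV Y om scW YW"

text \<open>For v of weight k the summand with L(1)^j v contributes \<open>cf k j\<close> times its
  mode \<open>p + dd k j\<close> to the coefficient of x^p.\<close>

definition dd :: "int \<Rightarrow> nat \<Rightarrow> int" where "dd k j = 2 * k - int j - 1"
definition cf :: "int \<Rightarrow> nat \<Rightarrow> complex" where "cf k j = (-1) powi k / fact j"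

text \<open>Enlarged index sets replace the exact supports, so that several vectors can be summed
  over one common range.\<close>

lemma X_sum:
  assumes K: "finite K" "\<And>k. k \<notin> K \<Longrightarrow> wt_comp v k = 0" and J: "\<And>k. k \<in> K \<Longrightarrow> J k \<ge> nil_bound k"
  shows "X v p w = (\<Sum>k\<in>K. \<Sum>j<J k. scW (cf k j) (YW ((L1 ^^ j) (wt_comp v k)) (p + dd k j) w))"
proof -
  have "X v p w = (\<Sum>k\<in>{k. wt_comp v k \<noteq> 0}. \<Sum>j\<in>{j. (L1 ^^ j) (wt_comp v k) \<noteq> 0}. scW (cf k j) (YW ((L1 ^^ j) (wt_comp v k)) (p + dd k j) w))"
    unfolding X_def Yopp_def Lop1 by (simp add: cf_def dd_def algebra_simps)
  also have "\<dots> = (\<Sum>k\<in>{k. wt_comp v k \<noteq> 0}. \<Sum>j<J k. scW (cf k j) (YW ((L1 ^^ j) (wt_comp v k)) (p + dd k j) w))"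
  proof (rule sum.cong[OF refl], rule sum.mono_neutral_left)
    fix k assume "k \<in> {k. wt_comp v k \<noteq> 0}"
    then have "k \<in> K" using K by blast
    then show "{j. (L1 ^^ j) (wt_comp v k) \<noteq> 0} \<subseteq> {..<J k}"
      using L1_nil[OF wt_comp_spec(2), of k _ v] J[of k] by (auto simp: not_le[symmetric])
  qed (auto simp: linD[OF YWlinu])
  also have "\<dots> = (\<Sum>k\<in>K. \<Sum>j<J k. scW (cf k j) (YW ((L1 ^^ j) (wt_comp v k)) (p + dd k j) w))"
    by (rule sum.mono_neutral_left) (use K in \<open>auto simp: L1_pow_zero linD[OF YWlinu]\<close>)
  finally show ?thesis .
qed

lemma X_hom: "v \<in> hom k \<Longrightarrow> J \<ge> nil_bound k \<Longrightarrow> X v p w = (\<Sum>j<J. scW (cf k j) (YW ((L1 ^^ j) v) (p + dd k j) w))"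
  by (subst X_sum[where K = "{k}" and J = "\<lambda>_. J"]) (auto simp: wt_comp_hom)

lemma X_rep: "\<exists>S. finite S \<and> (\<forall>p w. X v p w = (\<Sum>(k, j)\<in>S. scW (cf k j) (YW ((L1 ^^ j) (wt_comp v k)) (p + dd k j) w)))"
proof -
  let ?S = "Sigma {k. wt_comp v k \<noteq> 0} (\<lambda>k. {..<nil_bound k})"
  have "finite ?S" using wt_comp_spec(1) by blast
  moreover have "X v p w = (\<Sum>(k, j)\<in>?S. scW (cf k j) (YW ((L1 ^^ j) (wt_comp v k)) (p + dd k j) w))" for p w
    by (subst X_sum[OF wt_comp_spec(1), where J = nil_bound], simp, simp, rule sum.Sigma) (auto simp: wt_comp_spec)
  ultimately show ?thesis by blast
qed

lemma X_lin: "Vector_Spaces.linear scW scW (X v p)"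
proof (rule linI[OF Wvs Wvs])
  fix c x y
  obtain S where "finite S" and S: "\<And>p w. X v p w = (\<Sum>(k, j)\<in>S. scW (cf k j) (YW ((L1 ^^ j) (wt_comp v k)) (p + dd k j) w))"
    using X_rep[of v] by blast
  show "X v p (scW c x + y) = scW c (X v p x) + X v p y"
    unfolding S by (simp add: linD[OF YWlin] W.scale_sum_right sum.distrib W.scale_right_distrib case_prod_unfold mult.commute)
qed

lemma X_linv: "Vector_Spaces.linear scV scW (\<lambda>v. X v p w)"
proof (rule linI[OF Vvs Wvs])
  fix c u v
  let ?K = "{k. wt_comp u k \<noteq> 0} \<union> {k. wt_comp v k \<noteq> 0}"
  have K: "finite ?K" using wt_comp_spec(1) by blast
  have u: "X u p w = (\<Sum>k\<in>?K. \<Sum>j<nil_bound k. scW (cf k j) (YW ((L1 ^^ j) (wt_comp u k)) (p + dd k j) w))"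
    by (rule X_sum[OF K]) auto
  have v: "X v p w = (\<Sum>k\<in>?K. \<Sum>j<nil_bound k. scW (cf k j) (YW ((L1 ^^ j) (wt_comp v k)) (p + dd k j) w))"
    by (rule X_sum[OF K]) auto
  have uv: "X (scV c u + v) p w = (\<Sum>k\<in>?K. \<Sum>j<nil_bound k. scW (cf k j) (YW ((L1 ^^ j) (wt_comp (scV c u + v) k)) (p + dd k j) w))"
    by (rule X_sum[OF K]) (auto simp: wt_comp_lin)
  show "X (scV c u + v) p w = scW c (X u p w) + X v p w"
    unfolding u v uv wt_comp_lin L1_pow_lin
    by (simp add: linD[OF YWlinu] W.scale_sum_right sum.distrib W.scale_right_distrib mult.commute)
qed

lemma X_high: "\<exists>U. \<forall>p>U. X v p w = 0"
proof -
  obtain S where fS: "finite S" and S: "\<And>p w. X v p w = (\<Sum>(k, j)\<in>S. scW (cf k j) (YW ((L1 ^^ j) (wt_comp v k)) (p + dd k j) w))"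
    using X_rep[of v] by blast
  have "\<forall>x. \<exists>N. \<forall>n\<ge>N. YW ((L1 ^^ (snd x)) (wt_comp v (fst x))) n w = 0" by (intro allI YWtr)
  then obtain Nf where Nf: "\<And>x n. n \<ge> Nf x \<Longrightarrow> YW ((L1 ^^ (snd x)) (wt_comp v (fst x))) n w = 0"
    unfolding choice_iff by blast
  define U where "U = Max (insert 0 ((\<lambda>x. Nf x - dd (fst x) (snd x)) ` S))"
  have U: "Nf x - dd (fst x) (snd x) \<le> U" if "x \<in> S" for x unfolding U_def by (rule Max_ge) (use fS that in auto)
  have "X v p w = 0" if "p > U" for p
    unfolding S case_prod_unfold by (rule sum.neutral) (use U that Nf in \<open>fastforce\<close>)
  then show ?thesis by blast
qed

lemma X_vac: "X vac p w = (if p = 0 then w else 0)"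
proof -
  have v: "vac \<in> hom 0" by (simp add: hom_iff Ycreate)
  have j: "(L1 ^^ j) vac = (if j = 0 then vac else 0)" for j
    by (induction j) (auto simp: L1_def Ycreate linD[OF Ylin])
  have "X vac p w = (\<Sum>j<nil_bound 0. if j = 0 then YW vac (p - 1) w else 0)"
    unfolding X_hom[OF v order_refl] by (rule sum.cong) (auto simp: j cf_def dd_def linD[OF YWlinu])
  also have "\<dots> = YW vac (p - 1) w" by (simp add: nil_bound_def)
  finally show ?thesis by (simp add: YWvac)
qed

lemma YW_evz1: "evz (\<lambda>i. scW (c i) (YW x (f i) (YW y (n + int i) w)))"
proof -
  obtain N where "\<And>n. n \<ge> N \<Longrightarrow> YW y n w = 0" using YWtr by blast
  then show ?thesis unfolding evz_def by (intro exI[of _ "nat (N - n)"]) (auto simp: linD[OF YWlin])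
qed

lemma YW_evz2: "evz (\<lambda>i. scW (c i) (YW (Y x (n + int i) y) (f i) w))"
proof -
  obtain N where "\<And>n. n \<ge> N \<Longrightarrow> Y x n y = 0" using Ytr by blast
  then show ?thesis unfolding evz_def by (intro exI[of _ "nat (N - n)"]) (auto simp: linD[OF YWlinu])
qed

lemma WB:
  assumes a: "lin \<alpha>"
  shows "fsum (\<lambda>i. ((-1)^i * ibin l i) * \<alpha> (YW x (l+m-int i) (YW y (n+int i) w)))
     - ((-1) powi l) * (fsum (\<lambda>i. ((-1)^i * ibin l i) * \<alpha> (YW y (l+n-int i) (YW x (m+int i) w))))
     = fsum (\<lambda>i. ibin m i * \<alpha> (YW (Y x (l+int i) y) (m+n-int i) w))"
  using arg_cong[OF YWJ[of x y l m n w, unfolded jacobi_coeff_def], of \<alpha>]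
  by (simp add: lin_diff[OF a] linD[OF a] lin_fsum[OF a YW_evz1] lin_fsum[OF a YW_evz2])

abbreviation "gg \<alpha> w x c y d \<equiv> (\<lambda>a b. \<alpha> (YW y (b + d) (YW x (a + c) w)))"
abbreviation "hh \<alpha> w x c y d \<equiv> (\<lambda>a b. \<alpha> (YW x (a + c) (YW y (b + d) w)))"

lemma gh_fins: "lin \<alpha> \<Longrightarrow> fins (gg \<alpha> w x c y d) (hh \<alpha> w x c y d)"
  unfolding fins_def fin1_def tr_def
proof safe
  assume a: "lin \<alpha>"
  have *: "evz (\<lambda>i. \<alpha> (YW x (f i) (YW y (n + int i) w)))" for x f y n
  proof -
    obtain N where "\<And>n. n \<ge> N \<Longrightarrow> YW y n w = 0" using YWtr by blast
    then show ?thesis unfolding evz_def by (intro exI[of _ "nat (N - n)"]) (auto simp: linD[OF YWlin] linD[OF a])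
  qed
  show "evz (\<lambda>i. \<alpha> (YW y (b - int i + d) (YW x (e + int i + c) w)))" for e b
    using *[of y "\<lambda>i. b - int i + d" x "e + c"] by (simp add: algebra_simps)
  show "evz (\<lambda>i. \<alpha> (YW x (b - int i + c) (YW y (e + int i + d) w)))" for e b
    using *[of x "\<lambda>i. b - int i + c" y "e + d"] by (simp add: algebra_simps)
qed

text \<open>Passing from x to 1/x turns exponents into modes: with m' and n' as below the two
  expansions are those of the identity on W with the products exchanged, which accounts for the sign
  -(-1)^l.\<close>

lemma gh_Dcf:
  assumes a: "lin \<alpha>"
  shows "Dcf l m n (gg \<alpha> w x c y d) (hh \<alpha> w x c y d) = - ((-1) powi l) *
    fsum (\<lambda>i. ibin (c - m - 1 - l) i * \<alpha> (YW (Y x (l + int i) y) ((c - m - 1 - l) + (d - n - 1 - l) - int i) w))"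
proof -
  define m' n' where "m' = c - m - 1 - l" and "n' = d - n - 1 - l"
  have 1: "Mop l (gg \<alpha> w x c y d) (- m - 1) (- n - 1) = fsum (\<lambda>i. ((-1)^i * ibin l i) * \<alpha> (YW y (l+n'-int i) (YW x (m'+int i) w)))"
    unfolding Mop_def m'_def n'_def by (simp add: algebra_simps)
  have 2: "Mop l (tr (hh \<alpha> w x c y d)) (- n - 1) (- m - 1) = fsum (\<lambda>i. ((-1)^i * ibin l i) * \<alpha> (YW x (l+m'-int i) (YW y (n'+int i) w)))"
    unfolding Mop_def m'_def n'_def tr_def by (simp add: algebra_simps)
  have sg: "((-1::complex) powi l) * ((-1) powi l) = 1" by (simp add: power_int_mult_distrib[symmetric])
  have "Dcf l m n (gg \<alpha> w x c y d) (hh \<alpha> w x c y d)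
     = - ((-1) powi l) * (Mop l (tr (hh \<alpha> w x c y d)) (- n - 1) (- m - 1) - (-1) powi l * Mop l (gg \<alpha> w x c y d) (- m - 1) (- n - 1))"
    using sg by (simp add: Dcf_def right_diff_distrib mult.assoc[symmetric])
  also have "\<dots> = - ((-1) powi l) * fsum (\<lambda>i. ibin m' i * \<alpha> (YW (Y x (l + int i) y) (m' + n' - int i) w))"
    unfolding 1 2 WB[OF a] ..
  finally show ?thesis unfolding m'_def n'_def .
qed

definition GG where "GG \<alpha> w u v = (\<lambda>a b. \<alpha> (X v b (X u a w)) :: complex)"
definition HH where "HH \<alpha> w u v = (\<lambda>a b. \<alpha> (X u a (X v b w)) :: complex)"

lemma GH_fins: "lin \<alpha> \<Longrightarrow> fins (GG \<alpha> w u v) (HH \<alpha> w u v)"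
  unfolding fins_def fin1_def tr_def GG_def HH_def
proof safe
  assume a: "lin \<alpha>"
  have *: "evz (\<lambda>i. \<alpha> (X x (f i) (X y (n + int i) w)))" for x f y n
  proof -
    obtain N where "\<And>n. n > N \<Longrightarrow> X y n w = 0" using X_high by blast
    then show ?thesis unfolding evz_def by (intro exI[of _ "nat (N - n + 1)"]) (auto simp: linD[OF X_lin] linD[OF a])
  qed
  show "evz (\<lambda>i. \<alpha> (X v (b - int i) (X u (e + int i) w)))" for e b by (rule *)
  show "evz (\<lambda>i. \<alpha> (X u (b - int i) (X v (e + int i) w)))" for e b by (rule *)
qed

lemma GH_rep:
  assumes a: "lin \<alpha>" and S: "finite S" "finite S'"
    and u: "\<And>p w. X u p w = (\<Sum>x\<in>S. scW (cu x) (YW (eu x) (p + du x) w))"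
    and v: "\<And>p w. X v p w = (\<Sum>y\<in>S'. scW (cv y) (YW (ev y) (p + dv y) w))"
  shows "GG \<alpha> w u v = (\<lambda>a b. \<Sum>q\<in>S \<times> S'. (cu (fst q) * cv (snd q)) * gg \<alpha> w (eu (fst q)) (du (fst q)) (ev (snd q)) (dv (snd q)) a b)"
    "HH \<alpha> w u v = (\<lambda>a b. \<Sum>q\<in>S \<times> S'. (cu (fst q) * cv (snd q)) * hh \<alpha> w (eu (fst q)) (du (fst q)) (ev (snd q)) (dv (snd q)) a b)"
proof -
  show "GG \<alpha> w u v = (\<lambda>a b. \<Sum>q\<in>S \<times> S'. (cu (fst q) * cv (snd q)) * gg \<alpha> w (eu (fst q)) (du (fst q)) (ev (snd q)) (dv (snd q)) a b)"
    unfolding GG_def u v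
  proof (intro ext)
    fix a b
    show "\<alpha> (\<Sum>y\<in>S'. scW (cv y) (YW (ev y) (b + dv y) (\<Sum>x\<in>S. scW (cu x) (YW (eu x) (a + du x) w)))) =
      (\<Sum>q\<in>S \<times> S'. (cu (fst q) * cv (snd q)) * gg \<alpha> w (eu (fst q)) (du (fst q)) (ev (snd q)) (dv (snd q)) a b)"
      unfolding sum.cartesian_product' fst_conv snd_conv
      by (rule trans[OF _ sum.swap])
        (simp add: lin_sum[OF a] lin_sum[OF YWlin] linD[OF a] linD[OF YWlin] sum_distrib_left mult_ac)
  qed
  show "HH \<alpha> w u v = (\<lambda>a b. \<Sum>q\<in>S \<times> S'. (cu (fst q) * cv (snd q)) * hh \<alpha> w (eu (fst q)) (du (fst q)) (ev (snd q)) (dv (snd q)) a b)"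
    unfolding HH_def u v
  proof (intro ext)
    fix a b
    show "\<alpha> (\<Sum>x\<in>S. scW (cu x) (YW (eu x) (a + du x) (\<Sum>y\<in>S'. scW (cv y) (YW (ev y) (b + dv y) w)))) =
      (\<Sum>q\<in>S \<times> S'. (cu (fst q) * cv (snd q)) * hh \<alpha> w (eu (fst q)) (du (fst q)) (ev (snd q)) (dv (snd q)) a b)"
      unfolding sum.cartesian_product' fst_conv snd_conv
      by (simp add: lin_sum[OF a] lin_sum[OF YWlin] linD[OF a] linD[OF YWlin] sum_distrib_left mult_ac)
  qed
qed

lemma GH_Dcf:
  assumes a: "lin \<alpha>" and S: "finite S" "finite S'"
    and u: "\<And>p w. X u p w = (\<Sum>x\<in>S. scW (cu x) (YW (eu x) (p + du x) w))"
    and v: "\<And>p w. X v p w = (\<Sum>y\<in>S'. scW (cv y) (YW (ev y) (p + dv y) w))"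
  shows "Dcf l m n (GG \<alpha> w u v) (HH \<alpha> w u v) = (\<Sum>q\<in>S \<times> S'. (cu (fst q) * cv (snd q)) * (- ((-1) powi l) *
    fsum (\<lambda>i. ibin (du (fst q) - m - 1 - l) i * \<alpha> (YW (Y (eu (fst q)) (l + int i) (ev (snd q))) ((du (fst q) - m - 1 - l) + (dv (snd q) - n - 1 - l) - int i) w))))"
  unfolding GH_rep[OF a S u v]
  by (subst Dcf_sum) (use S in \<open>auto simp: gh_fins[OF a] gh_Dcf[OF a]\<close>)

text \<open>Only finitely many pairs L(1)^j u, L(1)^i v occur. For l beyond the truncation of all
  their products the right-hand side of the Jacobi identity is zero, with a bound that involves
  neither \<alpha> nor w.\<close>

lemma X_loc: "\<exists>N. \<forall>\<alpha> w. lin \<alpha> \<longrightarrow> (m12 0 ^^ N) (GG \<alpha> w u v) = (m12 0 ^^ N) (HH \<alpha> w u v)"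
proof -
  obtain S where fS: "finite S" and S: "\<And>p w. X u p w = (\<Sum>(k, j)\<in>S. scW (cf k j) (YW ((L1 ^^ j) (wt_comp u k)) (p + dd k j) w))"
    using X_rep[of u] by blast
  obtain S' where fS': "finite S'" and S': "\<And>p w. X v p w = (\<Sum>(k, j)\<in>S'. scW (cf k j) (YW ((L1 ^^ j) (wt_comp v k)) (p + dd k j) w))"
    using X_rep[of v] by blast
  define eu where "eu = (\<lambda>x. (L1 ^^ (snd x)) (wt_comp u (fst x)))"
  define ev where "ev = (\<lambda>x. (L1 ^^ (snd x)) (wt_comp v (fst x)))"
  define c where "c = (\<lambda>x. cf (fst x) (snd x))"
  define d where "d = (\<lambda>x. dd (fst x) (snd x))"
  have u: "X u p w = (\<Sum>x\<in>S. scW (c x) (YW (eu x) (p + d x) w))" for p w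
    unfolding S by (simp add: case_prod_unfold eu_def c_def d_def)
  have v: "X v p w = (\<Sum>x\<in>S'. scW (c x) (YW (ev x) (p + d x) w))" for p w
    unfolding S' by (simp add: case_prod_unfold ev_def c_def d_def)
  have "\<forall>x y. \<exists>N. \<forall>n\<ge>N. Y (eu x) n (ev y) = 0" by (intro allI Ytr)
  then obtain Nf where Nf: "\<And>x y n. n \<ge> Nf x y \<Longrightarrow> Y (eu x) n (ev y) = 0" unfolding choice_iff by blast
  define N where "N = nat (Max (insert 0 ((\<lambda>q. Nf (fst q) (snd q)) ` (S \<times> S'))))"
  have N: "Nf (fst q) (snd q) \<le> int N" if "q \<in> S \<times> S'" for q
  proof -
    have "Nf (fst q) (snd q) \<le> Max (insert 0 ((\<lambda>q. Nf (fst q) (snd q)) ` (S \<times> S')))"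
      by (rule Max_ge) (use fS fS' that in auto)
    then show ?thesis unfolding N_def by linarith
  qed
  have "Dcf (int N) m n (GG \<alpha> w u v) (HH \<alpha> w u v) = 0" if a: "lin \<alpha>" for \<alpha> w m n
    unfolding GH_Dcf[OF a fS fS' u v]
  proof (rule sum.neutral, rule ballI)
    fix q assume q: "q \<in> S \<times> S'"
    have "Y (eu (fst q)) (int N + int i) (ev (snd q)) = 0" for i by (rule Nf) (use N[OF q] in linarith)
    then show "c (fst q) * c (snd q) * (- ((- 1) powi int N) * fsum (\<lambda>i. ibin (d (fst q) - m - 1 - int N) i *
          \<alpha> (YW (Y (eu (fst q)) (int N + int i) (ev (snd q))) (d (fst q) - m - 1 - int N + (d (snd q) - n - 1 - int N) - int i) w))) = 0"
      by (simp add: linD[OF YWlinu] linD[OF a])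
  qed
  then show ?thesis using local_of_Dcf[OF GH_fins] by blast
qed

text \<open>The component form of \<open>e\<^bsup>xL(1)\<^esup> Y(u, x\<^sub>0) e\<^bsup>-xL(1)\<^esup> = Y(e\<^bsup>x(1 - x x\<^sub>0)L(1)\<^esup> (1 - x x\<^sub>0)\<^bsup>-2L(0)\<^esup> u, x\<^sub>0/(1 - x x\<^sub>0))\<close>.\<close>

lemma conj_formula:
  assumes u: "u \<in> hom k"
  shows "Vector_Spaces.linear scV (*) \<phi> \<Longrightarrow> \<phi> ((L1 ^^ N) (Y u n v)) / fact N
    = (\<Sum>(i, j, s)\<in>triples N. conj_coef (2 * k - n - 2) i j s * \<phi> (Y ((L1 ^^ j) u) (n + int s) ((L1 ^^ i) v)))"
proof (induction N arbitrary: \<phi>)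
  case 0
  have "triples 0 = {(0, 0, 0)}" by (auto simp: triples_def)
  then show ?case by (simp add: conj_coef_def)
next
  case (Suc N)
  note lp = Suc.prems
  let ?F = "\<lambda>i j s. \<phi> (Y ((L1 ^^ j) u) (n + int s) ((L1 ^^ i) v))"
  have L1l: "Vector_Spaces.linear scV scV L1" unfolding L1_def by (rule Ylin)
  have lp': "Vector_Spaces.linear scV (*) (\<lambda>x. \<phi> (L1 x))"
    by (rule linI[OF Vvs vs_complex]) (simp add: linD[OF lp] linD[OF L1l])
  have st: "\<phi> (L1 (Y ((L1 ^^ j) u) (n + int s) ((L1 ^^ i) v)))
    = ?F (Suc i) j s + ?F i (Suc j) s + of_int ((2 * k - n - 2) - 2 * int j - int s) * ?F i j (Suc s)" for i j s
  proof -
    have e: "n + int s + 1 = n + int (Suc s)" "2 * (k - int j) - (n + int s) - 2 = (2 * k - n - 2) - 2 * int j - int s" by simp_all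
    show ?thesis unfolding L1_Y[OF hom_L1_pow[OF u, of j], of "n + int s" "(L1 ^^ i) v"] linD[OF lp] e
      by (simp only: funpow.simps o_apply)
  qed
  have "of_nat (Suc N) * (\<phi> ((L1 ^^ Suc N) (Y u n v)) / fact (Suc N)) = \<phi> (L1 ((L1 ^^ N) (Y u n v))) / fact N"
    by (simp add: field_simps del: of_nat_Suc)
  also have "\<dots> = (\<Sum>(i, j, s)\<in>triples N. conj_coef (2 * k - n - 2) i j s * \<phi> (L1 (Y ((L1 ^^ j) u) (n + int s) ((L1 ^^ i) v))))"
    by (rule Suc.IH[OF lp'])
  also have "\<dots> = of_nat (Suc N) * (\<Sum>(i, j, s)\<in>triples (Suc N). conj_coef (2 * k - n - 2) i j s * ?F i j s)"
    unfolding triples_sum_rec st ..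
  finally show ?case by (rule iffD1[OF mult_left_cancel[OF of_nat_neq_0]])
qed

text \<open>Summing \<open>conj_formula\<close> over \<open>s\<close> gives the right-hand side of the Jacobi identity on \<open>W\<close> with \<open>m\<close> replaced by
\<open>2k - j - l - 2\<close>; its left-hand side is the opposite one.\<close>

lemma X_jac_hom:
  assumes a: "lin \<alpha>" and u: "u \<in> hom k" and v: "v \<in> hom k'"
  shows "\<alpha> (X (Y u l v) p w) = Jcf l (GG \<alpha> w u v) (HH \<alpha> w u v) p"
proof -
  define \<kappa> where "\<kappa> = k + k' - l - 1"
  have uv: "Y u l v \<in> hom \<kappa>" unfolding \<kappa>_def by (rule hom_Y[OF u v])
  define I where "I = nil_bound k'"
  define J where "J = nil_bound k"
  define eu where "eu = (\<lambda>j. (L1 ^^ j) u)"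
  define ev where "ev = (\<lambda>i. (L1 ^^ i) v)"
  have eu0: "eu j = 0" if "j \<ge> J" for j using L1_nil[OF u] that by (simp add: eu_def J_def)
  have ev0: "ev j = 0" if "j \<ge> I" for j using L1_nil[OF v] that by (simp add: ev_def I_def)
  have "\<forall>i j. \<exists>N. \<forall>n\<ge>N. Y (eu j) n (ev i) = 0" by (intro allI Ytr)
  then obtain Nf where Nf: "\<And>i j n. n \<ge> Nf i j \<Longrightarrow> Y (eu j) n (ev i) = 0" unfolding choice_iff by blast
  define s0 where "s0 = nat (Max (insert 0 ((\<lambda>q. Nf (fst q) (snd q) - l) ` ({..<I} \<times> {..<J}))))"
  have s0: "Nf i j \<le> l + int s" if "i < I" "j < J" "s \<ge> s0" for i j s
  proof -
    have "Nf (fst (i, j)) (snd (i, j)) - l \<le> Max (insert 0 ((\<lambda>q. Nf (fst q) (snd q) - l) ` ({..<I} \<times> {..<J})))"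
      by (rule Max_ge) (use that in force)+
    then show ?thesis using that unfolding s0_def by simp
  qed
  define h where "h = (\<lambda>(i, j, s). conj_coef (2 * k - l - 2) i j s * \<alpha> (YW (Y (eu j) (l + int s) (ev i)) (p + 2 * \<kappa> - 1 - int i - int j - int s) w))"
  define B where "B = {..<I} \<times> {..<J} \<times> {..<s0}"
  \<comment> \<open>Covers all degrees N in which L(1)^N need not kill u_l v, and all triples of the
    box B.\<close>
  define M where "M = max (nil_bound \<kappa>) (I + J + s0)"
  have h0: "h x = 0" if "x \<notin> B" for x
  proof -
    obtain i j s where x: "x = (i, j, s)" by (cases x) auto
    have "i \<ge> I \<or> j \<ge> J \<or> i < I \<and> j < J \<and> s \<ge> s0" using that unfolding x B_def by auto
    then consider "i \<ge> I" | "j \<ge> J" | "i < I" "j < J" "s \<ge> s0" by blast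
    then show ?thesis
    proof cases
      case 3
      then show ?thesis using Nf[OF s0[OF 3]] unfolding x h_def by (simp add: linD[OF YWlinu] linD[OF a])
    qed (auto simp: x h_def eu0 ev0 linD[OF Ylin] linD[OF Ylinu] linD[OF YWlinu] linD[OF a])
  qed
  let ?b = "\<lambda>i j. \<lambda>s. ibin (dd k j - 0 - 1 - l) s * \<alpha> (YW (Y (eu j) (l + int s) (ev i)) ((dd k j - 0 - 1 - l) + (dd k' i - (- p - 1) - 1 - l) - int s) w)"
  have lphi: "Vector_Spaces.linear scV (*) (\<lambda>x. \<alpha> (YW x q w))" for q
    by (rule linI[OF Vvs vs_complex]) (simp add: linD[OF YWlinu] linD[OF a])
  have "\<alpha> (X (Y u l v) p w) = (\<Sum>N<M. cf \<kappa> N * \<alpha> (YW ((L1 ^^ N) (Y u l v)) (p + dd \<kappa> N) w))"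
    by (subst X_hom[OF uv, of M]) (auto simp: M_def lin_sum[OF a] linD[OF a])
  also have "\<dots> = (\<Sum>N<M. (-1) powi \<kappa> * (\<Sum>x\<in>triples N. h x))"
  proof (rule sum.cong[OF refl])
    fix N
    have "cf \<kappa> N * \<alpha> (YW ((L1 ^^ N) (Y u l v)) (p + dd \<kappa> N) w) = (-1) powi \<kappa> * (\<alpha> (YW ((L1 ^^ N) (Y u l v)) (p + dd \<kappa> N) w) / fact N)"
      by (simp add: cf_def)
    also have "\<dots> = (-1) powi \<kappa> * (\<Sum>(i, j, s)\<in>triples N. conj_coef (2 * k - l - 2) i j s * \<alpha> (YW (Y ((L1 ^^ j) u) (l + int s) ((L1 ^^ i) v)) (p + dd \<kappa> N) w))"
      by (subst conj_formula[OF u lphi]) (rule refl)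
    also have "(\<Sum>(i, j, s)\<in>triples N. conj_coef (2 * k - l - 2) i j s * \<alpha> (YW (Y ((L1 ^^ j) u) (l + int s) ((L1 ^^ i) v)) (p + dd \<kappa> N) w)) = (\<Sum>x\<in>triples N. h x)"
      by (rule sum.cong) (auto simp: triples_def h_def eu_def ev_def dd_def algebra_simps)
    finally show "cf \<kappa> N * \<alpha> (YW ((L1 ^^ N) (Y u l v)) (p + dd \<kappa> N) w) = (-1) powi \<kappa> * (\<Sum>x\<in>triples N. h x)" .
  qed
  also have "\<dots> = (-1) powi \<kappa> * (\<Sum>x\<in>(\<Union>N<M. triples N). h x)"
    unfolding sum_distrib_left[symmetric] by (subst sum.UNION_disjoint) (simp_all, auto simp: triples_def)
  also have "(\<Sum>x\<in>(\<Union>N<M. triples N). h x) = (\<Sum>x\<in>B. h x)"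
  proof (rule sum.mono_neutral_right)
    show "B \<subseteq> (\<Union>N<M. triples N)" by (auto simp: B_def triples_def M_def)
  qed (auto simp: h0)
  also have "\<dots> = (\<Sum>i<I. \<Sum>j<J. \<Sum>s<s0. h (i, j, s))"
    unfolding B_def by (simp add: sum.cartesian_product case_prod_unfold)
  also have "\<dots> = (\<Sum>i<I. \<Sum>j<J. 1 / (fact i * fact j) * fsum (?b i j))"
  proof (intro sum.cong refl)
    fix i j assume ij: "i \<in> {..<I}" "j \<in> {..<J}"
    have "fsum (?b i j)
      = (\<Sum>s<s0. ?b i j s)"
      by (rule fsum_eq) (use ij Nf s0 in \<open>simp add: linD[OF YWlinu] linD[OF a]\<close>)
    then show "(\<Sum>s<s0. h (i, j, s)) = 1 / (fact i * fact j) * fsum (?b i j)"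
      by (simp add: h_def conj_coef_def sum_distrib_left \<kappa>_def dd_def algebra_simps)
  qed
  also have "(-1) powi \<kappa> * \<dots> = (\<Sum>j<J. \<Sum>i<I. (cf k j * cf k' i) * (- ((-1) powi l) * fsum (?b i j)))"
  proof -
    have "inverse ((-1::complex) powi l) = (-1) powi l" by (simp add: power_int_inverse[symmetric])
    \<comment> \<open>The parity of \<open>\<kappa>\<close> = k + k' - l - 1 yields exactly the sign
      of the exchange in \<open>gh_Dcf\<close>.\<close>
    then have sg: "(-1::complex) powi \<kappa> = (-1) powi k * (-1) powi k' * (- ((-1) powi l))"
      unfolding \<kappa>_def by (simp add: power_int_diff power_int_add divide_inverse)
    show ?thesis unfolding sg sum_distrib_left
      by (subst sum.swap, intro sum.cong refl) (simp add: cf_def mult_ac)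
  qed
  also have "\<dots> = Dcf l 0 (- p - 1) (GG \<alpha> w u v) (HH \<alpha> w u v)"
    by (subst GH_Dcf[OF a, where S = "{..<J}" and S' = "{..<I}" and cu = "cf k" and cv = "cf k'" and eu = eu and ev = ev and du = "dd k" and dv = "dd k'"])
      (auto simp: sum.cartesian_product case_prod_unfold X_hom[OF u, of J] X_hom[OF v, of I] I_def J_def eu_def ev_def)
  finally show ?thesis by (simp add: Jcf_def)
qed

lemma X_jac:
  assumes a: "lin \<alpha>"
  shows "\<alpha> (X (Y u l v) p w) = Jcf l (GG \<alpha> w u v) (HH \<alpha> w u v) p"
proof -
  define Q where "Q = (\<lambda>u v. \<alpha> (X (Y u l v) p w) = Jcf l (GG \<alpha> w u v) (HH \<alpha> w u v) p)"
  have Qu: "Q (u1 + u2) v" if "Q u1 v" "Q u2 v" for u1 u2 v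
  proof -
    have "GG \<alpha> w (u1 + u2) v = (\<lambda>a b. 1 * GG \<alpha> w u1 v a b + GG \<alpha> w u2 v a b)"
      "HH \<alpha> w (u1 + u2) v = (\<lambda>a b. 1 * HH \<alpha> w u1 v a b + HH \<alpha> w u2 v a b)"
      by (auto simp: GG_def HH_def fun_eq_iff linD[OF X_linv] linD[OF X_lin] linD[OF a])
    then show ?thesis using that Dcf_lin[OF GH_fins GH_fins, OF a a, of l 0 "- p - 1" 1 w u1 v w u2 v]
      by (simp add: Q_def Jcf_def linD[OF X_linv] linD[OF Ylinu] linD[OF a])
  qed
  have Qv: "Q u (v1 + v2)" if "Q u v1" "Q u v2" for u v1 v2
  proof -
    have "GG \<alpha> w u (v1 + v2) = (\<lambda>a b. 1 * GG \<alpha> w u v1 a b + GG \<alpha> w u v2 a b)"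
      "HH \<alpha> w u (v1 + v2) = (\<lambda>a b. 1 * HH \<alpha> w u v1 a b + HH \<alpha> w u v2 a b)"
      by (auto simp: GG_def HH_def fun_eq_iff linD[OF X_linv] linD[OF X_lin] linD[OF a])
    then show ?thesis using that Dcf_lin[OF GH_fins GH_fins, OF a a, of l 0 "- p - 1" 1 w u v1 w u v2]
      by (simp add: Q_def Jcf_def linD[OF X_linv] linD[OF Ylin] linD[OF a])
  qed
  have Q1: "Q (\<Sum>k\<in>K. c k) (d k')" if "finite K" "\<And>k. c k \<in> hom k" "\<And>k. d k \<in> hom k" for K c and d and k' :: int
    using that(1)
  proof (induction K rule: finite_induct)
    case empty
    show ?case unfolding Q_def using X_jac_hom[OF a hom0 that(3)] by simp
  next
    case (insert k K)
    have "Q (c k) (d k')" unfolding Q_def by (rule X_jac_hom[OF a that(2) that(3)])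
    then show ?case using Qu insert by simp
  qed
  have Q2: "Q (\<Sum>k\<in>K. c k) (\<Sum>k\<in>K'. d k)" if "finite K" "finite K'" "\<And>k. c k \<in> hom k" "\<And>k. d k \<in> hom k" for K K' :: "int set" and c d
    using that(2)
  proof (induction K' rule: finite_induct)
    case empty
    show ?case using Q1[of K c "\<lambda>_. 0"] that hom0 by simp
  next
    case (insert k K')
    then show ?case using Qv Q1[OF that(1,3,4)] by simp
  qed
  have "Q u v" using Q2[OF wt_comp_spec(1)[of u] wt_comp_spec(1)[of v] wt_comp_spec(2)[of u] wt_comp_spec(2)[of v]]
    unfolding wt_comp_spec(3)[of u, symmetric] wt_comp_spec(3)[of v, symmetric] .
  then show ?thesis by (simp add: Q_def)
qed

section \<open>Transfer to the given definitions\<close>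

sublocale op: oppmod scV Y vac scW X z
proof (rule oppmod.intro)
  show "Vector_Spaces.linear scW scW (X v p)" for v p by (rule X_lin)
  show "Vector_Spaces.linear scV scW (\<lambda>v. X v p w)" for p w by (rule X_linv)
  show "\<exists>U. \<forall>p>U. X v p w = 0" for v w by (rule X_high)
  show "X vac p w = (if p = 0 then w else 0)" for p w by (rule X_vac)
  show "\<exists>N. \<forall>n\<ge>N. Y u n v = 0" for u v by (rule Ytr)
  show "\<exists>N. \<forall>\<alpha> w. lin \<alpha> \<longrightarrow> (m12 0 ^^ N) (\<lambda>a b. \<alpha> (X v b (X u a w))) = (m12 0 ^^ N) (\<lambda>a b. \<alpha> (X u a (X v b w)))" for u v
    using X_loc[of u v] by (simp add: GG_def HH_def)
  show "lin \<alpha> \<Longrightarrow> \<alpha> (X (Y u l v) p w) = Jcf l (\<lambda>a b. \<alpha> (X v b (X u a w))) (\<lambda>a b. \<alpha> (X u a (X v b w))) p" for \<alpha> u l v p w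
    using X_jac[of \<alpha> u l v p w] by (simp add: GG_def HH_def)
  show "z \<noteq> 0" by (rule z0)
qed

lemma Dz_eq: "Dz scV Y om scW YW z = op.D"
  unfolding Dz_def Pz_linear_def X_def[symmetric] op.D_eq[symmetric] op.D_conv_def ..

lemma YR_eq: "\<alpha> \<in> op.D \<Longrightarrow> YR scV Y om scW YW z v n \<alpha> = op.Op 0 v n \<alpha>"
  unfolding YR_def fvaw_def X_def[symmetric] op.rat_fun_def[symmetric] by (intro ext) (rule op.iota_R)

lemma YL_eq: "\<alpha> \<in> op.D \<Longrightarrow> YL scV Y om scW YW z v n \<alpha> = op.Op z v n \<alpha>"
  unfolding YL_def fvaw_def X_def[symmetric] op.rat_fun_def[symmetric] by (intro ext) (rule op.iota_L)

lemma YPz_eq: "\<alpha> \<in> op.D \<Longrightarrow> YPz scV Y om scW YW z a k \<alpha> = op.YP a k \<alpha>"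
  unfolding YPz_def op.YP_def by (simp add: YR_eq YL_eq op.LR_D)

end

theorem theorem3p25:
  fixes scV :: "complex \<Rightarrow> 'v::ab_group_add \<Rightarrow> 'v"
    and Y :: "'v \<Rightarrow> int \<Rightarrow> 'v \<Rightarrow> 'v"
    and vac om :: 'v
    and scW :: "complex \<Rightarrow> 'w::ab_group_add \<Rightarrow> 'w"
    and YW :: "'v \<Rightarrow> int \<Rightarrow> 'w \<Rightarrow> 'w"
    and z :: complex
  assumes "voa scV Y vac om"
    and "weak_module scV Y vac scW YW"
    and "z \<noteq> 0"
  shows "(\<forall>v n. \<forall>\<alpha>\<in>Dz scV Y om scW YW z. YR scV Y om scW YW z v n \<alpha> \<in> Dz scV Y om scW YW z)
       \<and> (\<forall>u v k. \<forall>\<alpha>\<in>Dz scV Y om scW YW z. \<forall>w.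
            finite {i. YL scV Y om scW YW z u i (YR scV Y om scW YW z v (-k-1-i) \<alpha>) w \<noteq> 0})
       \<and> weak_tensor_module scV Y vac (Dz scV Y om scW YW z) (YPz scV Y om scW YW z)"
proof -
  interpret voamod scV Y vac om scW YW z by unfold_locales fact+
  \<comment> \<open>The module axioms are evaluated only on functionals in D, where
    \<open>YPz\<close> coincides with the algebraic \<open>YP\<close>.\<close>
  have t: "tensor_mode_op Y (YPz scV Y om scW YW z) a b k j \<alpha> = tensor_mode_op Y op.YP a b k j \<alpha>" if "\<alpha> \<in> op.D" for a b k j \<alpha>
    unfolding tensor_mode_op_def YPz_eq[OF that] ..
  have "weak_tensor_module scV Y vac op.D (YPz scV Y om scW YW z)"
    using op.tensor_module unfolding weak_tensor_module_def
    by (simp add: YPz_eq t op.YP_D op.D_add)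
  then show ?thesis unfolding Dz_eq using op.LR_finite by (simp add: YR_eq YL_eq op.LR_D)
qed

end
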